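(* Let $w\in A_s$, let $\mathcal A$ satisfy the structural conditions listed in the context, and let $f\in L^1(\Omega)$, $f\ge0$, $f\not\equiv0$. Let $u$ be the weak solution in $X=W_0^{1,p}(\Omega,w)$ of (the case $\delta=1$) $$-\operatorname{div}(\mathcal A(x,\nabla u))=\frac{f(x)}{u}\ \text{in }\Omega,\qquad u>0\ \text{in }\Omega,\qquad u=0\ \text{on }\partial\Omega$$ obtained as the limit of the approximating solutions $u_n$ (see context). Then: (a) Suppose $1\le p_s<N$. (i) If $f\in L^m(\Omega)$ for some $m\in\left(1,\frac{p_s^*}{p_s^*-p}\right)$, then $u\in L^t(\Omega)$ with $t=p_s^*\gamma$, where $\gamma=\frac{pm'}{pm'-p_s^*}$. (ii) If $f\in L^m(\Omega)$ for some $m>\frac{p_s^*}{p_s^*-p}$, then $u\in L^\infty(\Omega)$. (b) Suppose $p_s=N$ and let $q>p$. If $f\in L^m(\Omega)$ for some $m\in\left(1,\frac q{q-p}\right)$, then $u\in L^t(\Omega)$ with $t=q\gamma$, where $\gamma=\frac{pm'}{pm'-q}$. (c) If $p_s>N$ and $f\in L^1(\Omega)$, then $u\in L^\infty(\Omega)$.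
   Context: Setting: $N\ge 2$, $\Omega\subset\mathbb R^N$ is a bounded smooth domain, $1<p<\infty$. Weights: a locally integrable $w:\mathbb R^N\to(0,\infty)$ (with $0<w<\infty$ a.e.) belongs to $A_p$ if there is $c_{p,w}>0$ such that $\left(\frac1{|B|}\int_B w\,dx\right)\left(\frac1{|B|}\int_B w^{-\frac1{p-1}}dx\right)^{p-1}\le c_{p,w}$ for all balls $B\subset\mathbb R^N$. Fix $s\in[\frac1{p-1},\infty)\cap(\frac Np,\infty)$; $w\in A_s$ means $w\in A_p$ and $w^{-s}\in L^1(\Omega)$. Set $p_s=\frac{ps}{s+1}\in[1,p)$ and, if $p_s<N$, $p_s^*=\frac{Np_s}{N-p_s}$ (then $p_s^*>p$). For an exponent $r$, $r'$ is the Hölder conjugate. Spaces: $W^{1,p}(\Omega,w)$ is the space of (weakly differentiable) measurable $u$ with $\|u\|_{1,p,w}=(\int_\Omega|u|^pw\,dx)^{1/p}+(\int_\Omega|\nabla u|^pw\,dx)^{1/p}<\infty$; $X=W^{1,p}_0(\Omega,w)$ is the closure of $C_c^\infty(\Omega)$ in it, and $\left(\int_\Omega|\nabla u|^pw\,dx\right)^{1/p}$ is an equivalent norm on $X$. $u\in W^{1,p}_{loc}(\Omega,w)$ means $u\in W^{1,p}(\Omega',w)$ for every $\Omega'\Subset\Omega$. Operator: $\mathcal A:\Omega\times\mathbb R^N\to\mathbb R^N$ is Carathéodory ($\mathcal A(\cdot,\zeta)$ measurable for every $\zeta$; $\mathcal A(x,\cdot)$ continuous for a.e. $x$), and for a.e.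 $x\in\Omega$ and all vectors in $\mathbb R^N$: (growth) $|\mathcal A(x,\zeta)|\le|\zeta|^{p-1}w(x)$; (degeneracy) $\mathcal A(x,\zeta)\cdot\zeta\ge|\zeta|^pw(x)$; (homogeneity) $\mathcal A(x,t\zeta)=t|t|^{p-2}\mathcal A(x,\zeta)$ for $t\in\mathbb R\setminus\{0\}$; (strong monotonicity) with $\gamma_0=\max\{p,2\}$ and some constant $c>0$, for $\zeta_1\ne\zeta_2$, $\langle\mathcal A(x,\zeta_1)-\mathcal A(x,\zeta_2),\zeta_1-\zeta_2\rangle\ge c|\zeta_1-\zeta_2|^{\gamma_0}\{\overline{\mathcal A}(x,\zeta_1,\zeta_2)\}^{1-\frac{\gamma_0}p}w(x)$, where $\overline{\mathcal A}(x,\zeta_1,\zeta_2)=\frac1{w(x)}(\langle\mathcal A(x,\zeta_1),\zeta_1\rangle+\langle\mathcal A(x,\zeta_2),\zeta_2\rangle)$. Weak solution (with $\delta=1$): $u\in W^{1,p}_{loc}(\Omega,w)$ is a weak solution of the problem if for every $K\Subset\Omega$ there is $c_K>0$ with $u\ge c_K$ in $K$; for all $\phi\in C_c^1(\Omega)$, $\int_\Omega\mathcal A(x,\nabla u)\cdot\nabla\phi\,dx=\int_\Omega\frac{f}{u}\phi\,dx$; $u>0$ in $\Omega$; and $u=0$ on $\partial\Omega$ in the sense that $u^\alpha\in X$ for some $\alpha\ge1$. Approximating solutions: for $n\in\mathbb N$ let $f_n=\min\{f,n\}$. There is a unique $u_n\in X\cap L^\infty(\Omega)$ with $u_n>0$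 in $\Omega$ and $\int_\Omega\mathcal A(x,\nabla u_n)\cdot\nabla\phi\,dx=\int_\Omega\frac{f_n}{u_n+\frac1n}\phi\,dx$ for all $\phi\in X$; moreover $u_n\le u_{n+1}$. The solution $u$ in the claim is the pointwise a.e. limit of $u_n$, which is a weak solution in $X$ for every nonnegative $f\in L^1(\Omega)$, $f\not\equiv 0$. *)

theory Defs
  imports "HOL-Analysis.Analysis"
begin

text \<open>
  Functions on an open set \<open>\<Omega>\<close> are represented by total functions; only their values on \<open>\<Omega>\<close> matter.
  All integrals over \<open>\<Omega>\<close> are Lebesgue integrals with respect to \<open>lebesgue_on \<Omega>\<close>.
\<close>

section \<open>Differentiability classes and smooth domains\<close>

text \<open>To be used with an open set \<open>S\<close>.\<close>

primrec Ck_on :: "nat \<Rightarrow> 'a::euclidean_space set \<Rightarrow> ('a \<Rightarrow> 'b::real_normed_vector) \<Rightarrow> bool" where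
  "Ck_on 0 S f \<longleftrightarrow> continuous_on S f"
| "Ck_on (Suc k) S f \<longleftrightarrow>
     (\<forall>x\<in>S. f differentiable at x) \<and> (\<forall>v. Ck_on k S (\<lambda>x. frechet_derivative f (at x) v))"

definition smooth_on :: "'a::euclidean_space set \<Rightarrow> ('a \<Rightarrow> 'b::real_normed_vector) \<Rightarrow> bool" where
  "smooth_on S f \<longleftrightarrow> (\<forall>k. Ck_on k S f)"

definition grad :: "('a::euclidean_space \<Rightarrow> real) \<Rightarrow> 'a \<Rightarrow> 'a" where
  "grad \<phi> x = (\<Sum>e\<in>Basis. frechet_derivative \<phi> (at x) e *\<^sub>R e)"

definition compactly_inside :: "'a::euclidean_space set \<Rightarrow> 'a set \<Rightarrow> bool" where
  "compactly_inside K \<Omega> \<longleftrightarrow> compact (closure K) \<and> closure K \<subseteq> \<Omega>"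

text \<open>Compactly supported functions on \<open>\<Omega>\<close> are taken to be extended by zero to the whole space.\<close>

definition Cc1 :: "'a::euclidean_space set \<Rightarrow> ('a \<Rightarrow> real) set" where
  "Cc1 \<Omega> = {\<phi>. Ck_on 1 UNIV \<phi> \<and> compactly_inside {x. \<phi> x \<noteq> 0} \<Omega>}"

definition Cc_inf :: "'a::euclidean_space set \<Rightarrow> ('a \<Rightarrow> real) set" where
  "Cc_inf \<Omega> = {\<phi>. smooth_on UNIV \<phi> \<and> compactly_inside {x. \<phi> x \<noteq> 0} \<Omega>}"

text \<open>The boundary is smooth if near each of its points it can be straightened by a smooth
  diffeomorphism that maps \<open>\<Omega>\<close> to one side of a coordinate hyperplane.\<close>

definition bounded_smooth_domain :: "'a::euclidean_space set \<Rightarrow> bool" where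
  "bounded_smooth_domain \<Omega> \<longleftrightarrow>
     open \<Omega> \<and> connected \<Omega> \<and> \<Omega> \<noteq> {} \<and> bounded \<Omega> \<and>
     (\<forall>x\<in>frontier \<Omega>. \<exists>U (V :: 'a set) \<psi> \<psi>'. \<exists>e\<in>Basis.
        open U \<and> x \<in> U \<and> open V \<and> homeomorphism U V \<psi> \<psi>' \<and>
        smooth_on U \<psi> \<and> smooth_on V \<psi>' \<and>
        \<psi> ` (U \<inter> \<Omega>) = V \<inter> {y. y \<bullet> e > 0} \<and>
        \<psi> ` (U \<inter> frontier \<Omega>) = V \<inter> {y. y \<bullet> e = 0})"


section \<open>Lebesgue spaces and weights\<close>

definition Lp_weighted ::
    "'a::euclidean_space set \<Rightarrow> ('a \<Rightarrow> real) \<Rightarrow> real \<Rightarrow> ('a \<Rightarrow> 'b::euclidean_space) set" where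
  "Lp_weighted \<Omega> w r = {u. u \<in> borel_measurable (lebesgue_on \<Omega>) \<and>
                          integrable (lebesgue_on \<Omega>) (\<lambda>x. norm (u x) powr r * w x)}"

definition Lp :: "'a::euclidean_space set \<Rightarrow> real \<Rightarrow> ('a \<Rightarrow> real) set" where
  "Lp \<Omega> r = Lp_weighted \<Omega> (\<lambda>_. 1) r"

definition Linf :: "'a::euclidean_space set \<Rightarrow> ('a \<Rightarrow> real) set" where
  "Linf \<Omega> = {u. u \<in> borel_measurable (lebesgue_on \<Omega>) \<and> (\<exists>C. AE x in lebesgue_on \<Omega>. \<bar>u x\<bar> \<le> C)}"

definition locally_integrable ::
    "'a::euclidean_space set \<Rightarrow> ('a \<Rightarrow> 'b::euclidean_space) \<Rightarrow> bool" where
  "locally_integrable \<Omega> u \<longleftrightarrow> (\<forall>K. compact K \<and> K \<subseteq> \<Omega> \<longrightarrow> u absolutely_integrable_on K)"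

definition avg_ball :: "('a::euclidean_space \<Rightarrow> real) \<Rightarrow> 'a \<Rightarrow> real \<Rightarrow> real" where
  "avg_ball h x r = (LINT y|lebesgue_on (ball x r). h y) / measure lebesgue (ball x r)"

text \<open>The Bochner integral of a non-integrable function is \<open>0\<close>, so finiteness of the second
  average, which is implicit in the usual inequality, is stated explicitly.\<close>

definition muckenhoupt :: "real \<Rightarrow> ('a::euclidean_space \<Rightarrow> real) \<Rightarrow> bool" where
  "muckenhoupt p w \<longleftrightarrow>
     locally_integrable UNIV w \<and> (AE x in lebesgue. 0 < w x) \<and>
     (\<exists>c>0. \<forall>x. \<forall>r>0.
        integrable (lebesgue_on (ball x r)) (\<lambda>y. w y powr (- 1 / (p - 1))) \<and>
        avg_ball w x r * avg_ball (\<lambda>y. w y powr (- 1 / (p - 1))) x r powr (p - 1) \<le> c)"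

definition weight_class ::
    "'a::euclidean_space set \<Rightarrow> real \<Rightarrow> real \<Rightarrow> ('a \<Rightarrow> real) \<Rightarrow> bool" where
  "weight_class \<Omega> p s w \<longleftrightarrow>
     muckenhoupt p w \<and> integrable (lebesgue_on \<Omega>) (\<lambda>x. w x powr (- s))"


section \<open>Weighted Sobolev spaces\<close>

definition has_weak_gradient ::
    "'a::euclidean_space set \<Rightarrow> ('a \<Rightarrow> real) \<Rightarrow> ('a \<Rightarrow> 'a) \<Rightarrow> bool" where
  "has_weak_gradient \<Omega> u g \<longleftrightarrow>
     locally_integrable \<Omega> u \<and> locally_integrable \<Omega> g \<and>
     (\<forall>\<phi>\<in>Cc_inf \<Omega>. (LINT x|lebesgue_on \<Omega>. u x *\<^sub>R grad \<phi> x)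
                   = - (LINT x|lebesgue_on \<Omega>. \<phi> x *\<^sub>R g x))"

definition weakly_differentiable :: "'a::euclidean_space set \<Rightarrow> ('a \<Rightarrow> real) \<Rightarrow> bool" where
  "weakly_differentiable \<Omega> u \<longleftrightarrow> (\<exists>g. has_weak_gradient \<Omega> u g)"

text \<open>A representative of the weak gradient, which is unique up to null sets.\<close>

definition wgrad :: "'a::euclidean_space set \<Rightarrow> ('a \<Rightarrow> real) \<Rightarrow> 'a \<Rightarrow> 'a" where
  "wgrad \<Omega> u = (SOME g. has_weak_gradient \<Omega> u g)"

definition W1p ::
    "'a::euclidean_space set \<Rightarrow> ('a \<Rightarrow> real) \<Rightarrow> real \<Rightarrow> ('a \<Rightarrow> real) set" where
  "W1p \<Omega> w p = {u. weakly_differentiable \<Omega> u \<and>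
                   u \<in> Lp_weighted \<Omega> w p \<and> wgrad \<Omega> u \<in> Lp_weighted \<Omega> w p}"

definition W1p_norm ::
    "'a::euclidean_space set \<Rightarrow> ('a \<Rightarrow> real) \<Rightarrow> real \<Rightarrow> ('a \<Rightarrow> real) \<Rightarrow> real" where
  "W1p_norm \<Omega> w p u =
     (LINT x|lebesgue_on \<Omega>. \<bar>u x\<bar> powr p * w x) powr (1 / p) +
     (LINT x|lebesgue_on \<Omega>. norm (wgrad \<Omega> u x) powr p * w x) powr (1 / p)"

definition W01p ::
    "'a::euclidean_space set \<Rightarrow> ('a \<Rightarrow> real) \<Rightarrow> real \<Rightarrow> ('a \<Rightarrow> real) set" where
  "W01p \<Omega> w p =
     {u \<in> W1p \<Omega> w p. \<forall>\<epsilon>>0. \<exists>\<phi>\<in>Cc_inf \<Omega>. W1p_norm \<Omega> w p (\<lambda>x. u x - \<phi> x) < \<epsilon>}"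

definition W1p_loc ::
    "'a::euclidean_space set \<Rightarrow> ('a \<Rightarrow> real) \<Rightarrow> real \<Rightarrow> ('a \<Rightarrow> real) set" where
  "W1p_loc \<Omega> w p = {u. \<forall>\<Omega>'. open \<Omega>' \<and> compactly_inside \<Omega>' \<Omega> \<longrightarrow> u \<in> W1p \<Omega>' w p}"


section \<open>The operator and its solutions\<close>

definition caratheodory :: "'a::euclidean_space set \<Rightarrow> ('a \<Rightarrow> 'a \<Rightarrow> 'a) \<Rightarrow> bool" where
  "caratheodory \<Omega> A \<longleftrightarrow>
     (\<forall>\<zeta>. (\<lambda>x. A x \<zeta>) \<in> borel_measurable (lebesgue_on \<Omega>)) \<and>
     (AE x in lebesgue_on \<Omega>. continuous_on UNIV (A x))"

definition A_bar :: "('a::euclidean_space \<Rightarrow> real) \<Rightarrow> ('a \<Rightarrow> 'a \<Rightarrow> 'a) \<Rightarrow> 'a \<Rightarrow> 'a \<Rightarrow> 'a \<Rightarrow> real" where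
  "A_bar w A x \<zeta>1 \<zeta>2 = (A x \<zeta>1 \<bullet> \<zeta>1 + A x \<zeta>2 \<bullet> \<zeta>2) / w x"

definition strongly_monotone ::
    "'a::euclidean_space set \<Rightarrow> ('a \<Rightarrow> real) \<Rightarrow> real \<Rightarrow> ('a \<Rightarrow> 'a \<Rightarrow> 'a) \<Rightarrow> bool" where
  "strongly_monotone \<Omega> w p A \<longleftrightarrow>
     (let \<gamma>0 = max p 2 in
      \<exists>c>0. AE x in lebesgue_on \<Omega>. \<forall>\<zeta>1 \<zeta>2. \<zeta>1 \<noteq> \<zeta>2 \<longrightarrow>
        (A x \<zeta>1 - A x \<zeta>2) \<bullet> (\<zeta>1 - \<zeta>2)
          \<ge> c * norm (\<zeta>1 - \<zeta>2) powr \<gamma>0 * A_bar w A x \<zeta>1 \<zeta>2 powr (1 - \<gamma>0 / p) * w x)"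

definition structural_conditions ::
    "'a::euclidean_space set \<Rightarrow> ('a \<Rightarrow> real) \<Rightarrow> real \<Rightarrow> ('a \<Rightarrow> 'a \<Rightarrow> 'a) \<Rightarrow> bool" where
  "structural_conditions \<Omega> w p A \<longleftrightarrow>
     caratheodory \<Omega> A \<and>
     (AE x in lebesgue_on \<Omega>. \<forall>\<zeta>. norm (A x \<zeta>) \<le> norm \<zeta> powr (p - 1) * w x) \<and>
     (AE x in lebesgue_on \<Omega>. \<forall>\<zeta>. A x \<zeta> \<bullet> \<zeta> \<ge> norm \<zeta> powr p * w x) \<and>
     (AE x in lebesgue_on \<Omega>. \<forall>\<zeta> t. t \<noteq> 0 \<longrightarrow> A x (t *\<^sub>R \<zeta>) = (t * \<bar>t\<bar> powr (p - 2)) *\<^sub>R A x \<zeta>) \<and>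
     strongly_monotone \<Omega> w p A"

definition weak_solution ::
    "'a::euclidean_space set \<Rightarrow> ('a \<Rightarrow> real) \<Rightarrow> real \<Rightarrow> ('a \<Rightarrow> 'a \<Rightarrow> 'a) \<Rightarrow> ('a \<Rightarrow> real) \<Rightarrow>
     ('a \<Rightarrow> real) \<Rightarrow> bool" where
  "weak_solution \<Omega> w p A f u \<longleftrightarrow>
     u \<in> W1p_loc \<Omega> w p \<and>
     (\<forall>K. compactly_inside K \<Omega> \<longrightarrow> (\<exists>c>0. AE x in lebesgue_on \<Omega>. x \<in> K \<longrightarrow> u x \<ge> c)) \<and>
     (\<forall>\<phi>\<in>Cc1 \<Omega>. (LINT x|lebesgue_on \<Omega>. A x (wgrad \<Omega> u x) \<bullet> grad \<phi> x)
                = (LINT x|lebesgue_on \<Omega>. f x / u x * \<phi> x)) \<and>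
     (AE x in lebesgue_on \<Omega>. u x > 0) \<and>
     (\<exists>\<alpha>\<ge>1. (\<lambda>x. u x powr \<alpha>) \<in> W01p \<Omega> w p)"

text \<open>The integrands below are integrable when \<open>v\<close> and \<open>\<phi>\<close> are as indicated.\<close>

definition approx_solution ::
    "'a::euclidean_space set \<Rightarrow> ('a \<Rightarrow> real) \<Rightarrow> real \<Rightarrow> ('a \<Rightarrow> 'a \<Rightarrow> 'a) \<Rightarrow> ('a \<Rightarrow> real) \<Rightarrow>
     nat \<Rightarrow> ('a \<Rightarrow> real) \<Rightarrow> bool" where
  "approx_solution \<Omega> w p A f n v \<longleftrightarrow>
     v \<in> W01p \<Omega> w p \<inter> Linf \<Omega> \<and>
     (AE x in lebesgue_on \<Omega>. v x > 0) \<and>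
     (\<forall>\<phi>\<in>W01p \<Omega> w p. (LINT x|lebesgue_on \<Omega>. A x (wgrad \<Omega> v x) \<bullet> wgrad \<Omega> \<phi> x)
                = (LINT x|lebesgue_on \<Omega>. min (f x) (real n) / (v x + 1 / real n) * \<phi> x))"


section \<open>Exponents\<close>

definition p_sub :: "real \<Rightarrow> real \<Rightarrow> real" where
  "p_sub p s = p * s / (s + 1)"

definition sobolev_conj :: "real \<Rightarrow> real \<Rightarrow> real" where
  "sobolev_conj N r = N * r / (N - r)"

definition hoelder_conj :: "real \<Rightarrow> real" where
  "hoelder_conj r = r / (r - 1)"

end

theory Submission
  imports Defs
begin

text \<open>
  Growth and degeneracy together give \<open>A x \<zeta> \<bullet> \<zeta> = \<bar>\<zeta>\<bar>\<^sup>p w x\<close>, so testing the equation for \<open>u\<^sub>n\<close>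
  with \<open>G (u\<^sub>n)\<close> controls \<open>\<integral> G' (u\<^sub>n) \<bar>\<nabla>u\<^sub>n\<bar>\<^sup>p w\<close>. Hoelder's inequality with \<open>w powr (- s)\<close> embeds the
  weighted space into \<open>W\<^sub>0\<close> with exponent \<open>p\<^sub>s\<close> and no weight, where the Gagliardo-Nirenberg-Sobolev
  inequality applies. The powers \<open>G t = t powr (p (\<gamma> - 1) + 1)\<close> give the integrability of
  \<open>u\<^sub>n\<close>, since both sides of the resulting inequality contain the same norm of \<open>u\<^sub>n\<close>, with a smaller power
  on the right; truncations \<open>G t \<approx> max 0 (t - k)\<close> give boundedness by Stampacchia's lemma. All bounds are
  uniform in \<open>n\<close> and pass to the limit by Fatou's lemma. If \<open>p\<^sub>s\<close> equals the dimension, \<open>s\<close> is lowered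
  so that \<open>q\<close> becomes the Sobolev exponent; if it is larger, every element of the space is bounded.

  Since \<open>p\<^sub>s = 1\<close> is allowed, the Sobolev inequality is needed for exponent 1; it is proved by iterated
  integration along the coordinate directions. The chain rule in the weighted space is obtained from
  polynomials of test functions, which are again test functions.
\<close>

section \<open>Iterated integrals over a box\<close>

text \<open>Let \<open>q\<close> be the Sobolev exponent. The threshold \<open>q / (q - p)\<close>
  separates the two regimes: \<open>m\<close> lies below it exactly when
  \<open>1 - 1 / m < p / q\<close>. Below, \<open>p / q\<close> and \<open>1 - 1 / m\<close> are the
  powers of one integral on the two sides of the estimate, so that dividing leaves a bound; above,
  \<open>(1 - 1 / m) * (q / p) > 1\<close> is the superlinear power that Stampacchia's lemma asks
  for. The value of \<open>\<gamma>\<close> comes from making the two integrals coincide: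
  \<open>p * (\<gamma> - 1) = q * \<gamma> * (1 - 1 / m)\<close>. Two features of the definitions
  shape the rest. \<open>W01p\<close> is a closure of smooth functions, whereas the equation is
  tested with compositions that are only continuously differentiable, so their membership and their
  gradients have to be produced by approximation. And \<open>wgrad\<close> is an arbitrary choice
  among weak gradients, so nothing can be computed with it before weak gradients are known to be
  unique almost everywhere; this is the purpose of the fundamental lemma of the calculus of
  variations.\<close>

definition upd :: "'a::euclidean_space \<Rightarrow> 'a \<Rightarrow> real \<Rightarrow> 'a" where
  "upd x b t = x + (t - x \<bullet> b) *\<^sub>R b"

text \<open>The result is again a function on the whole space, constant in the coordinate along
  \<open>b\<close>. Line integrals can therefore be iterated without lower-dimensional spaces, and a
  power of one is a constant factor under a further integral along \<open>b\<close>.\<close>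

definition line_int :: "real \<Rightarrow> 'a::euclidean_space \<Rightarrow> ('a \<Rightarrow> real) \<Rightarrow> 'a \<Rightarrow> real" where
  "line_int a b f x = integral {-a..a} (\<lambda>t. f (upd x b t))"

text \<open>The head of the list is the innermost direction, which is why inductions over the list
  keep \<open>f\<close> arbitrary.\<close>

primrec iter_int :: "real \<Rightarrow> 'a::euclidean_space list \<Rightarrow> ('a \<Rightarrow> real) \<Rightarrow> 'a \<Rightarrow> real" where
  "iter_int a [] f = f"
| "iter_int a (b # L) f = iter_int a L (line_int a b f)"

lemma continuous_on_upd [continuous_intros]:
  assumes "continuous_on S f" "continuous_on S g"
  shows "continuous_on S (\<lambda>x. upd (f x) b (g x))"
  unfolding upd_def by (intro continuous_intros assms)

lemma upd_upd: "b \<in> Basis \<Longrightarrow> upd (upd x b s) b t = upd x b t"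
  by (simp add: upd_def algebra_simps inner_Basis flip: scaleR_left_distrib)

lemma upd_commute:
  "b \<in> Basis \<Longrightarrow> c \<in> Basis \<Longrightarrow> b \<noteq> c \<Longrightarrow> upd (upd x b s) c t = upd (upd x c t) b s"
  by (simp add: upd_def algebra_simps inner_Basis)

lemma continuous_line:
  assumes "continuous_on UNIV (f :: 'a::euclidean_space \<Rightarrow> real)"
  shows "continuous_on S (\<lambda>t. f (upd x b t))"
  by (rule continuous_on_compose2[OF assms]) (auto intro!: continuous_intros)

lemma continuous_line_int:
  fixes f :: "'a::euclidean_space \<Rightarrow> real"
  assumes "continuous_on UNIV f"
  shows "continuous_on UNIV (line_int a b f)"
proof -
  have "continuous_on (UNIV \<times> cbox (-a) a) (\<lambda>(x, t). f (upd x b t))"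
    unfolding case_prod_beta
    by (rule continuous_on_compose2[OF assms]) (auto intro!: continuous_intros)
  from integral_continuous_on_param[OF this] show ?thesis
    by (simp add: line_int_def[abs_def])
qed

lemma line_integrable:
  assumes "continuous_on UNIV (f :: 'a::euclidean_space \<Rightarrow> real)"
  shows "(\<lambda>t. f (upd x b t)) integrable_on {c..d}"
  by (intro integrable_continuous_interval continuous_line assms)

lemma line_int_mono:
  assumes "continuous_on UNIV f" "continuous_on UNIV g" "\<And>x. f x \<le> g x"
  shows "line_int a b f x \<le> line_int a b g x"
  unfolding line_int_def by (intro integral_le line_integrable assms)

text \<open>Strict positivity matters because Hoelder's inequality on a line is obtained by dividing
  by these integrals.\<close>

lemma line_int_pos:
  assumes "continuous_on UNIV f" "\<And>x. f x > 0" "a > 0"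
  shows "line_int a b f x > 0"
proof -
  have "line_int a b f x \<ge> 0"
    unfolding line_int_def using assms by (intro integral_nonneg line_integrable) (auto intro: less_imp_le)
  moreover have "line_int a b f x \<noteq> 0"
  proof
    assume "line_int a b f x = 0"
    then have "((\<lambda>t. f (upd x b t)) has_integral 0) (cbox (-a) a)"
      using integrable_integral[OF line_integrable[OF assms(1)]] by (metis box_real(2) line_int_def)
    then have "f (upd x b 0) = 0"
      using assms by (intro has_integral_0_cbox_imp_0[where f = "\<lambda>t. f (upd x b t)"])
        (auto intro!: continuous_line simp: less_imp_le)
    then show False using assms(2)[of "upd x b 0"] by simp
  qed
  ultimately show ?thesis by simp
qed

text \<open>Fubini on a square. It turns the integral along \<open>j\<close> of a line integral of
  \<open>f\<close> into a line integral of the function already integrated along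
  \<open>j\<close>.\<close>

lemma line_int_commute:
  assumes "continuous_on UNIV f" "b \<in> Basis" "c \<in> Basis" "b \<noteq> c"
  shows "line_int a b (line_int a c f) = line_int a c (line_int a b f)"
proof
  fix x
  have "continuous_on (cbox (-a, -a) (a, a)) (\<lambda>(s, t). f (upd (upd x b s) c t))"
    unfolding case_prod_beta
    by (rule continuous_on_compose2[OF assms(1)]) (auto intro!: continuous_intros)
  from integral_swap_continuous[OF this]
  show "line_int a b (line_int a c f) x = line_int a c (line_int a b f) x"
    using assms by (simp add: line_int_def upd_commute)
qed

lemma line_int_upd: "b \<in> Basis \<Longrightarrow> line_int a b f (upd x b t) = line_int a b f x"
  by (simp add: line_int_def upd_upd)

lemma iter_int_mono:
  assumes "continuous_on UNIV f" "continuous_on UNIV g" "\<And>x. f x \<le> g x"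
  shows "iter_int a L f x \<le> iter_int a L g x"
  using assms
  by (induction L arbitrary: f g) (auto simp: continuous_line_int line_int_mono)

text \<open>Jensen's inequality for the concave logarithm, exponentiated.\<close>

lemma weighted_arith_geom_mean:
  fixes x w :: "'a \<Rightarrow> real"
  assumes "finite I" and w: "\<And>i. i \<in> I \<Longrightarrow> 0 \<le> w i" "sum w I = 1" and x: "\<And>i. i \<in> I \<Longrightarrow> 0 < x i"
  shows "(\<Prod>i\<in>I. x i powr w i) \<le> (\<Sum>i\<in>I. w i * x i)"
proof -
  have ne: "I \<noteq> {}" using w by auto
  have "(\<Sum>i\<in>I. w i * ln (x i)) \<le> ln (\<Sum>i\<in>I. w i *\<^sub>R x i)"
    using concave_on_sum[OF assms(1) ne ln_concave] assms by auto
  moreover have "0 < (\<Sum>i\<in>I. w i *\<^sub>R x i)"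
  proof -
    obtain j where j: "j \<in> I" "w j > 0"
      by (metis w less_eq_real_def sum_nonpos not_one_le_zero)
    show ?thesis using assms j
      by (intro sum_pos2[OF assms(1), of j]) (auto simp: less_imp_le)
  qed
  ultimately have "exp (\<Sum>i\<in>I. w i * ln (x i)) \<le> (\<Sum>i\<in>I. w i * x i)"
    by (simp add: ln_ge_iff)
  moreover have "exp (\<Sum>i\<in>I. w i * ln (x i)) = (\<Prod>i\<in>I. x i powr w i)"
    unfolding exp_sum[OF assms(1)] using x by (intro prod.cong) (force simp: powr_def)+
  ultimately show ?thesis by simp
qed

text \<open>Apply the weighted AM-GM inequality to the normalised functions.\<close>

lemma integral_prod_powr_le:
  fixes h :: "'i \<Rightarrow> real \<Rightarrow> real"
  assumes I: "finite I" and w: "\<And>i. i \<in> I \<Longrightarrow> 0 \<le> w i" "sum w I = 1"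
    and cont: "\<And>i. i \<in> I \<Longrightarrow> continuous_on {c..d} (h i)"
    and pos: "\<And>i t. i \<in> I \<Longrightarrow> h i t > 0"
    and J: "\<And>i. i \<in> I \<Longrightarrow> integral {c..d} (h i) > 0"
  shows "integral {c..d} (\<lambda>t. \<Prod>i\<in>I. h i t powr w i) \<le> (\<Prod>i\<in>I. integral {c..d} (h i) powr w i)"
proof -
  define P where "P = (\<Prod>i\<in>I. integral {c..d} (h i) powr w i)"
  have P: "P \<ge> 0" unfolding P_def by (intro prod_nonneg) auto
  have "(\<Prod>i\<in>I. h i t powr w i) \<le> P * (\<Sum>i\<in>I. w i / integral {c..d} (h i) * h i t)" for t
  proof -
    have "(\<Prod>i\<in>I. h i t powr w i) = P * (\<Prod>i\<in>I. (h i t / integral {c..d} (h i)) powr w i)"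
      unfolding P_def prod.distrib[symmetric] using pos J
      by (intro prod.cong refl) (simp add: powr_divide less_imp_le, use J in force)
    also have "\<dots> \<le> P * (\<Sum>i\<in>I. w i * (h i t / integral {c..d} (h i)))"
      using pos J by (intro mult_left_mono weighted_arith_geom_mean P I w) auto
    finally show ?thesis by simp
  qed
  then have "integral {c..d} (\<lambda>t. \<Prod>i\<in>I. h i t powr w i)
      \<le> integral {c..d} (\<lambda>t. P * (\<Sum>i\<in>I. w i / integral {c..d} (h i) * h i t))"
    using pos by (intro integral_le integrable_continuous_interval continuous_intros cont)
      (auto simp: less_imp_neq[THEN not_sym])
  also have "\<dots> = P * (\<Sum>i\<in>I. w i / integral {c..d} (h i) * integral {c..d} (h i))"
    using I cont by (simp add: integral_sum integrable_continuous_interval integrable_on_mult_right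
        del: times_divide_eq_left)
  also have "(\<Sum>i\<in>I. w i / integral {c..d} (h i) * integral {c..d} (h i)) = sum w I"
    using J by (intro sum.cong) (auto, force)
  finally show ?thesis using w by (simp add: P_def)
qed

text \<open>Integrating first along \<open>j\<close> and applying Hoelder's inequality on the line replaces \<open>f\<close> by its
  line integral and removes one direction.\<close>

lemma iter_int_grid_lines:
  fixes f :: "'a::euclidean_space \<Rightarrow> real"
  assumes "distinct L" "set L \<subseteq> Basis" "continuous_on UNIV f" "\<And>x. f x > 0" "a > 0" "p \<ge> 0"
    and "(real (length L) - 1) * p \<le> 1"
  shows "iter_int a L (\<lambda>x. f x powr (1 - (real (length L) - 1) * p) * (\<Prod>i\<in>set L. line_int a i f x powr p)) z
           \<le> iter_int a L f z powr (1 + p)"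
  using assms
proof (induction L arbitrary: f)
  case Nil
  then show ?case by simp
next
  case (Cons j L)
  define k where "k = real (length L)"
  have k: "card (set L) = length L" using Cons.prems by (simp add: distinct_card)
  have kp: "k * p \<le> 1" using Cons.prems by (simp add: k_def)
  define g where "g = line_int a j f"
  have cg: "continuous_on UNIV g" unfolding g_def by (intro continuous_line_int Cons.prems)
  have pg: "g x > 0" for x unfolding g_def by (intro line_int_pos Cons.prems)
  have cl: "continuous_on UNIV (line_int a i h)" if "continuous_on UNIV h" for i and h :: "'a \<Rightarrow> real"
    using that by (rule continuous_line_int)
  have pl: "line_int a i h x > 0" if "continuous_on UNIV h" "\<And>x. h x > 0" for i x and h :: "'a \<Rightarrow> real"
    using that \<open>a > 0\<close> by (intro line_int_pos)
  define F where "F x = f x powr (1 - k * p) * (\<Prod>i\<in>set L. line_int a i f x powr p)" for x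
  have contF: "continuous_on UNIV F"
    unfolding F_def using Cons.prems pl[OF Cons.prems(3,4)]
    by (intro continuous_intros cl) (auto simp: less_imp_neq[THEN not_sym])
  have bound: "line_int a j (\<lambda>x. F x * g x powr p) x
      \<le> g x powr (1 - (k - 1) * p) * (\<Prod>i\<in>set L. line_int a i g x powr p)" for x
  proof -
    \<comment> \<open>Hoelder's inequality with one factor for \<open>f\<close> itself
      (\<open>None\<close>) and one for each remaining direction (\<open>Some i\<close>). The
      weights \<open>1 - k * p\<close> and \<open>k\<close> times \<open>p\<close> add up to
      1.\<close>
    define I where "I = insert None (Some ` set L)"
    define w where "w i = (case i of None \<Rightarrow> 1 - k * p | Some (_ :: 'a) \<Rightarrow> p)" for i
    define h where "h i t = (case i of None \<Rightarrow> f (upd x j t) | Some i \<Rightarrow> line_int a i f (upd x j t))" for i t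
    have I: "finite I" by (simp add: I_def)
    have pI: "(\<Prod>i\<in>I. q i) = q None * (\<Prod>i\<in>set L. q (Some i))" for q :: "'a option \<Rightarrow> real"
      unfolding I_def by (subst prod.insert) (auto simp: prod.reindex)
    have sw: "sum w I = 1"
      unfolding I_def by (subst sum.insert) (auto simp: sum.reindex w_def k k_def)
    have w0: "w i \<ge> 0" if "i \<in> I" for i
      using kp \<open>p \<ge> 0\<close> by (auto simp: w_def split: option.splits)
    have ch: "continuous_on {-a..a} (h i)" for i
      by (cases i) (auto simp: h_def[abs_def] intro!: continuous_line cl Cons.prems)
    have ph: "h i t > 0" for i t
      by (cases i) (auto simp: h_def intro!: pl Cons.prems)
    have Jh: "integral {-a..a} (h i) = (case i of None \<Rightarrow> g x | Some i \<Rightarrow> line_int a j (line_int a i f) x)" for i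
      by (cases i) (auto simp: h_def[abs_def] g_def line_int_def)
    have "integral {-a..a} (h i) > 0" for i
      unfolding Jh by (auto split: option.splits simp: pg intro!: pl cl Cons.prems)
    then have "integral {-a..a} (\<lambda>t. \<Prod>i\<in>I. h i t powr w i) \<le> (\<Prod>i\<in>I. integral {-a..a} (h i) powr w i)"
      using ph ch by (intro integral_prod_powr_le I w0 sw)
    also have "(\<lambda>t. \<Prod>i\<in>I. h i t powr w i) = (\<lambda>t. F (upd x j t))"
      unfolding pI by (auto simp: h_def w_def F_def)
    also have "(\<Prod>i\<in>I. integral {-a..a} (h i) powr w i)
       = g x powr (1 - k * p) * (\<Prod>i\<in>set L. line_int a i g x powr p)"
      unfolding pI using Cons.prems
      by (auto simp: Jh w_def g_def line_int_commute[OF Cons.prems(3)] intro!: prod.cong)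
         (metis line_int_commute[OF Cons.prems(3)] in_mono)
    finally have *: "line_int a j F x \<le> g x powr (1 - k * p) * (\<Prod>i\<in>set L. line_int a i g x powr p)"
      by (simp add: line_int_def)
    \<comment> \<open>\<open>g\<close> does not depend on the coordinate along \<open>j\<close>, so
      its power leaves the integral.\<close>
    have "line_int a j (\<lambda>x. F x * g x powr p) x = line_int a j F x * g x powr p"
      using Cons.prems by (simp add: line_int_def[of a j F] line_int_def[of a j "\<lambda>x. F x * g x powr p"])
        (simp add: g_def line_int_upd)
    also have "\<dots> \<le> g x powr (1 - k * p) * (\<Prod>i\<in>set L. line_int a i g x powr p) * g x powr p"
      using * by (intro mult_right_mono) auto
    also have "\<dots> = (g x powr (1 - k * p) * g x powr p) * (\<Prod>i\<in>set L. line_int a i g x powr p)"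
      by simp
    \<comment> \<open>Absorbing this factor yields exactly the power of \<open>g\<close> that the
      induction hypothesis for the shorter list \<open>L\<close> expects.\<close>
    also have "g x powr (1 - k * p) * g x powr p = g x powr (1 - (k - 1) * p)"
      by (simp add: powr_add[symmetric] algebra_simps)
    finally show ?thesis .
  qed
  have "iter_int a (j # L) (\<lambda>x. f x powr (1 - (real (length (j # L)) - 1) * p) * (\<Prod>i\<in>set (j # L). line_int a i f x powr p)) z
     = iter_int a L (line_int a j (\<lambda>x. F x * g x powr p)) z"
    using Cons.prems by (simp add: F_def g_def k_def mult_ac)
  also have "\<dots> \<le> iter_int a L (\<lambda>x. g x powr (1 - (k - 1) * p) * (\<Prod>i\<in>set L. line_int a i g x powr p)) z"
    using pg pl[OF cg pg] bound
    by (intro iter_int_mono cl continuous_intros contF cg) (auto simp: less_imp_neq[THEN not_sym])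
  also have "\<dots> \<le> iter_int a L g z powr (1 + p)"
    unfolding k_def using Cons.prems kp
    by (intro Cons.IH cg pg) (auto simp: k_def algebra_simps)
  finally show ?case by (simp add: g_def)
qed

text \<open>Passes from the functions integrated by a product measure over \<open>J\<close> to
  points of the space: the coordinates in \<open>J\<close> vary, the others stay frozen at
  \<open>z\<close>.\<close>

definition overlay :: "'a::euclidean_space set \<Rightarrow> ('a \<Rightarrow> real) \<Rightarrow> 'a \<Rightarrow> 'a" where
  "overlay J x z = (\<Sum>b\<in>Basis. (if b \<in> J then x b else z \<bullet> b) *\<^sub>R b)"

lemma overlay_empty: "overlay {} x z = z"
  by (simp add: overlay_def euclidean_representation)

lemma overlay_inner: "b \<in> Basis \<Longrightarrow> overlay J x z \<bullet> b = (if b \<in> J then x b else z \<bullet> b)"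
  by (simp add: overlay_def)

lemma overlay_insert:
  assumes "j \<in> Basis" "j \<notin> J"
  shows "overlay (insert j J) (x(j := y)) z = upd (overlay J x z) j y"
  by (rule euclidean_eqI) (use assms in \<open>auto simp: overlay_inner upd_def inner_add_left inner_Basis\<close>)

lemma measurable_overlay [measurable]:
  "(\<lambda>x. overlay J x z) \<in> borel_measurable (PiM J (\<lambda>_. lborel))"
proof -
  have "(\<lambda>x. if b \<in> J then x b else z \<bullet> b) \<in> borel_measurable (PiM J (\<lambda>_. lborel))" for b
    by (cases "b \<in> J") (auto intro!: measurable_component_singleton)
  then show ?thesis unfolding overlay_def by measurable
qed

lemma product_sigma_finite_lborel: "product_sigma_finite (\<lambda>_ :: 'i. lborel :: 'a::euclidean_space measure)"
  by (simp add: product_sigma_finite_def sigma_finite_lborel)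

lemma nn_integral_iter_int_PiM:
  fixes f :: "'a::euclidean_space \<Rightarrow> real"
  assumes "distinct L" "set L \<subseteq> Basis" "continuous_on UNIV f" "\<And>x. f x \<ge> 0" "a \<ge> 0"
  shows "(\<integral>\<^sup>+x. (\<Prod>b\<in>set L. indicator {-a..a} (x b)) * ennreal (f (overlay (set L) x z)) \<partial>PiM (set L) (\<lambda>_. lborel))
     = ennreal (iter_int a L f z)"
  using assms
proof (induction L arbitrary: f)
  case Nil
  interpret product_sigma_finite "\<lambda>_ :: 'a. lborel :: real measure"
    by (rule product_sigma_finite_lborel)
  show ?case by (simp add: overlay_empty PiM_empty nn_integral_count_space_finite)
next
  case (Cons j L)
  interpret product_sigma_finite "\<lambda>_ :: 'a. lborel :: real measure"
    by (rule product_sigma_finite_lborel)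
  note [measurable] = borel_measurable_continuous_onI[OF Cons.prems(3)]
  have [measurable]: "(\<lambda>x. indicator {-a..a} (x b) :: ennreal) \<in> borel_measurable (PiM J (\<lambda>_. lborel))" if "b \<in> J" for b :: 'a and J
  proof -
    have "(\<lambda>x. x b) \<in> measurable (PiM J (\<lambda>_. lborel)) lborel"
      using that by (rule measurable_component_singleton)
    then have "(\<lambda>x. x b) \<in> borel_measurable (PiM J (\<lambda>_. lborel))" by simp
    then show ?thesis
      by (rule measurable_compose) simp
  qed
  let ?W = "\<lambda>J x. (\<Prod>b\<in>J. indicator {-a..a} (x b)) * ennreal (f (overlay J x z))"
  have meas: "(\<lambda>x. ?W J x) \<in> borel_measurable (PiM J (\<lambda>_. lborel))" for J
    by measurable
  have "(\<integral>\<^sup>+x. ?W (set (j # L)) x \<partial>PiM (set (j # L)) (\<lambda>_. lborel))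
     = (\<integral>\<^sup>+x. (\<integral>\<^sup>+y. ?W (insert j (set L)) (x(j := y)) \<partial>lborel) \<partial>PiM (set L) (\<lambda>_. lborel))"
    unfolding list.set using Cons.prems
    by (intro product_nn_integral_insert meas) auto
  also have "\<dots> = (\<integral>\<^sup>+x. (\<Prod>b\<in>set L. indicator {-a..a} (x b)) * ennreal (line_int a j f (overlay (set L) x z)) \<partial>PiM (set L) (\<lambda>_. lborel))"
  proof (intro nn_integral_cong)
    fix x :: "'a \<Rightarrow> real"
    let ?P = "\<Prod>b\<in>set L. indicator {-a..a} (x b) :: ennreal"
    let ?f = "\<lambda>y. f (upd (overlay (set L) x z) j y)"
    let ?g = "\<lambda>y. indicator {-a..a} y * ennreal (?f y)"
    have P: "(\<Prod>b\<in>set L. indicator {-a..a} ((x(j := y)) b)) = ?P" for y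
      using Cons.prems by (intro prod.cong) auto
    have "(\<integral>\<^sup>+y. ?W (insert j (set L)) (x(j := y)) \<partial>lborel)
       = (\<integral>\<^sup>+y. ?P * (?g y) \<partial>lborel)"
      using Cons.prems by (subst overlay_insert) (auto simp: P[simplified] mult_ac)
    also have "\<dots> = ?P * (\<integral>\<^sup>+y. ?g y \<partial>lborel)"
    proof (intro nn_integral_cmult)
      have "(\<lambda>y. ?f y) \<in> borel_measurable borel"
        by (intro borel_measurable_continuous_onI continuous_line Cons.prems)
      then show "(\<lambda>y. ?g y) \<in> borel_measurable lborel"
        by measurable
    qed
    also have "(\<integral>\<^sup>+y. ?g y \<partial>lborel) = ennreal (line_int a j f (overlay (set L) x z))"
    proof -
      have "(\<integral>\<^sup>+y. ennreal (indicator {-a..a} y * ?f y) \<partial>lborel) = ennreal (line_int a j f (overlay (set L) x z))"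
        unfolding line_int_def using Cons.prems
        by (intro nn_integral_has_integral_lebesgue integrable_integral line_integrable) auto
      then show ?thesis using Cons.prems by (simp add: ennreal_mult' ennreal_indicator)
    qed
    finally show "(\<integral>\<^sup>+y. ?W (insert j (set L)) (x(j := y)) \<partial>lborel)
       = ?P * ennreal (line_int a j f (overlay (set L) x z))" .
  qed
  also have "\<dots> = ennreal (iter_int a L (line_int a j f) z)"
    using Cons.prems
    by (intro Cons.IH continuous_line_int) (auto simp: line_int_def intro!: integral_nonneg line_integrable)
  finally show ?case by simp
qed

lemma iter_int_nonneg:
  assumes "continuous_on UNIV f" "\<And>x. f x \<ge> 0"
  shows "iter_int a L f x \<ge> 0"
  using assms
proof (induction L arbitrary: f)
  case (Cons b L)
  then have "line_int a b f y \<ge> 0" for y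
    by (auto simp: line_int_def intro!: integral_nonneg line_integrable)
  with Cons show ?case by (simp add: continuous_line_int)
qed simp

text \<open>\<open>lborel\<close> is the image of the product measure over \<open>Basis\<close>
  under the map from coordinates to points. No coordinate remains frozen, hence the point
  \<open>z\<close> on the right is arbitrary.\<close>

lemma integral_iter_int:
  fixes f :: "'a::euclidean_space \<Rightarrow> real"
  assumes L: "distinct L" "set L = Basis" and f: "continuous_on UNIV f" "\<And>x. f x \<ge> 0" and "a \<ge> 0"
  shows "(LINT x|lborel. indicator (cbox (- (a *\<^sub>R One)) (a *\<^sub>R One)) x * f x) = iter_int a L f z"
proof -
  note [measurable] = borel_measurable_continuous_onI[OF f(1)]
  have *: "overlay Basis x z = (\<Sum>b\<in>Basis. x b *\<^sub>R b)" for x by (simp add: overlay_def)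
  have "(\<integral>\<^sup>+x. ennreal (indicator (cbox (- (a *\<^sub>R One)) (a *\<^sub>R One)) x * f x) \<partial>lborel)
    = (\<integral>\<^sup>+x. ennreal (indicator (cbox (- (a *\<^sub>R One)) (a *\<^sub>R One)) (overlay Basis x z) * f (overlay Basis x z)) \<partial>PiM Basis (\<lambda>_. lborel))"
    unfolding *
    by (subst lborel_def, subst nn_integral_distr) (auto simp: lborel_eq_real)
  also have "\<dots> = (\<integral>\<^sup>+x. (\<Prod>b\<in>set L. indicator {-a..a} (x b)) * ennreal (f (overlay (set L) x z)) \<partial>PiM (set L) (\<lambda>_. lborel))"
    unfolding L
  proof (intro nn_integral_cong)
    fix x :: "'a \<Rightarrow> real"
    have "(\<Prod>b\<in>Basis. indicator {-a..a} (x b)) = (indicator (cbox (- (a *\<^sub>R One)) (a *\<^sub>R One)) (overlay Basis x z) :: ennreal)"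
      by (auto simp: indicator_def cbox_def overlay_inner intro!: prod.neutral)
    then show "ennreal (indicator (cbox (- (a *\<^sub>R One)) (a *\<^sub>R One)) (overlay Basis x z) * f (overlay Basis x z))
       = (\<Prod>b\<in>Basis. indicator {-a..a} (x b)) * ennreal (f (overlay Basis x z))"
      by (simp add: indicator_def)
  qed
  also have "\<dots> = ennreal (iter_int a L f z)"
    using assms by (intro nn_integral_iter_int_PiM) auto
  finally show ?thesis
    using iter_int_nonneg[OF f] f by (subst integral_eq_nn_integral) auto
qed

section \<open>Compactly supported differentiable functions\<close>

text \<open>Unlike \<open>Cc_inf\<close>, this class is closed under composition with continuously
  differentiable functions that vanish at 0, such as powers and soft truncations; the classical
  inequalities are proved for it.\<close>

definition C1_compact :: "('a::euclidean_space \<Rightarrow> real) \<Rightarrow> ('a \<Rightarrow> 'a) \<Rightarrow> bool" where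
  "C1_compact \<phi> g \<longleftrightarrow> (\<forall>x. (\<phi> has_derivative (\<lambda>h. g x \<bullet> h)) (at x)) \<and> continuous_on UNIV g \<and> bounded {x. \<phi> x \<noteq> 0}"

lemma C1_compact_support:
  assumes "C1_compact \<phi> g"
  obtains a where "a > 0" "\<And>x. norm x \<ge> a \<Longrightarrow> \<phi> x = 0" "\<And>x. norm x \<ge> a \<Longrightarrow> g x = 0"
proof -
  obtain R where R: "\<And>x. \<phi> x \<noteq> 0 \<Longrightarrow> norm x \<le> R"
    using assms by (auto simp: C1_compact_def bounded_iff)
  \<comment> \<open>The additional 1 leaves an open set around \<open>x\<close> on which
    \<open>\<phi>\<close> vanishes, so that its derivative vanishes too.\<close>
  have "g x = 0" if "norm x \<ge> \<bar>R\<bar> + 1" for x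
  proof -
    have "open {x :: 'a. norm x > R}"
      by (intro open_Collect_less continuous_intros)
    moreover have "\<And>y. y \<in> {x. norm x > R} \<Longrightarrow> 0 = \<phi> y" using R by force
    ultimately have "(\<phi> has_derivative (\<lambda>h. 0)) (at x)"
      using that by (intro has_derivative_transform_within_open[OF has_derivative_const[of 0]]) auto
    with assms have "(\<lambda>h. g x \<bullet> h) = (\<lambda>h. 0)"
      by (auto simp: C1_compact_def intro: has_derivative_unique)
    then have "g x \<bullet> g x = 0" by meson
    then show ?thesis by simp
  qed
  moreover have "\<phi> x = 0" if "norm x \<ge> \<bar>R\<bar> + 1" for x using R[of x] that by force
  ultimately show ?thesis using that[of "\<bar>R\<bar> + 1"] by force
qed

lemma C1_compact_continuous:
  assumes "C1_compact \<phi> g"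
  shows "continuous_on UNIV \<phi>" "continuous_on UNIV g"
proof -
  show "continuous_on UNIV \<phi>"
    using assms by (intro continuous_at_imp_continuous_on ballI) (auto simp: C1_compact_def intro: has_derivative_continuous)
qed (use assms in \<open>simp add: C1_compact_def\<close>)

lemma C1_compact_compose:
  fixes G G' :: "real \<Rightarrow> real"
  assumes "C1_compact \<phi> g" and G: "\<And>t. (G has_real_derivative G' t) (at t)" "continuous_on UNIV G'" "G 0 = 0"
  shows "C1_compact (\<lambda>x. G (\<phi> x)) (\<lambda>x. G' (\<phi> x) *\<^sub>R g x)"
  unfolding C1_compact_def
proof (intro conjI allI)
  fix x
  show "((\<lambda>x. G (\<phi> x)) has_derivative (\<lambda>h. (G' (\<phi> x) *\<^sub>R g x) \<bullet> h)) (at x)"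
    using assms(1) has_derivative_compose[of \<phi> _ x UNIV G, OF _ G(1)[unfolded has_field_derivative_def]]
    by (simp add: C1_compact_def)
next
  show "continuous_on UNIV (\<lambda>x. G' (\<phi> x) *\<^sub>R g x)"
    using C1_compact_continuous[OF assms(1)]
    by (intro continuous_intros continuous_on_compose2[OF G(2)]) auto
  have "bounded {x. \<phi> x \<noteq> 0}" using assms(1) by (simp add: C1_compact_def)
  then show "bounded {x. G (\<phi> x) \<noteq> 0}"
    by (rule bounded_subset) (use G in auto)
qed

lemma C1_compact_mult:
  assumes "C1_compact \<phi> g" "C1_compact \<psi> h"
  shows "C1_compact (\<lambda>x. \<phi> x * \<psi> x) (\<lambda>x. \<phi> x *\<^sub>R h x + \<psi> x *\<^sub>R g x)"
  unfolding C1_compact_def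
proof (intro conjI allI)
  fix x
  show "((\<lambda>x. \<phi> x * \<psi> x) has_derivative (\<lambda>k. (\<phi> x *\<^sub>R h x + \<psi> x *\<^sub>R g x) \<bullet> k)) (at x)"
    using assms unfolding C1_compact_def
    by (auto intro!: derivative_eq_intros simp: algebra_simps inner_add_left)
next
  show "continuous_on UNIV (\<lambda>x. \<phi> x *\<^sub>R h x + \<psi> x *\<^sub>R g x)"
    using C1_compact_continuous[OF assms(1)] C1_compact_continuous[OF assms(2)]
    by (intro continuous_intros) 
  have "bounded {x. \<phi> x \<noteq> 0}" using assms(1) by (simp add: C1_compact_def)
  then show "bounded {x. \<phi> x * \<psi> x \<noteq> 0}"
    by (rule bounded_subset) auto
qed

section \<open>Line integrals of gradients and the Sobolev inequality for exponent 1\<close>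

lemma integrable_continuous_compact_support:
  fixes h :: "'a::euclidean_space \<Rightarrow> 'b::{banach, second_countable_topology}"
  assumes "continuous_on UNIV h" "\<And>x. norm x \<ge> a \<Longrightarrow> h x = 0"
  shows "integrable lborel h"
proof -
  have "integrable lborel (\<lambda>x. indicator (cball 0 a) x *\<^sub>R h x)"
    using assms(1) by (intro borel_integrable_compact) (auto intro: continuous_on_subset)
  moreover have "(\<lambda>x. indicator (cball 0 a) x *\<^sub>R h x) = h"
    using assms(2) by (force simp: indicator_def)
  ultimately show ?thesis by simp
qed

lemma norm_ge_outside_cbox:
  assumes "x \<notin> cbox (- (a *\<^sub>R One)) (a *\<^sub>R One :: 'a::euclidean_space)"
  shows "norm x \<ge> a"
proof -
  from assms obtain b where "b \<in> Basis" "\<bar>x \<bullet> b\<bar> > a"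
    by (auto simp: mem_box not_le abs_if split: if_splits)
  then show ?thesis using Basis_le_norm[of b x] by simp
qed

lemma integrable_indicator_cbox_mult:
  fixes h :: "'a::euclidean_space \<Rightarrow> real"
  shows "continuous_on UNIV h \<Longrightarrow> integrable lborel (\<lambda>x. indicator (cbox a b) x * h x)"
  using borel_integrable_compact[of "cbox a b" h] by (auto intro: continuous_on_subset)

lemma norm_upd_ge: "b \<in> Basis \<Longrightarrow> norm (upd x b t) \<ge> \<bar>t\<bar>"
  using Basis_le_norm[of b "upd x b t"] by (simp add: upd_def inner_add_left)

lemma line_has_vector_derivative:
  assumes "C1_compact \<phi> g"
  shows "((\<lambda>t. \<phi> (upd x b t)) has_vector_derivative (g (upd x b t) \<bullet> b)) (at t within S)"
proof -
  have "((\<lambda>t. upd x b t) has_derivative (\<lambda>h. h *\<^sub>R b)) (at t within S)"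
    unfolding upd_def by (auto intro!: derivative_eq_intros)
  from has_derivative_compose[OF this, of \<phi> "\<lambda>h. g (upd x b t) \<bullet> h"] assms
  show ?thesis
    by (simp add: has_vector_derivative_def C1_compact_def)
qed

text \<open>The fundamental theorem of calculus along \<open>b\<close>, started at coordinate
  \<open>- a\<close>, where \<open>\<phi>\<close> vanishes. A continuous majorant \<open>f\<close>
  takes the place of \<open>norm (g x)\<close> so that it can be chosen strictly positive.\<close>

lemma C1_compact_le_line_int:
  assumes "C1_compact \<phi> g" "a > 0" "\<And>x. norm x \<ge> a \<Longrightarrow> \<phi> x = 0" "b \<in> Basis"
    and f: "continuous_on UNIV f" "\<And>x. norm (g x) \<le> f x"
  shows "\<bar>\<phi> x\<bar> \<le> line_int a b f x"
proof (cases "\<bar>x \<bullet> b\<bar> \<le> a")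
  case False
  then have "norm x \<ge> a" using Basis_le_norm[OF assms(4), of x] by simp
  then show ?thesis
    using assms f(2)[THEN order_trans[OF norm_ge_zero]]
    by (auto simp: line_int_def intro!: integral_nonneg line_integrable)
next
  case True
  have g: "continuous_on UNIV (\<lambda>x. g x \<bullet> b)"
    using C1_compact_continuous[OF assms(1)] by (intro continuous_intros)
  have f0: "f y \<ge> 0" for y using f(2)[of y] norm_ge_zero order_trans by blast
  have "((\<lambda>t. g (upd x b t) \<bullet> b) has_integral (\<phi> (upd x b (x \<bullet> b)) - \<phi> (upd x b (-a)))) {-a..x \<bullet> b}"
    using True by (intro fundamental_theorem_of_calculus line_has_vector_derivative assms(1)) auto
  moreover have "upd x b (x \<bullet> b) = x" by (simp add: upd_def)
  moreover have "\<phi> (upd x b (-a)) = 0"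
    using norm_upd_ge[OF assms(4), of "-a" x] \<open>a > 0\<close> by (intro assms(3)) auto
  ultimately have "\<phi> x = integral {-a..x \<bullet> b} (\<lambda>t. g (upd x b t) \<bullet> b)"
    by (simp add: integral_unique)
  also have "norm \<dots> \<le> integral {-a..x \<bullet> b} (\<lambda>t. f (upd x b t))"
  proof (intro Henstock_Kurzweil_Integration.integral_norm_bound_integral line_integrable g f)
    fix t
    show "norm (g (upd x b t) \<bullet> b) \<le> f (upd x b t)"
      using Cauchy_Schwarz_ineq2[of "g (upd x b t)" b] f(2)[of "upd x b t"] assms(4) by simp
  qed
  also have "\<dots> \<le> line_int a b f x"
    unfolding line_int_def using True f0
    by (intro integral_subset_le line_integrable f) auto
  finally show ?thesis by simp
qed

theorem gagliardo_nirenberg_sobolev_1: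
  fixes \<phi> :: "'a::euclidean_space \<Rightarrow> real"
  assumes C: "C1_compact \<phi> g" and dim: "DIM('a) \<ge> 2"
  defines "n \<equiv> real DIM('a)"
  shows "(LINT x|lborel. \<bar>\<phi> x\<bar> powr (n / (n - 1))) \<le> (LINT x|lborel. norm (g x)) powr (n / (n - 1))"
proof -
  obtain a where a: "a > 0" "\<And>x. norm x \<ge> a \<Longrightarrow> \<phi> x = 0" "\<And>x. norm x \<ge> a \<Longrightarrow> g x = 0"
    using C1_compact_support[OF C] by metis
  obtain L :: "'a list" where L: "set L = Basis" "distinct L"
    using finite_distinct_list[of "Basis :: 'a set"] by auto
  have lL: "length L = DIM('a)" using L by (metis distinct_card)
  note cont = C1_compact_continuous[OF C]
  define B where "B = cbox (- (a *\<^sub>R One)) (a *\<^sub>R One :: 'a)"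
  define p where "p = 1 / (n - 1)"
  have n: "n \<ge> 2" using dim by (simp add: n_def)
  have p: "p > 0" "1 + p = n / (n - 1)" "(n - 1) * p = 1" using n by (auto simp: p_def field_simps)
  have out: "norm x \<ge> a" if "x \<notin> B" for x
    using that unfolding B_def by (rule norm_ge_outside_cbox)
  have ig: "integrable lborel (\<lambda>x. norm (g x))"
    using a cont by (intro integrable_continuous_compact_support[of _ a] continuous_intros) auto
  have main: "(LINT x|lborel. \<bar>\<phi> x\<bar> powr (1 + p)) \<le> ((LINT x|lborel. norm (g x)) + e * measure lborel B) powr (1 + p)"
    if "e > 0" for e
  proof -
    \<comment> \<open>The shift by \<open>e\<close> supplies strict positivity. Over the box it
      costs only \<open>e * measure lborel B\<close>, which disappears as \<open>e\<close> tends to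
      0.\<close>
    define f where "f x = norm (g x) + e" for x
    have f: "continuous_on UNIV f" "\<And>x. f x > 0"
      using \<open>e > 0\<close> cont by (auto simp: f_def[abs_def] add_nonneg_pos intro!: continuous_intros)
    define F where "F x = (\<Prod>i\<in>Basis. line_int a i f x powr p)" for x
    have pl: "line_int a i f x > 0" for i x using f a by (intro line_int_pos)
    have F: "continuous_on UNIV F" "\<And>x. F x \<ge> 0"
      using pl unfolding F_def
      by (auto intro!: continuous_intros continuous_line_int f prod_nonneg simp: less_imp_neq[THEN not_sym])
    have le: "\<bar>\<phi> x\<bar> powr (1 + p) \<le> F x" for x
    proof -
      \<comment> \<open>There are as many factors as dimensions and \<open>n * p = 1 + p\<close>;
        each factor is estimated in its own direction.\<close>
      have "\<bar>\<phi> x\<bar> powr (1 + p) = (\<Prod>i\<in>(Basis::'a set). \<bar>\<phi> x\<bar> powr p)"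
        using n dim by (cases "\<phi> x = 0") (auto simp: powr_power p_def n_def p(2)[unfolded p_def n_def])
      also have "\<dots> \<le> F x"
        unfolding F_def using p
        by (intro prod_mono conjI powr_mono2 C1_compact_le_line_int[OF C] a f) (auto simp: f_def \<open>e > 0\<close> less_imp_le)
      finally show ?thesis .
    qed
  have cb: "continuous_on UNIV h \<Longrightarrow> integrable lborel (\<lambda>x. indicator B x * h x)" for h :: "'a \<Rightarrow> real"
    unfolding B_def by (rule integrable_indicator_cbox_mult)
    have "(LINT x|lborel. \<bar>\<phi> x\<bar> powr (1 + p)) \<le> (LINT x|lborel. indicator B x * F x)"
    proof (intro integral_mono' cb F)
      fix x show "\<bar>\<phi> x\<bar> powr (1 + p) \<le> indicator B x * F x"
        using le[of x] out[of x] a(2)[of x] by (auto simp: indicator_def)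
    qed (auto simp: F)
    also have "\<dots> = iter_int a L F 0"
      unfolding B_def using L F a by (intro integral_iter_int) auto
    also have "\<dots> = iter_int a L (\<lambda>x. f x powr (1 - (real (length L) - 1) * p) * (\<Prod>i\<in>set L. line_int a i f x powr p)) 0"
    proof -
      \<comment> \<open>For the full list the leftover power of \<open>f\<close> is the zeroth one.
        It equals 1 only because \<open>f\<close> is positive, as
        \<open>0 powr 0 = 0\<close>.\<close>
      have "1 - (real (length L) - 1) * p = 0" using p by (simp add: lL n_def)
      moreover have "f x powr 0 = 1" for x using f(2)[of x] by simp
      ultimately show ?thesis by (simp add: F_def[abs_def] L)
    qed
    also have "\<dots> \<le> iter_int a L f 0 powr (1 + p)"
      using L f a p by (intro iter_int_grid_lines) (auto simp: lL n_def)
    also have "iter_int a L f 0 = (LINT x|lborel. indicator B x * f x)"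
      unfolding B_def using L f a by (intro integral_iter_int[symmetric]) (auto simp: less_imp_le)
    also have "(\<lambda>x. indicator B x * f x) = (\<lambda>x. norm (g x) + e * indicator B x)"
      using out a(3) by (force simp: f_def indicator_def)
    also have "integral\<^sup>L lborel \<dots> = (LINT x|lborel. norm (g x)) + e * measure lborel B"
      using ig integrable_mult_right[OF cb[of "\<lambda>_. 1"], of e] by (simp add: B_def)
    finally show ?thesis .
  qed
  have "((\<lambda>e. ((LINT x|lborel. norm (g x)) + e * measure lborel B) powr (1 + p)) \<longlongrightarrow>
     ((LINT x|lborel. norm (g x)) + 0 * measure lborel B) powr (1 + p)) (at_right 0)"
    using p by (intro tendsto_powr' tendsto_intros) (auto intro!: disjI2 always_eventually eventually_at_right_less integral_nonneg
       add_nonneg_nonneg eventually_mono[OF eventually_at_right_less])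
  then have "(LINT x|lborel. \<bar>\<phi> x\<bar> powr (1 + p)) \<le> ((LINT x|lborel. norm (g x)) + 0 * measure lborel B) powr (1 + p)"
    using main by (intro tendsto_lowerbound[where F = "at_right 0"])
      (auto intro: eventually_mono[OF eventually_at_right_less])
  then show ?thesis by (simp add: p)
qed

text \<open>Adding a constant \<open>K\<close> makes the integrand nonnegative, and both integrals over the box
  become iterated integrals whose first step is the direction of differentiation.\<close>

lemma integral_gradient_eq_0:
  fixes \<phi> :: "'a::euclidean_space \<Rightarrow> real"
  assumes C: "C1_compact \<phi> g"
  shows "(LINT x|lborel. g x) = 0"
proof -
  obtain a where a: "a > 0" "\<And>x. norm x \<ge> a \<Longrightarrow> \<phi> x = 0" "\<And>x. norm x \<ge> a \<Longrightarrow> g x = 0"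
    using C1_compact_support[OF C] by metis
  note cont = C1_compact_continuous[OF C]
  define B where "B = cbox (- (a *\<^sub>R One)) (a *\<^sub>R One :: 'a)"
  have cb: "continuous_on UNIV h \<Longrightarrow> integrable lborel (\<lambda>x. indicator B x * h x)" for h :: "'a \<Rightarrow> real"
    unfolding B_def by (rule integrable_indicator_cbox_mult)
  have out: "norm x \<ge> a" if "x \<notin> B" for x
    using that unfolding B_def by (rule norm_ge_outside_cbox)
  have ig: "integrable lborel g"
    using a cont by (intro integrable_continuous_compact_support[of _ a] continuous_intros) auto
  have "(LINT x|lborel. g x) \<bullet> b = 0" if b: "b \<in> Basis" for b
  proof -
    have "bounded (g ` cball 0 a)"
      using cont by (intro compact_imp_bounded compact_continuous_image) (auto intro: continuous_on_subset)
    then obtain K where "\<forall>x\<in>cball 0 a. norm (g x) \<le> K"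
      unfolding bounded_iff by blast
    then have K: "norm (g x) \<le> K" if "norm x \<le> a" for x
      using that by simp
    have "K \<ge> 0" using K[of 0] a(1) norm_ge_zero[of "g 0"] by (auto simp del: norm_ge_zero)
    have K: "norm (g x) \<le> K" for x
      using K[of x] a(3)[of x] \<open>K \<ge> 0\<close> by (cases "norm x \<le> a") auto
    have gK: "g x \<bullet> b + K \<ge> 0" for x
      using Basis_le_norm[OF b, of "g x"] K[of x] by linarith
    have cg: "continuous_on UNIV (\<lambda>x. g x \<bullet> b + K)" using cont by (intro continuous_intros)
    obtain L where L: "set L = Basis - {b}" "distinct L"
      using finite_distinct_list[of "Basis - {b}"] by auto
    have bL: "distinct (b # L)" "set (b # L) = Basis" using L b by auto
    have "line_int a b (\<lambda>x. g x \<bullet> b + K) x = line_int a b (\<lambda>x. K) x" for x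
    proof -
      have "((\<lambda>t. g (upd x b t) \<bullet> b) has_integral (\<phi> (upd x b a) - \<phi> (upd x b (-a)))) {-a..a}"
        using a by (intro fundamental_theorem_of_calculus line_has_vector_derivative C) auto
      moreover have "\<phi> (upd x b (-a)) = 0" "\<phi> (upd x b a) = 0"
        using norm_upd_ge[OF b, of "-a" x] norm_upd_ge[OF b, of "a" x] a by auto
      ultimately have "((\<lambda>t. g (upd x b t) \<bullet> b + K) has_integral (0 + (a - (-a)) * K)) {-a..a}"
        using a has_integral_const_real[of K "-a" a] by (intro has_integral_add) auto
      then show ?thesis
        using a by (simp add: line_int_def integral_unique)
    qed
    then have "line_int a b (\<lambda>x. g x \<bullet> b + K) = line_int a b (\<lambda>x. K)" by blast
    then have "iter_int a (b # L) (\<lambda>x. g x \<bullet> b + K) 0 = iter_int a (b # L) (\<lambda>x. K) 0"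
      by simp
    then have "(LINT x|lborel. indicator B x * (g x \<bullet> b + K)) = (LINT x|lborel. indicator B x * K)"
      using integral_iter_int[OF bL cg gK, of a 0] integral_iter_int[OF bL continuous_on_const, of K a 0] a \<open>K \<ge> 0\<close>
      by (simp add: B_def)
    also have "(LINT x|lborel. indicator B x * (g x \<bullet> b + K)) = (LINT x|lborel. g x \<bullet> b + indicator B x * K)"
      using out a(3) by (intro Bochner_Integration.integral_cong) (force simp: indicator_def)+
    also have "\<dots> = (LINT x|lborel. g x \<bullet> b) + (LINT x|lborel. indicator B x * K)"
      using ig cb[of "\<lambda>_. K"] by (intro Bochner_Integration.integral_add) auto
    finally show ?thesis using ig by simp
  qed
  then show ?thesis by (metis euclidean_eqI inner_zero_left)
qed

text \<open>Young's inequality gives integrability pointwise and, applied to the functions divided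
  by their integrals, the estimate. Powers of integrable functions replace conjugate norms because
  all later uses split one integrand into two such powers.\<close>

lemma Hoelder_powr:
  fixes F G :: "'a \<Rightarrow> real"
  assumes ab: "0 < \<alpha>" "0 < \<beta>" "\<alpha> + \<beta> = 1"
    and F: "integrable M F" "AE x in M. F x \<ge> 0" and G: "integrable M G" "AE x in M. G x \<ge> 0"
  shows "integrable M (\<lambda>x. F x powr \<alpha> * G x powr \<beta>)"
    and "(LINT x|M. F x powr \<alpha> * G x powr \<beta>) \<le> (LINT x|M. F x) powr \<alpha> * (LINT x|M. G x) powr \<beta>"
proof -
  have young: "a powr \<alpha> * b powr \<beta> \<le> \<alpha> * a + \<beta> * b" if "a \<ge> 0" "b \<ge> 0" for a b :: real
    using Youngs_inequality_0[of \<alpha> \<beta> a b] ab that by (cases "a = 0 \<or> b = 0") auto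
  note [measurable] = borel_measurable_integrable[OF F(1)] borel_measurable_integrable[OF G(1)]
  have "AE x in M. norm (F x powr \<alpha> * G x powr \<beta>) \<le> norm (\<alpha> * F x + \<beta> * G x)"
    using F(2) G(2)
  proof eventually_elim
    case (elim x)
    then have "0 \<le> F x powr \<alpha> * G x powr \<beta>" "F x powr \<alpha> * G x powr \<beta> \<le> \<alpha> * F x + \<beta> * G x"
      by (simp_all add: young)
    then show ?case unfolding real_norm_def by linarith
  qed
  then show int: "integrable M (\<lambda>x. F x powr \<alpha> * G x powr \<beta>)"
    by (rule Bochner_Integration.integrable_bound[rotated 2])
      (intro Bochner_Integration.integrable_add integrable_mult_right F(1) G(1), measurable)
  define I where "I = (LINT x|M. F x)"
  define J where "J = (LINT x|M. G x)"
  have IJ: "I \<ge> 0" "J \<ge> 0" unfolding I_def J_def using F G by (auto intro: integral_nonneg_AE)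
  show "(LINT x|M. F x powr \<alpha> * G x powr \<beta>) \<le> (LINT x|M. F x) powr \<alpha> * (LINT x|M. G x) powr \<beta>"
  proof (cases "I = 0 \<or> J = 0")
    case True
    \<comment> \<open>Dividing by the integrals is impossible here, but one of the two functions
      vanishes a.e., and with it the product.\<close>
    then have "(AE x in M. F x = 0) \<or> (AE x in M. G x = 0)"
      using integral_nonneg_eq_0_iff_AE[OF F] integral_nonneg_eq_0_iff_AE[OF G] by (auto simp: I_def J_def)
    then have "AE x in M. F x powr \<alpha> * G x powr \<beta> = 0" by auto
    then have "(LINT x|M. F x powr \<alpha> * G x powr \<beta>) = 0" by (rule integral_eq_zero_AE)
    then show ?thesis by simp
  next
    case False
    then have IJ: "I > 0" "J > 0" using IJ by auto
    define P where "P = I powr \<alpha> * J powr \<beta>"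
    have "(LINT x|M. F x powr \<alpha> * G x powr \<beta>) \<le> (LINT x|M. P * (\<alpha> / I * F x + \<beta> / J * G x))"
    proof (intro integral_mono_AE int)
      show "integrable M (\<lambda>x. P * (\<alpha> / I * F x + \<beta> / J * G x))" using F G by simp
      show "AE x in M. F x powr \<alpha> * G x powr \<beta> \<le> P * (\<alpha> / I * F x + \<beta> / J * G x)"
        using F(2) G(2)
      proof eventually_elim
        case (elim x)
        have "F x powr \<alpha> * G x powr \<beta> = P * ((F x / I) powr \<alpha> * (G x / J) powr \<beta>)"
          using elim IJ by (simp add: P_def powr_divide)
        also have "\<dots> \<le> P * (\<alpha> * (F x / I) + \<beta> * (G x / J))"
          using elim IJ by (intro mult_left_mono young) (auto simp: P_def)
        finally show ?case by simp
      qed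
    qed
    also have "\<dots> = P * (\<alpha> / I * I + \<beta> / J * J)"
      using F G by (simp add: I_def J_def)
    also have "\<dots> = P" using IJ ab by simp
    finally show ?thesis by (simp add: P_def I_def J_def)
  qed
qed

lemma Hoelder_indicator:
  fixes f :: "'a \<Rightarrow> real"
  assumes m: "m > 1" and f: "integrable M (\<lambda>x. \<bar>f x\<bar> powr m)" and A: "A \<in> sets M" "emeasure M A < \<infinity>"
  shows "integrable M (\<lambda>x. \<bar>f x\<bar> * indicator A x)"
    and "(LINT x|M. \<bar>f x\<bar> * indicator A x) \<le> (LINT x|M. \<bar>f x\<bar> powr m) powr (1 / m) * measure M A powr (1 - 1 / m)"
proof -
  have eq: "(\<bar>f x\<bar> powr m) powr (1 / m) * indicator A x powr (1 - 1 / m) = \<bar>f x\<bar> * indicator A x" for x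
    using m by (cases "x \<in> A") (auto simp: powr_powr)
  have "integrable M (\<lambda>x. indicator A x :: real)" by (intro integrable_real_indicator A)
  then have "integrable M (\<lambda>x. (\<bar>f x\<bar> powr m) powr (1 / m) * indicator A x powr (1 - 1 / m))"
    "(LINT x|M. (\<bar>f x\<bar> powr m) powr (1 / m) * indicator A x powr (1 - 1 / m))
      \<le> (LINT x|M. \<bar>f x\<bar> powr m) powr (1 / m) * (LINT x|M. indicator A x) powr (1 - 1 / m)"
    using m by (intro Hoelder_powr f; simp)+
  moreover have "(LINT x|M. indicator A x) = measure M A"
    using sets.sets_into_space[OF A(1)] by (simp add: Int_absorb2)
  ultimately show "integrable M (\<lambda>x. \<bar>f x\<bar> * indicator A x)"
    "(LINT x|M. \<bar>f x\<bar> * indicator A x) \<le> (LINT x|M. \<bar>f x\<bar> powr m) powr (1 / m) * measure M A powr (1 - 1 / m)"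
    by (simp_all only: eq)
qed

section \<open>Truncations\<close>

text \<open>Only the origin needs an argument: the difference quotient there is at most
  \<open>\<bar>h\<bar> powr (c - 1)\<close>, which tends to 0 because \<open>c > 1\<close>.\<close>

lemma has_real_derivative_pos_part_powr:
  assumes "c > 1"
  shows "((\<lambda>t. max 0 t powr c) has_real_derivative c * max 0 t powr (c - 1)) (at t)"
proof -
  consider "t > 0" | "t < 0" | "t = 0" by linarith
  then show ?thesis
  proof cases
    case 1
    have "((\<lambda>t. t powr c) has_real_derivative c * t powr (c - 1)) (at t)"
      using 1 by (rule has_real_derivative_powr)
    then have "((\<lambda>t. max 0 t powr c) has_real_derivative c * t powr (c - 1)) (at t)"
      by (rule DERIV_cong_ev[THEN iffD1, rotated 3])
        (use 1 in \<open>auto intro!: eventually_mono[OF eventually_nhds_in_open[of "{0<..}"]]\<close>)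
    then show ?thesis using 1 by (simp add: max_def)
  next
    case 2
    have "((\<lambda>t. 0) has_real_derivative 0) (at t)" by simp
    then have "((\<lambda>t. max 0 t powr c) has_real_derivative 0) (at t)"
      by (rule DERIV_cong_ev[THEN iffD1, rotated 3])
        (use 2 in \<open>auto intro!: eventually_mono[OF eventually_nhds_in_open[of "{..<0}"]] simp: max_def\<close>)
    then show ?thesis using 2 by (simp add: max_def)
  next
    case 3
    have "((\<lambda>h. (max 0 (0 + h) powr c - max 0 0 powr c) / h) \<longlongrightarrow> 0) (at 0)"
    proof (rule Lim_null_comparison)
      have "norm ((max 0 (0 + h) powr c - max 0 0 powr c) / h) \<le> \<bar>h\<bar> powr (c - 1)" for h :: real
        using assms powr_diff[of h c 1] by (cases "h > 0") (simp_all add: max_def)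
      then show "\<forall>\<^sub>F h in at 0. norm ((max 0 (0 + h) powr c - max 0 0 powr c) / h) \<le> \<bar>h\<bar> powr (c - 1)"
        by simp
      have "((\<lambda>h. \<bar>h\<bar> powr (c - 1)) \<longlongrightarrow> \<bar>0 :: real\<bar> powr (c - 1)) (at 0)"
        using assms by (intro tendsto_powr' tendsto_intros) auto
      then show "((\<lambda>h. \<bar>h\<bar> powr (c - 1)) \<longlongrightarrow> (0 :: real)) (at 0)" using assms by simp
    qed
    then show ?thesis using 3 by (simp add: DERIV_def)
  qed
qed

lemma continuous_pos_part_powr:
  fixes f :: "'a::topological_space \<Rightarrow> real"
  assumes "c > 0" "continuous_on S f"
  shows "continuous_on S (\<lambda>t. max 0 (f t) powr c)"
  using assms by (intro continuous_on_powr' continuous_intros) auto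

lemma has_real_derivative_abs_powr:
  assumes "c > 1"
  shows "((\<lambda>t. \<bar>t\<bar> powr c) has_real_derivative c * (max 0 t powr (c - 1) - max 0 (-t) powr (c - 1))) (at t)"
proof -
  have "((\<lambda>t. max 0 t powr c + max 0 (-t) powr c) has_real_derivative
      c * max 0 t powr (c - 1) + c * max 0 (-t) powr (c - 1) * (-1)) (at t)"
    using assms by (intro DERIV_add has_real_derivative_pos_part_powr
        DERIV_chain2[OF has_real_derivative_pos_part_powr]) (auto intro!: derivative_eq_intros)
  moreover have "(\<lambda>t. max 0 t powr c + max 0 (-t) powr c) = (\<lambda>t. \<bar>t\<bar> powr c)"
    using assms by (auto simp: max_def)
  ultimately show ?thesis by (simp add: algebra_simps)
qed

text \<open>A continuously differentiable approximation, up to \<open>e\<close>, of the truncation \<open>max 0 (t - k)\<close>.\<close>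

definition soft_excess :: "real \<Rightarrow> real \<Rightarrow> real \<Rightarrow> real" where
  "soft_excess k e t = sqrt ((max 0 (t - k))\<^sup>2 + e\<^sup>2) - e"

definition soft_excess' :: "real \<Rightarrow> real \<Rightarrow> real \<Rightarrow> real" where
  "soft_excess' k e t = max 0 (t - k) / sqrt ((max 0 (t - k))\<^sup>2 + e\<^sup>2)"

lemma soft_excess_derivative:
  assumes "e > 0"
  shows "(soft_excess k e has_real_derivative soft_excess' k e t) (at t)"
proof -
  have "((\<lambda>s. max 0 s powr 2) has_real_derivative 2 * max 0 (t - k) powr (2 - 1)) (at (t - k))"
    by (rule has_real_derivative_pos_part_powr) simp
  moreover have "(\<lambda>s :: real. max 0 s powr 2) = (\<lambda>s. (max 0 s)\<^sup>2)" by (simp add: fun_eq_iff)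
  ultimately have *: "((\<lambda>s. (max 0 s)\<^sup>2) has_real_derivative 2 * max 0 (t - k)) (at (t - k))" by simp
  have shift: "((\<lambda>t. t - k) has_real_derivative 1) (at t)" by (auto intro!: derivative_eq_intros)
  have "((\<lambda>t. (max 0 (t - k))\<^sup>2 + e\<^sup>2) has_real_derivative 2 * max 0 (t - k) * 1 + 0) (at t)"
    by (rule DERIV_add[OF DERIV_chain2[OF * shift] DERIV_const])
  moreover have pos: "(max 0 (t - k))\<^sup>2 + e\<^sup>2 > 0" using assms by (simp add: add_nonneg_pos)
  ultimately have "((\<lambda>t. sqrt ((max 0 (t - k))\<^sup>2 + e\<^sup>2)) has_real_derivative
      inverse (sqrt ((max 0 (t - k))\<^sup>2 + e\<^sup>2)) / 2 * (2 * max 0 (t - k) * 1 + 0)) (at t)"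
    by (rule DERIV_chain2[OF DERIV_real_sqrt, rotated])
  from DERIV_diff[OF this DERIV_const[of e]] show ?thesis
    unfolding soft_excess_def[abs_def] soft_excess'_def by (rule DERIV_cong) (simp add: inverse_eq_divide)
qed

lemma soft_excess'_continuous: "e > 0 \<Longrightarrow> continuous_on S (soft_excess' k e)"
  unfolding soft_excess'_def[abs_def]
  by (intro continuous_intros) (simp add: sum_power2_eq_zero_iff)

lemma soft_excess'_bounds:
  assumes "e > 0"
  shows "0 \<le> soft_excess' k e t" "soft_excess' k e t \<le> 1" "t \<le> k \<Longrightarrow> soft_excess' k e t = 0"
proof -
  have "max 0 (t - k) \<le> sqrt ((max 0 (t - k))\<^sup>2 + e\<^sup>2)" by (rule real_le_rsqrt) simp
  moreover have "sqrt ((max 0 (t - k))\<^sup>2 + e\<^sup>2) > 0" using assms by (simp add: add_nonneg_pos)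
  ultimately show "soft_excess' k e t \<le> 1" by (simp add: soft_excess'_def divide_le_eq_1)
qed (auto simp: soft_excess'_def)

lemma soft_excess_bounds:
  assumes "e > 0"
  shows "0 \<le> soft_excess k e t" "t \<le> k \<Longrightarrow> soft_excess k e t = 0" "t - k - e \<le> soft_excess k e t"
    "soft_excess k e t \<le> max 0 (t - k)"
proof -
  show "0 \<le> soft_excess k e t" unfolding soft_excess_def using assms by (auto intro: real_le_rsqrt)
  have "t - k \<le> max 0 (t - k)" by simp
  also have "\<dots> \<le> sqrt ((max 0 (t - k))\<^sup>2 + e\<^sup>2)" by (rule real_le_rsqrt) simp
  finally show "t - k - e \<le> soft_excess k e t" by (simp add: soft_excess_def)
  have "sqrt ((max 0 (t - k))\<^sup>2 + e\<^sup>2) \<le> max 0 (t - k) + e"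
    using assms by (intro real_le_lsqrt) (auto simp: power2_sum)
  then show "soft_excess k e t \<le> max 0 (t - k)" by (simp add: soft_excess_def)
qed (use assms in \<open>auto simp: soft_excess_def\<close>)

section \<open>The Sobolev inequality below the dimension\<close>

text \<open>The case of exponent 1 is applied to \<open>\<bar>\<phi>\<bar> powr c\<close>. The
  choice of \<open>c\<close> makes \<open>c * n / (n - 1) = q\<close> and also
  \<open>c - 1 = q * (1 - 1 / r)\<close>, so that Hoelder's inequality on the gradient brings back
  the integral on the left, with a smaller power.\<close>

theorem gagliardo_nirenberg_sobolev:
  fixes \<phi> :: "'a::euclidean_space \<Rightarrow> real"
  assumes C: "C1_compact \<phi> g" and dim: "DIM('a) \<ge> 2"
  defines "n \<equiv> real DIM('a)"
  assumes r: "1 \<le> r" "r < n"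
  defines "q \<equiv> n * r / (n - r)" and "c \<equiv> r * (n - 1) / (n - r)"
  shows "(LINT x|lborel. \<bar>\<phi> x\<bar> powr q) powr (1 / q) \<le> c * (LINT x|lborel. norm (g x) powr r) powr (1 / r)"
proof (cases "r = 1")
  case True
  have n: "n \<ge> 2" using dim by (simp add: n_def)
  have "(LINT x|lborel. \<bar>\<phi> x\<bar> powr (n / (n - 1))) powr ((n - 1) / n)
      \<le> ((LINT x|lborel. norm (g x)) powr (n / (n - 1))) powr ((n - 1) / n)"
    using gagliardo_nirenberg_sobolev_1[OF C dim] n
    by (intro powr_mono2) (auto simp: n_def)
  then show ?thesis using n True by (simp add: q_def c_def powr_powr)
next
  case False
  have n: "n \<ge> 2" using dim by (simp add: n_def)
  have c: "c > 1" using r n False by (simp add: c_def field_simps)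
  have q: "q > 0" using r n by (simp add: q_def)
  have cq: "c * (n / (n - 1)) = q" using n r by (simp add: c_def q_def)
  have cq': "(c - 1) = q * (1 - 1 / r)" using n r by (simp add: c_def q_def field_simps)
  obtain a where a: "a > 0" "\<And>x. norm x \<ge> a \<Longrightarrow> \<phi> x = 0" "\<And>x. norm x \<ge> a \<Longrightarrow> g x = 0"
    using C1_compact_support[OF C] by metis
  note cont = C1_compact_continuous[OF C]
  define G' where "G' t = c * (max 0 t powr (c - 1) - max 0 (-t) powr (c - 1))" for t
  have aG': "\<bar>G' t\<bar> = c * \<bar>t\<bar> powr (c - 1)" for t
    using c by (auto simp: G'_def max_def abs_mult)
  have C': "C1_compact (\<lambda>x. \<bar>\<phi> x\<bar> powr c) (\<lambda>x. G' (\<phi> x) *\<^sub>R g x)"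
    using c by (intro C1_compact_compose[OF C, of "\<lambda>t. \<bar>t\<bar> powr c"])
      (auto simp: G'_def[abs_def] intro!: has_real_derivative_abs_powr continuous_intros continuous_pos_part_powr)
  define Q where "Q = (LINT x|lborel. \<bar>\<phi> x\<bar> powr q)"
  define R where "R = (LINT x|lborel. norm (g x) powr r)"
  have Q0: "Q \<ge> 0" "R \<ge> 0" by (auto simp: Q_def R_def)
  have iQ: "integrable lborel (\<lambda>x. \<bar>\<phi> x\<bar> powr q)"
    using a cont q by (intro integrable_continuous_compact_support[of _ a] continuous_on_powr' continuous_intros) auto
  have iR: "integrable lborel (\<lambda>x. norm (g x) powr r)"
    using a cont r by (intro integrable_continuous_compact_support[of _ a] continuous_on_powr' continuous_intros) auto
  have H: "(LINT x|lborel. (\<bar>\<phi> x\<bar> powr q) powr (1 - 1 / r) * (norm (g x) powr r) powr (1 / r)) \<le> Q powr (1 - 1 / r) * R powr (1 / r)"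
    unfolding Q_def R_def using r False by (intro Hoelder_powr iQ iR) auto
  have "Q = (LINT x|lborel. \<bar>\<bar>\<phi> x\<bar> powr c\<bar> powr (n / (n - 1)))"
    using cq by (simp add: powr_powr Q_def)
  also have "\<dots> \<le> (LINT x|lborel. norm (G' (\<phi> x) *\<^sub>R g x)) powr (n / (n - 1))"
    unfolding n_def by (rule gagliardo_nirenberg_sobolev_1[OF C' dim])
  also have "(\<lambda>x. norm (G' (\<phi> x) *\<^sub>R g x)) = (\<lambda>x. c * ((\<bar>\<phi> x\<bar> powr q) powr (1 - 1 / r) * (norm (g x) powr r) powr (1 / r)))"
    using r by (simp add: aG' powr_powr cq' mult.assoc)
  also have "(LINT x|lborel. c * ((\<bar>\<phi> x\<bar> powr q) powr (1 - 1 / r) * (norm (g x) powr r) powr (1 / r))) powr (n / (n - 1))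
      \<le> (c * (Q powr (1 - 1 / r) * R powr (1 / r))) powr (n / (n - 1))"
    using H c n by (intro powr_mono2) (auto intro!: mult_nonneg_nonneg)
  finally have "Q powr ((n - 1) / n) \<le> ((c * (Q powr (1 - 1 / r) * R powr (1 / r))) powr (n / (n - 1))) powr ((n - 1) / n)"
    using n Q0 by (intro powr_mono2) auto
  then have *: "Q powr ((n - 1) / n) \<le> c * R powr (1 / r) * Q powr (1 - 1 / r)"
    using n c by (simp add: powr_powr mult_ac)
  show ?thesis
  proof (cases "Q = 0")
    case True
    then show ?thesis using c by (simp add: Q_def)
  next
    case False
    \<comment> \<open>This is \<open>1 / q = 1 / r - 1 / n\<close>; dividing by
      \<open>Q powr (1 - 1 / r)\<close> then leaves the claimed power of \<open>Q\<close>.\<close>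
    have e: "(n - 1) / n = 1 / q + (1 - 1 / r)" using n r by (simp add: q_def field_simps)
    have "Q powr (1 / q) * Q powr (1 - 1 / r) \<le> c * R powr (1 / r) * Q powr (1 - 1 / r)"
      using * unfolding e powr_add .
    then show ?thesis using False Q0 by (simp add: Q_def R_def)
  qed
qed

section \<open>Stampacchia's lemma and boundedness above the dimension\<close>

text \<open>Depends on the constants alone and not on the function to which Stampacchia's lemma is
  applied, so the resulting bounds are uniform over families. The maxima with 1 keep it
  positive.\<close>

definition stampacchia_level :: "real \<Rightarrow> real \<Rightarrow> real \<Rightarrow> real \<Rightarrow> real" where
  "stampacchia_level \<alpha> \<beta> C V =
     (max 1 C * max 1 V powr (\<beta> - 1) * 2 powr (\<alpha> / (\<beta> - 1) * \<beta>)) powr (1 / \<alpha>)"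

lemma stampacchia_level_pos: "stampacchia_level \<alpha> \<beta> C V > 0"
  by (auto simp: stampacchia_level_def max_def)

text \<open>On the levels \<open>d (1 - 2\<^sup>-\<^sup>j)\<close> the function decays geometrically.\<close>

lemma stampacchia:
  fixes \<Phi> :: "real \<Rightarrow> real"
  assumes "\<alpha> > 0" "\<beta> > 1"
    and nn: "\<And>k. 0 \<le> k \<Longrightarrow> 0 \<le> \<Phi> k" and V: "\<Phi> 0 \<le> V"
    and dec: "\<And>k h. 0 \<le> k \<Longrightarrow> k < h \<Longrightarrow> \<Phi> h \<le> \<Phi> k"
    and C: "\<And>k h. 0 \<le> k \<Longrightarrow> k < h \<Longrightarrow> (h - k) powr \<alpha> * \<Phi> h \<le> C * \<Phi> k powr \<beta>"
  shows "\<Phi> (stampacchia_level \<alpha> \<beta> C V) = 0"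
proof -
  define C' where "C' = max 1 C"
  define V' where "V' = max 1 V"
  have CV: "C' > 0" "V' > 0" by (auto simp: C'_def V'_def)
  \<comment> \<open>\<open>\<mu>\<close> solves \<open>\<mu> * \<beta> = \<mu> + \<alpha>\<close>:
    raising the decay \<open>2 powr (- \<mu>)\<close> per level to the power \<open>\<beta>\<close>
    then pays for the factor \<open>2 powr \<alpha>\<close> lost when the gap between levels is
    halved.\<close>
  define \<mu> where "\<mu> = \<alpha> / (\<beta> - 1)"
  have \<mu>: "\<mu> > 0" using assms by (simp add: \<mu>_def)
  define d where "d = (C' * V' powr (\<beta> - 1) * 2 powr (\<mu> * \<beta>)) powr (1 / \<alpha>)"
  have d_eq: "d = stampacchia_level \<alpha> \<beta> C V"
    by (simp only: d_def stampacchia_level_def C'_def V'_def \<mu>_def)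
  have d: "d > 0" using CV by (simp add: d_def)
  have da: "d powr \<alpha> = C' * V' powr (\<beta> - 1) * 2 powr (\<mu> * \<beta>)"
    using CV assms by (simp add: d_def powr_powr)
  define l where "l j = d * (1 - 2 powr (- real j))" for j
  have l0: "l j \<ge> 0" for j
    using d powr_mono[of "- real j" 0 2] by (simp add: l_def)
  have ld: "l j < d" for j using d by (simp add: l_def)
  have bound: "\<Phi> (l j) \<le> V' * 2 powr (- (real j * \<mu>))" for j
  proof (induction j)
    case 0
    then show ?case using V by (simp add: l_def V'_def)
  next
    case (Suc j)
    have two: "2 powr (- real j) = 2 * 2 powr (- real (Suc j))"
      using powr_add[of 2 1 "- real (Suc j)"] by simp
    have diff: "l (Suc j) - l j = d * 2 powr (- real (Suc j))"
      unfolding l_def two by (simp add: algebra_simps)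
    have lt: "l j < l (Suc j)" using diff d by (smt (verit) mult_pos_pos powr_gt_zero)
    have "(l (Suc j) - l j) powr \<alpha> * \<Phi> (l (Suc j)) \<le> C * \<Phi> (l j) powr \<beta>"
      using C[OF l0 lt] .
    also have "\<dots> \<le> C' * (V' * 2 powr (- (real j * \<mu>))) powr \<beta>"
      using Suc nn[OF l0] assms CV by (intro mult_mono powr_mono2) (auto simp: C'_def)
    also have "\<dots> = C' * V' powr \<beta> * 2 powr (- (real j * \<mu> * \<beta>))"
      using CV by (simp add: powr_mult powr_powr)
    also have "C' * V' powr \<beta> = d powr \<alpha> * V' * 2 powr (- (\<mu> * \<beta>))"
    proof -
      have "V' powr \<beta> = V' powr (\<beta> - 1) * V'" using powr_add[of V' "\<beta> - 1" 1] CV by simp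
      moreover have "2 powr (\<mu> * \<beta>) * 2 powr (- (\<mu> * \<beta>)) = (1 :: real)" by (simp add: powr_minus)
      ultimately show ?thesis by (simp add: da)
    qed
    also have "d powr \<alpha> * V' * 2 powr (- (\<mu> * \<beta>)) * 2 powr (- (real j * \<mu> * \<beta>))
        = d powr \<alpha> * V' * (2 powr (- real (Suc j) * \<alpha>) * 2 powr (- (real (Suc j) * \<mu>)))"
    proof -
      have "\<mu> * \<beta> = \<mu> + \<alpha>" using assms by (simp add: \<mu>_def field_simps)
      moreover from this have "real j * \<mu> * \<beta> = real j * \<mu> + real j * \<alpha>"
        by (simp add: mult.assoc distrib_left)
      ultimately have "- (\<mu> * \<beta>) + - (real j * \<mu> * \<beta>) = - real (Suc j) * \<alpha> + - (real (Suc j) * \<mu>)"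
        by (simp add: algebra_simps)
      then have "2 powr (- (\<mu> * \<beta>)) * 2 powr (- (real j * \<mu> * \<beta>))
          = 2 powr (- real (Suc j) * \<alpha>) * (2 powr (- (real (Suc j) * \<mu>)) :: real)"
        by (metis powr_add)
      then show ?thesis by (simp only: mult.assoc)
    qed
    also have "\<dots> = (l (Suc j) - l j) powr \<alpha> * (V' * 2 powr (- (real (Suc j) * \<mu>)))"
      using d by (simp add: diff powr_mult powr_powr)
    finally show ?case using lt by simp
  qed
  \<comment> \<open>All levels \<open>l j\<close> lie below \<open>d\<close>, so by monotonicity
    \<open>\<Phi> d\<close> is at most every member of this null sequence.\<close>
  have "(\<lambda>j. V' * (2 powr (- \<mu>)) ^ j) \<longlonglongrightarrow> V' * 0"
    using \<mu> powr_less_mono[of "-\<mu>" 0 2] by (intro tendsto_intros LIMSEQ_power_zero) simp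
  moreover have "(2 powr (- \<mu>)) ^ j = 2 powr (- (real j * \<mu>))" for j
    by (simp add: powr_power)
  ultimately have "(\<lambda>j. V' * 2 powr (- (real j * \<mu>))) \<longlonglongrightarrow> 0" by simp
  then have "\<Phi> d \<le> 0"
    by (rule LIMSEQ_le_const) (use bound dec[OF l0 ld] order_trans in blast)
  then show "\<Phi> (stampacchia_level \<alpha> \<beta> C V) = 0" using nn[of d] d by (simp flip: d_eq)
qed

text \<open>Chebyshev's inequality turns bounds for the truncations into the relation between two
  levels that \<open>stampacchia\<close> needs, for the measure of the superlevel sets of
  \<open>v\<close>.\<close>

lemma AE_le_stampacchia_level:
  fixes v :: "'a \<Rightarrow> real"
  assumes [measurable]: "v \<in> borel_measurable M"
    and fin: "emeasure M {x \<in> space M. v x > 0} < \<infinity>" and V: "measure M {x \<in> space M. v x > 0} \<le> V"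
    and q: "q > 0" and \<beta>: "\<beta> > 1"
    and int: "\<And>k e. 0 \<le> k \<Longrightarrow> 0 < e \<Longrightarrow> integrable M (\<lambda>x. \<bar>soft_excess k e (v x)\<bar> powr q)"
    and le: "\<And>k e. 0 \<le> k \<Longrightarrow> 0 < e \<Longrightarrow>
      (LINT x|M. \<bar>soft_excess k e (v x)\<bar> powr q) \<le> C * measure M {x \<in> space M. v x > k} powr \<beta>"
  shows "AE x in M. v x \<le> stampacchia_level q \<beta> (2 powr q * C) V"
proof -
  define A where "A k = {x \<in> space M. v x > k}" for k
  have fm: "A k \<in> fmeasurable M" if "k \<ge> 0" for k
  proof (rule fmeasurableI2)
    show "A 0 \<in> fmeasurable M" unfolding A_def using fin by (intro fmeasurableI) measurable
  qed (use that in \<open>auto simp: A_def\<close>)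
  define d where "d = stampacchia_level q \<beta> (2 powr q * C) V"
  have d: "d > 0" unfolding d_def by (rule stampacchia_level_pos)
  have "measure M (A d) = 0"
    unfolding d_def
  proof (rule stampacchia[OF q \<beta>])
    show "measure M (A 0) \<le> V" using V by (simp add: A_def)
    fix k h :: real assume kh: "0 \<le> k" "k < h"
    show "measure M (A h) \<le> measure M (A k)"
      using fm[of k] fm[of h] kh by (intro measure_mono_fmeasurable) (auto simp: A_def)
    \<comment> \<open>Half of the gap pays for the smoothing error of \<open>soft_excess\<close>,
      the other half is the height in Chebyshev's inequality; hence the factor
      \<open>2 powr q\<close> in the level.\<close>
    define e where "e = (h - k) / 2"
    have e: "e > 0" "h = k + e + e" using kh by (simp_all add: e_def field_simps)
    have "e powr q * measure M (A h) = (LINT x|M. e powr q * indicator (A h) x)"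
      using sets.sets_into_space[OF fmeasurableD[OF fm]] kh by (simp add: Int_absorb2)
    also have "\<dots> \<le> (LINT x|M. \<bar>soft_excess k e (v x)\<bar> powr q)"
    proof (rule integral_mono'[OF int[OF kh(1) e(1)]])
      show "e powr q * indicator (A h) x \<le> \<bar>soft_excess k e (v x)\<bar> powr q" for x
      proof (cases "x \<in> A h")
        case True
        then have "h < v x" by (simp add: A_def)
        then have "e \<le> \<bar>soft_excess k e (v x)\<bar>"
          using soft_excess_bounds(3)[OF e(1), of "v x" k] e(2) by linarith
        then show ?thesis using True e q by (simp add: powr_mono2)
      qed simp
    qed simp
    also have "\<dots> \<le> C * measure M (A k) powr \<beta>"
      using le[OF kh(1) e(1)] by (simp add: A_def)
    finally have "2 powr q * (e powr q * measure M (A h)) \<le> 2 powr q * (C * measure M (A k) powr \<beta>)"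
      by (intro mult_left_mono) auto
    moreover have "2 powr q * e powr q = (h - k) powr q"
      using e(2) by (simp flip: powr_mult)
    ultimately show "(h - k) powr q * measure M (A h) \<le> 2 powr q * C * measure M (A k) powr \<beta>"
      by (simp add: mult.assoc[symmetric])
  qed simp
  then have "A d \<in> null_sets M"
    using fm[of d] d by (auto simp: null_sets_def fmeasurable_def emeasure_eq_ennreal_measure)
  then show ?thesis
    by (rule AE_I') (auto simp: A_def d_def not_le)
qed

text \<open>The Sobolev inequality for exponent 1 is applied to soft truncations and Hoelder's
  inequality to their gradients on the superlevel sets. The resulting power
  \<open>(1 - 1 / r) * n / (n - 1)\<close> exceeds 1 exactly when \<open>r > n\<close>. The bound is
  fixed before \<open>\<phi>\<close>, so it holds along a whole approximating sequence.\<close>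

theorem C1_compact_bounded:
  fixes r V B :: real
  assumes dim: "DIM('a::euclidean_space) \<ge> 2" and r: "r > real DIM('a)" and "B \<ge> 0"
  obtains d where
    "\<And>(\<phi> :: 'a \<Rightarrow> real) g. C1_compact \<phi> g \<Longrightarrow> measure lborel {x. \<phi> x \<noteq> 0} \<le> V \<Longrightarrow>
       (LINT x|lborel. norm (g x) powr r) powr (1 / r) \<le> B \<Longrightarrow> AE x in lborel. \<phi> x \<le> d"
proof -
  define n where "n = real DIM('a)"
  have n: "n \<ge> 2" "r > n" using dim r by (auto simp: n_def)
  define q where "q = n / (n - 1)"
  have q: "q > 0" using n by (simp add: q_def)
  have qr: "(1 - 1 / r) * q > 1" using n by (simp add: q_def field_simps)
  show ?thesis
  proof (rule that)
    fix \<phi> :: "'a \<Rightarrow> real" and g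
    assume C: "C1_compact \<phi> g" and V: "measure lborel {x. \<phi> x \<noteq> 0} \<le> V"
      and B: "(LINT x|lborel. norm (g x) powr r) powr (1 / r) \<le> B"
    obtain a where a: "a > 0" "\<And>x. norm x \<ge> a \<Longrightarrow> \<phi> x = 0" "\<And>x. norm x \<ge> a \<Longrightarrow> g x = 0"
      using C1_compact_support[OF C] by metis
    note cont = C1_compact_continuous[OF C]
    note [measurable] = cont[THEN borel_measurable_continuous_onI]
    have fm: "{x. \<phi> x \<noteq> 0} \<in> fmeasurable lborel"
    proof (rule fmeasurableI2[of "cball 0 a"])
      show "{x. \<phi> x \<noteq> 0} \<subseteq> cball 0 a" using a by (force simp: not_le)
      show "cball 0 a \<in> fmeasurable lborel"
        using emeasure_bounded_finite[OF bounded_cball] by (intro fmeasurableI) auto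
    qed auto
    have fmk: "{x. \<phi> x > k} \<in> fmeasurable lborel" if "k \<ge> 0" for k
      using fm by (rule fmeasurableI2) (use that in auto)
    have iR: "integrable lborel (\<lambda>x. \<bar>norm (g x)\<bar> powr r)"
      using a cont n by (intro integrable_continuous_compact_support[of _ a] continuous_on_powr' continuous_intros) auto
    show "AE x in lborel. \<phi> x \<le> stampacchia_level q ((1 - 1 / r) * q) (2 powr q * B powr q) V"
    proof (rule AE_le_stampacchia_level[OF _ _ _ q qr])
      have "measure lborel {x. \<phi> x > 0} \<le> measure lborel {x. \<phi> x \<noteq> 0}"
        using fm by (intro measure_mono_fmeasurable) auto
      then show "measure lborel {x \<in> space lborel. \<phi> x > 0} \<le> V" using V by simp
      show "emeasure lborel {x \<in> space lborel. \<phi> x > 0} < \<infinity>"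
        using fmk[of 0] by (simp add: fmeasurable_def)
      fix k e :: real assume k: "0 \<le> k" and e: "0 < e"
      have C': "C1_compact (\<lambda>x. soft_excess k e (\<phi> x)) (\<lambda>x. soft_excess' k e (\<phi> x) *\<^sub>R g x)"
        using e k by (intro C1_compact_compose[OF C] soft_excess_derivative soft_excess'_continuous soft_excess_bounds)
      obtain b where b: "b > 0" "\<And>x. norm x \<ge> b \<Longrightarrow> soft_excess k e (\<phi> x) = 0"
        using C1_compact_support[OF C'] by metis
      show "integrable lborel (\<lambda>x. \<bar>soft_excess k e (\<phi> x)\<bar> powr q)"
        using b q C1_compact_continuous[OF C']
        by (intro integrable_continuous_compact_support[of _ b] continuous_on_powr' continuous_intros) auto
      have A: "{x. \<phi> x > k} \<in> sets lborel" "emeasure lborel {x. \<phi> x > k} < \<infinity>"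
        using fmk[OF k] by (auto simp: fmeasurable_def)
      have "(LINT x|lborel. norm (soft_excess' k e (\<phi> x) *\<^sub>R g x)) \<le> (LINT x|lborel. \<bar>norm (g x)\<bar> * indicator {x. \<phi> x > k} x)"
      proof (rule integral_mono')
        show "integrable lborel (\<lambda>x. \<bar>norm (g x)\<bar> * indicator {x. \<phi> x > k} x)"
          using n by (intro Hoelder_indicator(1)[OF _ iR A]) simp
        show "norm (soft_excess' k e (\<phi> x) *\<^sub>R g x) \<le> \<bar>norm (g x)\<bar> * indicator {x. \<phi> x > k} x" for x
          using soft_excess'_bounds(1,2)[OF e, of k "\<phi> x"]
          by (cases "\<phi> x \<le> k") (simp_all add: mult_left_le_one_le soft_excess'_bounds(3)[OF e])
      qed simp
      also have "\<dots> \<le> (LINT x|lborel. \<bar>norm (g x)\<bar> powr r) powr (1 / r) * measure lborel {x. \<phi> x > k} powr (1 - 1 / r)"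
        using n by (intro Hoelder_indicator(2)[OF _ iR A]) simp
      also have "\<dots> \<le> B * measure lborel {x. \<phi> x > k} powr (1 - 1 / r)"
        using B by (intro mult_right_mono) auto
      finally have "(LINT x|lborel. norm (soft_excess' k e (\<phi> x) *\<^sub>R g x)) powr q
          \<le> (B * measure lborel {x. \<phi> x > k} powr (1 - 1 / r)) powr q"
        using q by (intro powr_mono2) auto
      also have "\<dots> = B powr q * measure lborel {x. \<phi> x > k} powr ((1 - 1 / r) * q)"
        by (simp add: powr_mult powr_powr)
      finally show "(LINT x|lborel. \<bar>soft_excess k e (\<phi> x)\<bar> powr q)
          \<le> B powr q * measure lborel {x \<in> space lborel. \<phi> x > k} powr ((1 - 1 / r) * q)"
        using gagliardo_nirenberg_sobolev_1[OF C' dim] by (simp add: q_def n_def)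
    qed measurable
  qed
qed

section \<open>Smooth functions\<close>

lemma Ck_on_SucI:
  assumes "\<And>x. (f has_derivative D x) (at x)" "\<And>v. Ck_on k UNIV (\<lambda>x. D x v)"
  shows "Ck_on (Suc k) UNIV f"
proof -
  have "frechet_derivative f (at x) = D x" for x
    using frechet_derivative_at[OF assms(1)] by simp
  then show ?thesis using assms by (auto simp: differentiable_def)
qed

lemma Ck_on_SucE:
  assumes "Ck_on (Suc k) UNIV f"
  obtains D where "\<And>x. (f has_derivative D x) (at x)" "\<And>v. Ck_on k UNIV (\<lambda>x. D x v)"
  using assms that[of "\<lambda>x. frechet_derivative f (at x)"] by (auto simp: frechet_derivative_works)

lemma Ck_on_continuous: "Ck_on k UNIV f \<Longrightarrow> continuous_on UNIV f"
proof (cases k)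
  case (Suc l)
  assume "Ck_on k UNIV f"
  then show ?thesis unfolding Suc
    by (elim Ck_on_SucE) (auto intro!: continuous_at_imp_continuous_on has_derivative_continuous)
qed simp

lemma Ck_on_lower: "Ck_on (Suc k) UNIV f \<Longrightarrow> Ck_on k UNIV f"
proof (induction k arbitrary: f)
  case 0
  then show ?case using Ck_on_continuous[OF 0] by simp
next
  case (Suc k)
  then show ?case by (elim Ck_on_SucE[of "Suc k"]) (blast intro: Ck_on_SucI)
qed

lemma Ck_on_const: "Ck_on k UNIV (\<lambda>x. c)"
  by (induction k arbitrary: c) (auto intro!: Ck_on_SucI[where D = "\<lambda>_ _. 0"] simp del: Ck_on.simps(2))

lemma Ck_on_add: "Ck_on k UNIV f \<Longrightarrow> Ck_on k UNIV g \<Longrightarrow> Ck_on k UNIV (\<lambda>x. f x + g x)"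
proof (induction k arbitrary: f g)
  case 0
  then show ?case by (auto intro: continuous_intros)
next
  case (Suc k)
  obtain D E where D: "\<And>x. (f has_derivative D x) (at x)" "\<And>v. Ck_on k UNIV (\<lambda>x. D x v)"
    and E: "\<And>x. (g has_derivative E x) (at x)" "\<And>v. Ck_on k UNIV (\<lambda>x. E x v)"
    using Ck_on_SucE[OF Suc.prems(1)] Ck_on_SucE[OF Suc.prems(2)] by metis
  show ?case
    by (rule Ck_on_SucI[where D = "\<lambda>x v. D x v + E x v"]) (intro has_derivative_add D E Suc.IH)+
qed

lemma Ck_on_mult:
  fixes f g :: "'a::euclidean_space \<Rightarrow> real"
  shows "Ck_on k UNIV f \<Longrightarrow> Ck_on k UNIV g \<Longrightarrow> Ck_on k UNIV (\<lambda>x. f x * g x)"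
proof (induction k arbitrary: f g)
  case 0
  then show ?case by (auto intro: continuous_intros)
next
  case (Suc k)
  obtain D E where D: "\<And>x. (f has_derivative D x) (at x)" "\<And>v. Ck_on k UNIV (\<lambda>x. D x v)"
    and E: "\<And>x. (g has_derivative E x) (at x)" "\<And>v. Ck_on k UNIV (\<lambda>x. E x v)"
    using Ck_on_SucE[OF Suc.prems(1)] Ck_on_SucE[OF Suc.prems(2)] by metis
  show ?case
    by (rule Ck_on_SucI[where D = "\<lambda>x v. f x * E x v + D x v * g x"])
      (intro has_derivative_mult D E Ck_on_add Suc.IH Ck_on_lower[OF Suc.prems(1)] Ck_on_lower[OF Suc.prems(2)])+
qed

lemma smooth_on_mult:
  fixes f g :: "'a::euclidean_space \<Rightarrow> real"
  shows "smooth_on UNIV f \<Longrightarrow> smooth_on UNIV g \<Longrightarrow> smooth_on UNIV (\<lambda>x. f x * g x)"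
  by (simp add: smooth_on_def Ck_on_mult)

lemma smooth_on_add: "smooth_on UNIV f \<Longrightarrow> smooth_on UNIV g \<Longrightarrow> smooth_on UNIV (\<lambda>x. f x + g x)"
  by (simp add: smooth_on_def Ck_on_add)

lemma smooth_on_const: "smooth_on UNIV (\<lambda>x. c)"
  by (simp add: smooth_on_def Ck_on_const)

lemma smooth_on_prod:
  fixes f :: "'i \<Rightarrow> 'a::euclidean_space \<Rightarrow> real"
  assumes "\<And>i. i \<in> I \<Longrightarrow> smooth_on UNIV (f i)"
  shows "smooth_on UNIV (\<lambda>x. \<Prod>i\<in>I. f i x)"
  using assms by (induction I rule: infinite_finite_induct) (auto simp: smooth_on_const intro!: smooth_on_mult)

lemma smooth_on_sum:
  assumes "\<And>i. i \<in> I \<Longrightarrow> smooth_on UNIV (f i)"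
  shows "smooth_on UNIV (\<lambda>x. \<Sum>i\<in>I. f i x)"
  using assms by (induction I rule: infinite_finite_induct) (auto simp: smooth_on_const intro!: smooth_on_add)

lemma smooth_on_power:
  fixes f :: "'a::euclidean_space \<Rightarrow> real"
  shows "smooth_on UNIV f \<Longrightarrow> smooth_on UNIV (\<lambda>x. f x ^ m)"
  using smooth_on_prod[of "{..<m}" "\<lambda>_. f"] by simp

text \<open>The functions \<open>t\<^sup>-\<^sup>j exp (- 1/t)\<close> on the positive half-line; their span is closed under
  differentiation.\<close>

definition flat :: "nat \<Rightarrow> real \<Rightarrow> real" where
  "flat j t = (if t > 0 then inverse t ^ j * exp (- inverse t) else 0)"

lemma flat_tendsto_0: "(flat j \<longlongrightarrow> 0) (at 0)"
proof (rule filterlim_split_at)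
  show "(flat j \<longlongrightarrow> 0) (at_left 0)"
    by (rule tendsto_eventually) (auto simp: flat_def eventually_at_left_field intro: exI[of _ "-1"])
  have "((\<lambda>t. inverse t ^ j / exp (inverse t)) \<longlongrightarrow> (0::real)) (at_right 0)"
    by (rule filterlim_compose[OF tendsto_power_div_exp_0 filterlim_inverse_at_top_right])
  then show "(flat j \<longlongrightarrow> 0) (at_right 0)"
    by (rule filterlim_cong[THEN iffD1, OF refl refl, rotated])
      (auto simp: flat_def eventually_at_right_field exp_minus field_simps intro: exI[of _ 1])
qed

lemma flat_derivative: "(flat j has_real_derivative flat (j + 2) t - real j * flat (j + 1) t) (at t)"
proof -
  consider "t > 0" | "t < 0" | "t = 0" by linarith
  then show ?thesis
  proof cases
    case 1
    have "((\<lambda>t. inverse t ^ j * exp (- inverse t)) has_real_derivative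
        inverse t ^ (j + 2) * exp (- inverse t) - real j * (inverse t ^ (j + 1) * exp (- inverse t))) (at t)"
    proof -
      have "((\<lambda>t. inverse t ^ j * exp (- inverse t)) has_real_derivative
          real j * inverse t ^ (j - 1) * (- (inverse t ^ 2)) * exp (- inverse t)
            + inverse t ^ j * (exp (- inverse t) * inverse t ^ 2)) (at t)"
        using 1 by (auto intro!: derivative_eq_intros simp: power2_eq_square)
      moreover have "real j * inverse t ^ (j - 1) * (- (inverse t ^ 2)) = - (real j * inverse t ^ (j + 1))"
        by (cases j) (simp_all add: power2_eq_square)
      ultimately show ?thesis
        by (simp only:) (simp add: power2_eq_square algebra_simps)
    qed
    then have "(flat j has_real_derivative
        inverse t ^ (j + 2) * exp (- inverse t) - real j * (inverse t ^ (j + 1) * exp (- inverse t))) (at t)"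
      by (rule has_field_derivative_transform_within_open[of _ _ _ "{0<..}"]) (use 1 in \<open>auto simp: flat_def\<close>)
    then show ?thesis using 1 by (simp add: flat_def)
  next
    case 2
    have "(flat j has_real_derivative 0) (at t)"
      by (rule has_field_derivative_transform_within_open[OF DERIV_const[of 0], of "{..<0}"])
        (use 2 in \<open>auto simp: flat_def\<close>)
    then show ?thesis using 2 by (simp add: flat_def)
  next
    case 3
    \<comment> \<open>The difference quotient at 0 is itself a member of the family, so its limit is
      already known.\<close>
    have "(\<lambda>h. (flat j (0 + h) - flat j 0) / h) = flat (Suc j)"
      by (auto simp: flat_def fun_eq_iff field_simps)
    then show ?thesis using 3 flat_tendsto_0[of "Suc j"] by (simp add: DERIV_def) (simp add: flat_def)
  qed
qed

text \<open>The induction runs over all \<open>j\<close> together, since differentiation leads to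
  \<open>j + 1\<close> and \<open>j + 2\<close>. The affine argument is meant for the faces of a
  box.\<close>

lemma smooth_on_flat:
  fixes e :: "'a::euclidean_space"
  shows "smooth_on UNIV (\<lambda>x. flat j (c * (x \<bullet> e) + d))"
  unfolding smooth_on_def
proof
  fix k show "Ck_on k UNIV (\<lambda>x :: 'a. flat j (c * (x \<bullet> e) + d))"
  proof (induction k arbitrary: j)
    case 0
    have "continuous_on UNIV (flat j)"
      by (intro continuous_at_imp_continuous_on ballI DERIV_isCont[OF flat_derivative])
    then show ?case
      by (auto intro!: continuous_on_compose2[of UNIV "flat j"] continuous_intros)
  next
    case (Suc k)
    show ?case
    proof (rule Ck_on_SucI)
      fix x :: 'a
      have "((\<lambda>x. c * (x \<bullet> e) + d) has_derivative (\<lambda>v. c * (v \<bullet> e))) (at x)"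
        by (auto intro!: derivative_eq_intros)
      from has_derivative_compose[OF this flat_derivative[unfolded has_field_derivative_def]]
      show "((\<lambda>x. flat j (c * (x \<bullet> e) + d)) has_derivative
         (\<lambda>v. (flat (j + 2) (c * (x \<bullet> e) + d) + - real j * flat (j + 1) (c * (x \<bullet> e) + d)) * (c * (v \<bullet> e)))) (at x)"
        by simp
    next
      fix v :: 'a
      show "Ck_on k UNIV (\<lambda>x. (flat (j + 2) (c * (x \<bullet> e) + d) + - real j * flat (j + 1) (c * (x \<bullet> e) + d)) * (c * (v \<bullet> e)))"
        by (intro Ck_on_mult Ck_on_add Ck_on_const Suc.IH)
    qed
  qed
qed

section \<open>Test functions\<close>

lemma compactly_inside_subset:
  assumes "compactly_inside A \<Omega>" "B \<subseteq> A"
  shows "compactly_inside B \<Omega>"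
  using assms closure_mono[of B A] unfolding compactly_inside_def
  by (metis closed_closure compact_Int_closed inf.absorb_iff2 order_trans)

lemma Cc_inf_C1:
  assumes "\<phi> \<in> Cc_inf \<Omega>"
  shows "C1_compact \<phi> (grad \<phi>)"
proof -
  have C: "Ck_on (Suc 0) UNIV \<phi>" using assms unfolding Cc_inf_def smooth_on_def by blast
  then have d: "(\<phi> has_derivative frechet_derivative \<phi> (at x)) (at x)" for x
    by (auto simp: frechet_derivative_works)
  have "frechet_derivative \<phi> (at x) h = grad \<phi> x \<bullet> h" for x h
  proof -
    interpret linear "frechet_derivative \<phi> (at x)" by (rule has_derivative_linear[OF d])
    have "frechet_derivative \<phi> (at x) h = frechet_derivative \<phi> (at x) (\<Sum>e\<in>Basis. (h \<bullet> e) *\<^sub>R e)"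
      by (simp add: euclidean_representation)
    also have "\<dots> = grad \<phi> x \<bullet> h"
      by (simp add: sum scale grad_def inner_sum_right inner_commute[of _ h] mult.commute)
    finally show ?thesis .
  qed
  then have "(\<phi> has_derivative (\<lambda>h. grad \<phi> x \<bullet> h)) (at x)" for x
    using d[of x] by presburger
  moreover have "continuous_on UNIV (grad \<phi>)"
    unfolding grad_def[abs_def] using C by (auto intro!: continuous_intros)
  moreover have "bounded {x. \<phi> x \<noteq> 0}"
    using assms closure_subset by (auto simp: Cc_inf_def compactly_inside_def intro: bounded_subset[OF compact_imp_bounded])
  ultimately show ?thesis by (simp add: C1_compact_def)
qed

lemma C1_compact_unique:
  assumes "C1_compact \<phi> g" "C1_compact \<phi> h"
  shows "g = h"
proof
  fix x
  have "(\<lambda>k. g x \<bullet> k) = (\<lambda>k. h x \<bullet> k)"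
    using assms by (auto simp: C1_compact_def intro: has_derivative_unique)
  then show "g x = h x" by (metis vector_eq_rdot)
qed

lemma Cc_inf_support:
  assumes "\<phi> \<in> Cc_inf \<Omega>"
  obtains K where "compact K" "K \<subseteq> \<Omega>" "\<And>x. x \<notin> K \<Longrightarrow> \<phi> x = 0" "\<And>x. x \<notin> K \<Longrightarrow> grad \<phi> x = 0"
proof (rule that[of "closure {x. \<phi> x \<noteq> 0}"])
  show "compact (closure {x. \<phi> x \<noteq> 0})" "closure {x. \<phi> x \<noteq> 0} \<subseteq> \<Omega>"
    using assms by (auto simp: Cc_inf_def compactly_inside_def)
  show *: "\<phi> x = 0" if "x \<notin> closure {x. \<phi> x \<noteq> 0}" for x
    using that closure_subset[of "{x. \<phi> x \<noteq> 0}"] by auto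
  fix x assume x: "x \<notin> closure {x. \<phi> x \<noteq> 0}"
  have "(\<phi> has_derivative (\<lambda>h. 0)) (at x)"
  proof (rule has_derivative_transform_within_open)
    show "((\<lambda>_. 0 :: real) has_derivative (\<lambda>h. 0)) (at x)" by simp
    show "open (- closure {x. \<phi> x \<noteq> 0})" by (rule open_Compl) (rule closed_closure)
    show "x \<in> - closure {x. \<phi> x \<noteq> 0}" using x by simp
    show "0 = \<phi> y" if "y \<in> - closure {x. \<phi> x \<noteq> 0}" for y using *[of y] that by simp
  qed
  with Cc_inf_C1[OF assms] have "(\<lambda>h. grad \<phi> x \<bullet> h) = (\<lambda>h. 0)"
    by (auto simp: C1_compact_def intro: has_derivative_unique)
  then have "grad \<phi> x \<bullet> grad \<phi> x = 0" by meson
  then show "grad \<phi> x = 0" by simp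
qed

text \<open>The polynomial has no constant term, so the support does not grow. Coefficients and
  powers are arranged so that \<open>Q'\<close> can be any prescribed polynomial.\<close>

lemma Cc_inf_polynomial:
  fixes a :: "nat \<Rightarrow> real" and m :: nat
  assumes \<phi>: "\<phi> \<in> Cc_inf \<Omega>"
  defines "Q \<equiv> \<lambda>t. (\<Sum>i\<le>m. a i * t ^ Suc i)"
  defines "Q' \<equiv> \<lambda>t. (\<Sum>i\<le>m. a i * (1 + real i) * t ^ i)"
  shows "(\<lambda>x. Q (\<phi> x)) \<in> Cc_inf \<Omega>" "grad (\<lambda>x. Q (\<phi> x)) = (\<lambda>x. Q' (\<phi> x) *\<^sub>R grad \<phi> x)"
proof -
  have "smooth_on UNIV (\<lambda>x. Q (\<phi> x))"
    unfolding Q_def using \<phi>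
    by (intro smooth_on_sum smooth_on_mult smooth_on_const smooth_on_power) (auto simp: Cc_inf_def)
  moreover have "compactly_inside {x. Q (\<phi> x) \<noteq> 0} \<Omega>"
    by (rule compactly_inside_subset[of "{x. \<phi> x \<noteq> 0}"]) (use \<phi> in \<open>auto simp: Cc_inf_def Q_def\<close>)
  ultimately show *: "(\<lambda>x. Q (\<phi> x)) \<in> Cc_inf \<Omega>" by (simp add: Cc_inf_def)
  have "C1_compact (\<lambda>x. Q (\<phi> x)) (\<lambda>x. Q' (\<phi> x) *\<^sub>R grad \<phi> x)"
  proof (rule C1_compact_compose[OF Cc_inf_C1[OF \<phi>]])
    show "(Q has_real_derivative Q' t) (at t)" for t
    proof -
      have "((\<lambda>t. a i * t ^ Suc i) has_real_derivative a i * (1 + real i) * t ^ i) (at t)" for i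
        using DERIV_cmult[OF DERIV_pow[of "Suc i" t UNIV], of "a i"] by (simp add: algebra_simps)
      then show ?thesis unfolding Q_def Q'_def by (intro DERIV_sum)
    qed
    show "continuous_on UNIV Q'" unfolding Q'_def by (intro continuous_intros)
  qed (simp add: Q_def)
  from C1_compact_unique[OF Cc_inf_C1[OF *] this]
  show "grad (\<lambda>x. Q (\<phi> x)) = (\<lambda>x. Q' (\<phi> x) *\<^sub>R grad \<phi> x)" .
qed

text \<open>For \<open>t > 0\<close> the values \<open>flat 0 (real (Suc k) * t)\<close> tend to 1,
  for other \<open>t\<close> they are 0. Taking \<open>t\<close> as the signed distance to each face
  and multiplying gives functions that vanish exactly outside the open box.\<close>

lemma Cc_inf_box_bump:
  fixes a b :: "'a::euclidean_space"
  assumes "cbox a b \<subseteq> \<Omega>"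
  obtains \<phi> where "\<And>k. \<phi> k \<in> Cc_inf \<Omega>" "\<And>k x. 0 \<le> \<phi> k x" "\<And>k x. \<phi> k x \<le> indicator (box a b) x"
    "\<And>x. (\<lambda>k. \<phi> k x) \<longlonglongrightarrow> indicator (box a b) x"
proof -
  define \<phi> where "\<phi> k x = (\<Prod>e\<in>Basis. flat 0 (real (Suc k) * (x \<bullet> e) + (- real (Suc k) * (a \<bullet> e)))
      * flat 0 ((- real (Suc k)) * (x \<bullet> e) + real (Suc k) * (b \<bullet> e)))" for k and x :: 'a
  have flat: "flat 0 t \<ge> 0" "flat 0 t \<le> 1" "flat 0 t \<noteq> 0 \<longleftrightarrow> t > 0" for t by (auto simp: flat_def)
  have arg: "real (Suc k) * (x \<bullet> e) + (- real (Suc k) * (a \<bullet> e)) = real (Suc k) * (x \<bullet> e - a \<bullet> e)"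
    "(- real (Suc k)) * (x \<bullet> e) + real (Suc k) * (b \<bullet> e) = real (Suc k) * (b \<bullet> e - x \<bullet> e)" for k x e
    by (simp_all add: algebra_simps)
  have nz: "\<phi> k x \<noteq> 0 \<longleftrightarrow> x \<in> box a b" for k x
    unfolding \<phi>_def arg by (auto simp: flat box_def zero_less_mult_iff)
  have nn: "0 \<le> \<phi> k x" for k x unfolding \<phi>_def by (intro prod_nonneg mult_nonneg_nonneg flat ballI)
  have le1: "\<phi> k x \<le> 1" for k x
    unfolding \<phi>_def by (intro prod_le_1 conjI mult_nonneg_nonneg mult_le_one flat)
  have smooth: "smooth_on UNIV (\<phi> k)" for k
    unfolding \<phi>_def by (intro smooth_on_prod smooth_on_mult smooth_on_flat)
  have "compactly_inside (cbox a b) \<Omega>" using assms by (simp add: compactly_inside_def)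
  then have "compactly_inside {x. \<phi> k x \<noteq> 0} \<Omega>" for k
    by (rule compactly_inside_subset) (use nz box_subset_cbox[of a b] in auto)
  with smooth have C: "\<phi> k \<in> Cc_inf \<Omega>" for k by (simp add: Cc_inf_def)
  have lim1: "(\<lambda>k. flat 0 (real (Suc k) * t)) \<longlonglongrightarrow> 1" if "t > 0" for t
  proof -
    have "(\<lambda>k. exp (- (inverse t * inverse (real (Suc k))))) \<longlonglongrightarrow> exp (- (inverse t * 0))"
      by (intro tendsto_intros LIMSEQ_inverse_real_of_nat)
    moreover have "flat 0 (real (Suc k) * t) = exp (- (inverse t * inverse (real (Suc k))))" for k
      using that by (simp add: flat_def mult.commute)
    ultimately show ?thesis by simp
  qed
  have lim: "(\<lambda>k. \<phi> k x) \<longlonglongrightarrow> indicator (box a b) x" for x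
  proof (cases "x \<in> box a b")
    case True
    have "(\<lambda>k. \<phi> k x) \<longlonglongrightarrow> (\<Prod>e\<in>(Basis::'a set). 1 * 1)"
      unfolding \<phi>_def arg using True by (intro tendsto_intros lim1) (auto simp: box_def)
    then show ?thesis using True by simp
  next
    case False
    then have "\<phi> k x = 0" for k using nz by blast
    then show ?thesis using False by simp
  qed
  show ?thesis
  proof (rule that[of \<phi>])
    show "\<phi> k x \<le> indicator (box a b) x" for k x
      using le1[of k x] nz[of k x] by (cases "x \<in> box a b") auto
  qed (use C nn lim in auto)
qed

section \<open>The fundamental lemma of the calculus of variations\<close>

text \<open>By Henstock's lemma the Riemann sums of \<open>\<bar>f\<bar>\<close> are small, because the integrals of \<open>f\<close> over the
  pieces of any division vanish.\<close>

lemma AE_eq_0_if_box_integrals_0: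
  fixes f :: "'a::euclidean_space \<Rightarrow> real"
  assumes f: "f absolutely_integrable_on cbox a b"
    and 0: "\<And>c d. cbox c d \<subseteq> cbox a b \<Longrightarrow> integral (cbox c d) f = 0"
  shows "AE x in lebesgue_on (cbox a b). f x = 0"
proof -
  have int: "f integrable_on cbox a b" "(\<lambda>x. \<bar>f x\<bar>) integrable_on cbox a b"
    using f[unfolded absolutely_integrable_on_def] unfolding real_norm_def by blast+
  define I where "I = integral (cbox a b) (\<lambda>x. \<bar>f x\<bar>)"
  have "I \<le> 0"
  proof (rule field_le_epsilon)
    fix e :: real assume "e > 0"
    then have e: "e / 2 > 0" by simp
    obtain \<gamma>1 where 1: "gauge \<gamma>1"
      "\<And>p. \<lbrakk>p tagged_partial_division_of (cbox a b); \<gamma>1 fine p\<rbrakk> \<Longrightarrow> sum (\<lambda>(x,k). norm (measure lborel k *\<^sub>R f x - integral k f)) p < e / 2"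
      by (rule Henstock_lemma[OF int(1) e]) (rule that, assumption+)
    have "((\<lambda>x. \<bar>f x\<bar>) has_integral I) (cbox a b)" unfolding I_def using int by (intro integrable_integral)
    from has_integral[THEN iffD1, rule_format, OF this e] obtain \<gamma>2 where 2: "gauge \<gamma>2"
      "\<forall>p. p tagged_division_of (cbox a b) \<and> \<gamma>2 fine p \<longrightarrow> norm ((\<Sum>(x, k)\<in>p. measure lborel k *\<^sub>R \<bar>f x\<bar>) - I) < e / 2"
      by (elim exE conjE)
    \<comment> \<open>One division serves both gauges: the first makes the Riemann sum of
      \<open>\<bar>f\<bar>\<close> small, the second brings the same sum within \<open>e / 2\<close>
      of \<open>I\<close>.\<close>
    obtain p where p: "p tagged_division_of (cbox a b)" "(\<lambda>x. \<gamma>1 x \<inter> \<gamma>2 x) fine p"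
      by (rule fine_division_exists[OF gauge_Int[OF 1(1) 2(1)], of a b])
    then have fine: "\<gamma>1 fine p" "\<gamma>2 fine p" by (auto simp: fine_Int)
    have "(\<Sum>(x, k)\<in>p. norm (measure lborel k *\<^sub>R f x - integral k f)) = (\<Sum>(x, k)\<in>p. measure lborel k *\<^sub>R \<bar>f x\<bar>)"
    proof (intro sum.cong refl, clarify)
      fix x k assume xk: "(x, k) \<in> p"
      obtain c d where "k = cbox c d" using tagged_division_ofD(4)[OF p(1) xk] by blast
      moreover have "k \<subseteq> cbox a b" using tagged_division_ofD(3)[OF p(1) xk] .
      ultimately have "integral k f = 0" using 0[of c d] by blast
      then show "norm (measure lborel k *\<^sub>R f x - integral k f) = measure lborel k *\<^sub>R \<bar>f x\<bar>"
        by (simp add: abs_mult)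
    qed
    then have "(\<Sum>(x, k)\<in>p. measure lborel k *\<^sub>R \<bar>f x\<bar>) < e / 2"
      using 1(2)[of p] p(1) fine by (simp add: tagged_division_of_def)
    then show "I \<le> 0 + e" using 2(2)[rule_format, OF conjI[OF p(1) fine(2)]] unfolding real_norm_def by linarith
  qed
  have L: "integrable (lebesgue_on (cbox a b)) (\<lambda>x. \<bar>f x\<bar>)"
    using f by (simp add: set_integrable_def integrable_restrict_space)
  have "integral\<^sup>L (lebesgue_on (cbox a b)) (\<lambda>x. \<bar>f x\<bar>) = 0"
    using lebesgue_integral_eq_integral[OF L] \<open>I \<le> 0\<close> integral_nonneg[OF int(2)] by (simp add: I_def)
  then show ?thesis
    using integral_nonneg_eq_0_iff_AE[OF L] by simp
qed

lemma integrable_lebesgue_on_indicator_iff: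
  fixes f :: "'a::euclidean_space \<Rightarrow> 'b::euclidean_space"
  assumes "S \<in> sets lebesgue" "K \<in> sets lebesgue" "K \<subseteq> S"
  shows "integrable (lebesgue_on S) (\<lambda>x. indicator K x *\<^sub>R f x) \<longleftrightarrow> f absolutely_integrable_on K"
proof -
  have "(\<lambda>x. indicator S x *\<^sub>R indicator K x *\<^sub>R f x) = (\<lambda>x. indicator K x *\<^sub>R f x)"
    using assms(3) by (auto simp: indicator_def fun_eq_iff)
  then show ?thesis using assms(1) by (simp add: integrable_restrict_space set_integrable_def del: scaleR_scaleR)
qed

lemma integrable_test_mult:
  fixes g :: "'a::euclidean_space \<Rightarrow> 'b::euclidean_space" and \<phi> :: "'a \<Rightarrow> real"
  assumes "open \<Omega>" "locally_integrable \<Omega> g" "continuous_on UNIV \<phi>" "compact K" "K \<subseteq> \<Omega>" "\<And>x. x \<notin> K \<Longrightarrow> \<phi> x = 0"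
  shows "integrable (lebesgue_on \<Omega>) (\<lambda>x. \<phi> x *\<^sub>R g x)"
proof -
  have sets: "\<Omega> \<in> sets lebesgue" "K \<in> sets lebesgue" using assms by (auto simp: lmeasurable_compact fmeasurableD)
  have "bounded (\<phi> ` K)"
    using assms by (intro compact_imp_bounded compact_continuous_image) (auto intro: continuous_on_subset)
  then obtain M where M: "\<And>x. x \<in> K \<Longrightarrow> \<bar>\<phi> x\<bar> \<le> M" by (auto simp: bounded_iff)
  have int: "integrable (lebesgue_on \<Omega>) (\<lambda>x. indicator K x *\<^sub>R g x)"
    using assms sets by (simp add: integrable_lebesgue_on_indicator_iff locally_integrable_def)
  have [measurable]: "\<phi> \<in> borel_measurable (lebesgue_on \<Omega>)"
    using assms sets by (intro continuous_imp_measurable_on_sets_lebesgue) (auto intro: continuous_on_subset)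
  have "integrable (lebesgue_on \<Omega>) (\<lambda>x. \<phi> x *\<^sub>R (indicator K x *\<^sub>R g x))"
  proof (rule Bochner_Integration.integrable_bound[where f = "\<lambda>x. M *\<^sub>R (indicator K x *\<^sub>R g x)"])
    show "AE x in lebesgue_on \<Omega>. norm (\<phi> x *\<^sub>R indicator K x *\<^sub>R g x) \<le> norm (M *\<^sub>R (indicator K x *\<^sub>R g x))"
      using M by (intro AE_I2) (force simp: indicator_def intro!: mult_right_mono)
    show "(\<lambda>x. \<phi> x *\<^sub>R indicator K x *\<^sub>R g x) \<in> borel_measurable (lebesgue_on \<Omega>)"
      using borel_measurable_integrable[OF int] by (rule borel_measurable_scaleR[rotated]) measurable
  qed (intro integrable_scaleR_right int)
  moreover have "(\<lambda>x. \<phi> x *\<^sub>R (indicator K x *\<^sub>R g x)) = (\<lambda>x. \<phi> x *\<^sub>R g x)"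
    using assms(6) by (force simp: indicator_def)
  ultimately show ?thesis by metis
qed

text \<open>Bump functions converge to indicators of boxes, so by dominated convergence the
  integrals of \<open>f\<close> over boxes inside \<open>\<Omega>\<close> vanish. Countably many
  boxes cover \<open>\<Omega>\<close>, so the exceptional sets remain null.\<close>

lemma fundamental_lemma:
  fixes f :: "'a::euclidean_space \<Rightarrow> real"
  assumes \<Omega>: "open \<Omega>" and f: "locally_integrable \<Omega> f"
    and 0: "\<And>\<phi>. \<phi> \<in> Cc_inf \<Omega> \<Longrightarrow> (LINT x|lebesgue_on \<Omega>. \<phi> x * f x) = 0"
  shows "AE x in lebesgue_on \<Omega>. f x = 0"
proof -
  have s\<Omega>: "\<Omega> \<in> sets lebesgue" using \<Omega> by auto
  have box: "integral (cbox a b) f = 0" if ab: "cbox a b \<subseteq> \<Omega>" for a b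
  proof -
    obtain \<phi> where \<phi>: "\<And>k. \<phi> k \<in> Cc_inf \<Omega>" "\<And>k x. 0 \<le> \<phi> k x" "\<And>k x. \<phi> k x \<le> indicator (box a b) x"
      "\<And>x. (\<lambda>k. \<phi> k x) \<longlonglongrightarrow> indicator (box a b) x"
      using Cc_inf_box_bump[OF ab] by metis
    have abs: "f absolutely_integrable_on cbox a b"
      using f ab by (auto simp: locally_integrable_def)
    then have abs': "f absolutely_integrable_on box a b"
      by (rule set_integrable_subset) (auto simp: box_subset_cbox)
    have bs: "box a b \<subseteq> \<Omega>" using ab box_subset_cbox by blast
    have int: "integrable (lebesgue_on \<Omega>) (\<lambda>x. indicator (box a b) x *\<^sub>R f x)"
      using abs' s\<Omega> bs by (subst integrable_lebesgue_on_indicator_iff) auto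
    have meas: "(\<lambda>x. \<phi> k x * f x) \<in> borel_measurable (lebesgue_on \<Omega>)" for k
    proof -
      obtain K where "compact K" "K \<subseteq> \<Omega>" "\<And>x. x \<notin> K \<Longrightarrow> \<phi> k x = 0"
        using Cc_inf_support[OF \<phi>(1)] by metis
      then have "integrable (lebesgue_on \<Omega>) (\<lambda>x. \<phi> k x *\<^sub>R f x)"
        using \<Omega> f C1_compact_continuous(1)[OF Cc_inf_C1[OF \<phi>(1)]] by (intro integrable_test_mult)
      then show ?thesis by auto
    qed
    have "(\<lambda>k. LINT x|lebesgue_on \<Omega>. \<phi> k x * f x) \<longlonglongrightarrow> (LINT x|lebesgue_on \<Omega>. indicator (box a b) x * f x)"
    proof (rule integral_dominated_convergence[where w = "\<lambda>x. \<bar>indicator (box a b) x *\<^sub>R f x\<bar>"])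
      show "AE x in lebesgue_on \<Omega>. (\<lambda>k. \<phi> k x * f x) \<longlonglongrightarrow> indicator (box a b) x * f x"
        by (intro AE_I2 tendsto_intros \<phi>)
      have "\<bar>\<phi> k x * f x\<bar> \<le> \<bar>indicator (box a b) x * f x\<bar>" for k x
        using \<phi>(2,3)[of k x] by (simp add: abs_mult mult_right_mono)
      then show "AE x in lebesgue_on \<Omega>. norm (\<phi> k x * f x) \<le> \<bar>indicator (box a b) x *\<^sub>R f x\<bar>" for k
        by simp
    qed (use meas int in auto)
    then have "(LINT x|lebesgue_on \<Omega>. indicator (box a b) x * f x) = 0"
      using 0[OF \<phi>(1)] by (simp add: LIMSEQ_const_iff)
    also have "(LINT x|lebesgue_on \<Omega>. indicator (box a b) x * f x) = (LINT x|lebesgue. indicator (box a b) x *\<^sub>R f x)"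
      using s\<Omega> bs by (subst integral_restrict_space) (auto intro!: Bochner_Integration.integral_cong simp: indicator_def)
    also have "\<dots> = integral (box a b) f"
      using set_lebesgue_integral_eq_integral(2)[OF abs'] by (simp add: set_lebesgue_integral_def)
    finally show ?thesis by (simp add: integral_open_interval)
  qed
  obtain \<D> where \<D>: "countable \<D>" "\<D> \<subseteq> Pow \<Omega>" "\<And>X. X \<in> \<D> \<Longrightarrow> \<exists>a b. X = cbox a b" "\<Union>\<D> = \<Omega>"
    using open_countable_Union_open_cbox[OF \<Omega>] by metis
  have "AE x in lebesgue. x \<in> X \<longrightarrow> f x = 0" if XD: "X \<in> \<D>" for X
  proof -
    obtain a b where X: "X = cbox a b" using \<D>(3)[OF XD] by blast
    have ab: "cbox a b \<subseteq> \<Omega>" using X \<D>(2) XD by blast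
    have "AE x in lebesgue_on (cbox a b). f x = 0"
      using f ab by (intro AE_eq_0_if_box_integrals_0 box) (auto simp: locally_integrable_def)
    then show ?thesis using X by (simp add: AE_restrict_space_iff)
  qed
  then have "AE x in lebesgue. \<forall>X\<in>\<D>. x \<in> X \<longrightarrow> f x = 0"
    using \<D>(1) by (subst AE_ball_countable) auto
  then have "AE x in lebesgue. x \<in> \<Omega> \<longrightarrow> f x = 0"
    by eventually_elim (use \<D>(4) in blast)
  then show ?thesis using s\<Omega> by (simp add: AE_restrict_space_iff)
qed

section \<open>Uniqueness of weak gradients\<close>

lemma locally_integrable_diff:
  "locally_integrable \<Omega> f \<Longrightarrow> locally_integrable \<Omega> g \<Longrightarrow> locally_integrable \<Omega> (\<lambda>x. f x - g x)"
  by (auto simp: locally_integrable_def)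

text \<open>The fundamental lemma in each coordinate. It ties the arbitrary representative
  \<open>wgrad\<close> to any weak gradient found by computation.\<close>

lemma weak_gradient_unique:
  assumes \<Omega>: "open \<Omega>" and g: "has_weak_gradient \<Omega> u g" and h: "has_weak_gradient \<Omega> u h"
  shows "AE x in lebesgue_on \<Omega>. g x = h x"
proof -
  have loc: "locally_integrable \<Omega> g" "locally_integrable \<Omega> h"
    using g h by (auto simp: has_weak_gradient_def)
  have "AE x in lebesgue_on \<Omega>. (g x - h x) \<bullet> b = 0" for b
  proof (rule fundamental_lemma[OF \<Omega>])
    have "(\<lambda>x. (g x - h x) \<bullet> b) absolutely_integrable_on K" if "(\<lambda>x. g x - h x) absolutely_integrable_on K" for K
      using absolutely_integrable_linear[OF that bounded_linear_inner_left[of b]] by (simp add: o_def)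
    then show "locally_integrable \<Omega> (\<lambda>x. (g x - h x) \<bullet> b)"
      using locally_integrable_diff[OF loc] by (auto simp: locally_integrable_def)
    fix \<phi> assume \<phi>: "\<phi> \<in> Cc_inf \<Omega>"
    obtain K where K: "compact K" "K \<subseteq> \<Omega>" "\<And>x. x \<notin> K \<Longrightarrow> \<phi> x = 0"
      using Cc_inf_support[OF \<phi>] by metis
    note int = integrable_test_mult[OF \<Omega> _ C1_compact_continuous(1)[OF Cc_inf_C1[OF \<phi>]] K]
    have "(LINT x|lebesgue_on \<Omega>. \<phi> x *\<^sub>R g x) = (LINT x|lebesgue_on \<Omega>. \<phi> x *\<^sub>R h x)"
      using g h \<phi> by (auto simp: has_weak_gradient_def)
    then have "(LINT x|lebesgue_on \<Omega>. \<phi> x *\<^sub>R (g x - h x)) = 0"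
      using int[OF loc(1)] int[OF loc(2)] by (simp add: scaleR_diff_right)
    then have "(LINT x|lebesgue_on \<Omega>. \<phi> x *\<^sub>R (g x - h x)) \<bullet> b = 0" by simp
    then show "(LINT x|lebesgue_on \<Omega>. \<phi> x * ((g x - h x) \<bullet> b)) = 0"
      using int[OF locally_integrable_diff[OF loc]] by (simp flip: integral_inner_left)
  qed
  then have "AE x in lebesgue_on \<Omega>. \<forall>b\<in>Basis. (g x - h x) \<bullet> b = 0"
    by (intro AE_finite_allI) auto
  then show ?thesis
    by eventually_elim (auto simp: inner_diff_left intro: euclidean_eqI)
qed

lemma wgrad_AE_eq:
  assumes "open \<Omega>" "has_weak_gradient \<Omega> u g"
  shows "AE x in lebesgue_on \<Omega>. wgrad \<Omega> u x = g x"
  using weak_gradient_unique[OF assms(1) _ assms(2)] assms(2) someI[of "has_weak_gradient \<Omega> u" g]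
  by (simp add: wgrad_def)

section \<open>Weighted spaces\<close>

text \<open>Completeness of Lebesgue measure. It gives measurability to functions known only up to
  null sets, such as \<open>wgrad\<close> or the integrand containing \<open>A\<close>.\<close>

lemma borel_measurable_lebesgue_on_AE:
  fixes f g :: "'a::euclidean_space \<Rightarrow> 'b::euclidean_space"
  assumes S: "S \<in> sets lebesgue" and f: "f \<in> borel_measurable (lebesgue_on S)"
    and ae: "AE x in lebesgue_on S. f x = g x"
  shows "g \<in> borel_measurable (lebesgue_on S)"
proof -
  have "(\<lambda>x. indicator S x *\<^sub>R f x) \<in> borel_measurable lebesgue"
    using f S by (simp add: borel_measurable_restrict_space_iff)
  moreover have "AE x in lebesgue. x \<in> S \<longrightarrow> f x = g x"
    using ae S by (simp add: AE_restrict_space_iff)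
  then have "AE x in lebesgue. indicator S x *\<^sub>R f x = indicator S x *\<^sub>R g x"
    by eventually_elim (auto simp: indicator_def)
  ultimately have "(\<lambda>x. indicator S x *\<^sub>R g x) \<in> borel_measurable lebesgue"
    by (rule borel_measurable_AE)
  then show ?thesis using S by (simp add: borel_measurable_restrict_space_iff)
qed

lemma integrable_imp_locally_integrable:
  fixes f :: "'a::euclidean_space \<Rightarrow> 'b::euclidean_space"
  assumes "\<Omega> \<in> sets lebesgue" "integrable (lebesgue_on \<Omega>) f"
  shows "locally_integrable \<Omega> f"
proof -
  have "f absolutely_integrable_on \<Omega>"
    using assms by (simp add: integrable_restrict_space set_integrable_def)
  then show ?thesis
    unfolding locally_integrable_def
    by (auto intro: set_integrable_subset lmeasurable_compact[THEN fmeasurableD])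
qed

text \<open>A crude substitute for Minkowski's inequality, through the maximum of the three terms.
  The constant is harmless: it multiplies null sequences or enters a Sobolev constant.\<close>

lemma powr_add3_le:
  fixes a b c p :: real
  assumes "a \<ge> 0" "b \<ge> 0" "c \<ge> 0" "p \<ge> 0"
  shows "(a + b + c) powr p \<le> 3 powr p * (a powr p + b powr p + c powr p)"
proof -
  define m where "m = max a (max b c)"
  have "(a + b + c) powr p \<le> (3 * m) powr p"
    using assms by (intro powr_mono2) (auto simp: m_def)
  also have "\<dots> = 3 powr p * m powr p" using assms by (simp add: powr_mult m_def)
  also have "m powr p \<le> a powr p + b powr p + c powr p"
    by (auto simp: m_def max_def)
  finally show ?thesis by simp
qed

text \<open>Fatou's lemma, with integrability of the limit as part of the conclusion. The bounds may
  depend on \<open>k\<close> because those coming from approximating test functions only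
  converge.\<close>

lemma integral_le_of_tendsto:
  fixes f :: "nat \<Rightarrow> 'a \<Rightarrow> real"
  assumes F: "\<And>k. integrable M (f k)" "\<And>k. AE x in M. 0 \<le> f k x" and g: "g \<in> borel_measurable M"
    and lim: "AE x in M. (\<lambda>k. f k x) \<longlonglongrightarrow> g x"
    and B: "\<And>k. (LINT x|M. f k x) \<le> B k" "B \<longlonglongrightarrow> C"
  shows "integrable M g" "(LINT x|M. g x) \<le> C"
proof -
  have nn: "AE x in M. \<forall>k. 0 \<le> f k x" using F(2) by (simp add: AE_all_countable)
  have g0: "AE x in M. 0 \<le> g x"
    using nn lim by eventually_elim (auto intro: LIMSEQ_le_const)
  have B0: "B k \<ge> 0" for k
    using B(1)[of k] integral_nonneg_AE[OF F(2)[of k]] by linarith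
  have C0: "C \<ge> 0" using B(2) B0 by (auto intro: LIMSEQ_le_const)
  have "(\<integral>\<^sup>+x. ennreal (g x) \<partial>M) = (\<integral>\<^sup>+x. liminf (\<lambda>k. ennreal (f k x)) \<partial>M)"
  proof (intro nn_integral_cong_AE)
    show "AE x in M. ennreal (g x) = liminf (\<lambda>k. ennreal (f k x))"
      using lim
    proof eventually_elim
      case (elim x)
      then have "(\<lambda>k. ennreal (f k x)) \<longlonglongrightarrow> ennreal (g x)" by (rule tendsto_ennrealI)
      then show ?case by (intro lim_imp_Liminf[symmetric]) auto
    qed
  qed
  also have "\<dots> \<le> liminf (\<lambda>k. \<integral>\<^sup>+x. ennreal (f k x) \<partial>M)"
    using borel_measurable_integrable[OF F(1)] by (intro nn_integral_liminf) measurable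
  also have "\<dots> \<le> liminf (\<lambda>k. ennreal (B k))"
  proof (intro Liminf_mono always_eventually allI)
    fix k
    have "(\<integral>\<^sup>+x. ennreal (f k x) \<partial>M) = ennreal (LINT x|M. f k x)"
      by (rule nn_integral_eq_integral[OF F])
    then show "(\<integral>\<^sup>+x. ennreal (f k x) \<partial>M) \<le> ennreal (B k)"
      using B(1)[of k] by (simp add: ennreal_leI)
  qed
  also have "\<dots> = ennreal C"
    using tendsto_ennrealI[OF B(2)] by (intro lim_imp_Liminf) auto
  finally have *: "(\<integral>\<^sup>+x. ennreal (g x) \<partial>M) \<le> ennreal C" .
  show "integrable M g"
    by (rule integrableI_nonneg[OF g g0]) (rule le_less_trans[OF *], simp)
  then have "ennreal (LINT x|M. g x) \<le> ennreal C"
    using * nn_integral_eq_integral[OF _ g0] by simp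
  then show "(LINT x|M. g x) \<le> C" using C0 by (simp add: ennreal_le_iff)
qed

text \<open>Integrability of \<open>w\<close> puts bounded functions into the weighted space;
  integrability of the dual power puts that space into the unweighted space of integrable functions,
  where weak gradients make sense.\<close>

locale weighted_domain =
  fixes \<Omega> :: "'a::euclidean_space set" and w :: "'a \<Rightarrow> real" and p :: real
  assumes open_dom: "open \<Omega>" and bounded_dom: "bounded \<Omega>" and p: "p > 1"
    and w_int: "integrable (lebesgue_on \<Omega>) w"
    and w_pos: "AE x in lebesgue_on \<Omega>. w x > 0"
    and w_dual: "integrable (lebesgue_on \<Omega>) (\<lambda>x. w x powr (- 1 / (p - 1)))"
begin

abbreviation \<mu> :: "'a measure" where
  "\<mu> \<equiv> lebesgue_on \<Omega>"

abbreviation Lpw :: "('a \<Rightarrow> 'b::euclidean_space) set" where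
  "Lpw \<equiv> Lp_weighted \<Omega> w p"

abbreviation W0 :: "('a \<Rightarrow> real) set" where
  "W0 \<equiv> W01p \<Omega> w p"

text \<open>The \<open>p\<close>-th power of the weighted norm. The free range type lets the same
  notion serve functions and gradients.\<close>

definition energy :: "('a \<Rightarrow> 'b::euclidean_space) \<Rightarrow> real" where
  "energy v = (LINT x|\<mu>. norm (v x) powr p * w x)"

lemma sets_dom: "\<Omega> \<in> sets lebesgue"
  using open_dom by auto

lemma w_measurable [measurable]: "w \<in> borel_measurable \<mu>"
  using w_int by (rule borel_measurable_integrable)

lemma energy_nonneg [simp]: "energy v \<ge> 0"
  unfolding energy_def using w_pos by (intro integral_nonneg_AE) (auto elim: eventually_mono)

lemma Lp_weightedD:
  assumes "v \<in> Lpw"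
  shows "v \<in> borel_measurable \<mu>" "integrable \<mu> (\<lambda>x. norm (v x) powr p * w x)"
  using assms by (auto simp: Lp_weighted_def)

lemma Lp_weightedI:
  assumes "v \<in> borel_measurable \<mu>" "u \<in> Lpw" "h \<in> Lpw"
    and "AE x in \<mu>. norm (v x) \<le> c * (norm (u x) + norm (h x))" "c \<ge> 0"
  shows "v \<in> Lpw"
proof -
  note [measurable] = assms(1) Lp_weightedD(1)[OF assms(2)] Lp_weightedD(1)[OF assms(3)]
  have "integrable \<mu> (\<lambda>x. norm (v x) powr p * w x)"
  proof (rule Bochner_Integration.integrable_bound)
    show "integrable \<mu> (\<lambda>x. (c powr p * 3 powr p) * (norm (u x) powr p * w x + norm (h x) powr p * w x))"
      by (intro integrable_mult_right Bochner_Integration.integrable_add Lp_weightedD(2) assms)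
    show "AE x in \<mu>. norm (norm (v x) powr p * w x)
        \<le> norm ((c powr p * 3 powr p) * (norm (u x) powr p * w x + norm (h x) powr p * w x))"
      using assms(4) w_pos
    proof eventually_elim
      case (elim x)
      have "norm (v x) powr p \<le> (c * (norm (u x) + norm (h x) + 0)) powr p"
        using elim p by (intro powr_mono2) auto
      also have "\<dots> = c powr p * (norm (u x) + norm (h x) + 0) powr p"
        by (rule powr_mult)
      also have "\<dots> \<le> c powr p * (3 powr p * (norm (u x) powr p + norm (h x) powr p + 0 powr p))"
        using p by (intro mult_left_mono powr_add3_le) auto
      finally have "norm (v x) powr p * w x \<le> (c powr p * 3 powr p * (norm (u x) powr p + norm (h x) powr p)) * w x"
        using elim p by (intro mult_right_mono) auto
      moreover have "0 \<le> norm (v x) powr p * w x" using elim by simp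
      ultimately show ?case unfolding real_norm_def by (simp add: distrib_left distrib_right mult.assoc)
    qed
  qed measurable
  then show ?thesis using assms(1) by (simp add: Lp_weighted_def)
qed

lemma Lp_weighted_diff:
  assumes "u \<in> Lpw" "h \<in> Lpw"
  shows "(\<lambda>x. u x - h x) \<in> Lpw"
  by (rule Lp_weightedI[OF _ assms, of _ 1])
    (use Lp_weightedD(1)[OF assms(1)] Lp_weightedD(1)[OF assms(2)] norm_triangle_ineq4 in auto)

text \<open>Plays the part of the triangle inequality; three terms match the splitting of the error
  in the chain rule.\<close>

lemma energy_le3:
  assumes v: "v \<in> borel_measurable \<mu>"
    and a: "a \<in> Lpw" and b: "b \<in> Lpw" and c: "c \<in> Lpw"
    and le: "AE x in \<mu>. norm (v x) \<le> A * norm (a x) + B * norm (b x) + norm (c x)" and AB: "A \<ge> 0" "B \<ge> 0"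
  shows "energy v \<le> 3 powr p * (A powr p * energy a + B powr p * energy b + energy c)"
proof -
  note int = Lp_weightedD(2)[OF a] Lp_weightedD(2)[OF b] Lp_weightedD(2)[OF c]
  have "energy v \<le> (LINT x|\<mu>. 3 powr p * (A powr p * (norm (a x) powr p * w x)
      + B powr p * (norm (b x) powr p * w x) + norm (c x) powr p * w x))"
    unfolding energy_def
  proof (rule integral_mono_AE')
    show "AE x in \<mu>. norm (v x) powr p * w x \<le> 3 powr p * (A powr p * (norm (a x) powr p * w x)
      + B powr p * (norm (b x) powr p * w x) + norm (c x) powr p * w x)"
      using le w_pos
    proof eventually_elim
      case (elim x)
      have "norm (v x) powr p \<le> (A * norm (a x) + B * norm (b x) + norm (c x)) powr p"
        using elim p by (intro powr_mono2) auto
      also have "\<dots> \<le> 3 powr p * ((A * norm (a x)) powr p + (B * norm (b x)) powr p + norm (c x) powr p)"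
        using AB p by (intro powr_add3_le) auto
      finally have "norm (v x) powr p * w x
          \<le> (3 powr p * ((A * norm (a x)) powr p + (B * norm (b x)) powr p + norm (c x) powr p)) * w x"
        using elim by (intro mult_right_mono) auto
      then show ?case using AB by (simp add: powr_mult algebra_simps)
    qed
    show "AE x in \<mu>. 0 \<le> 3 powr p * (A powr p * (norm (a x) powr p * w x)
      + B powr p * (norm (b x) powr p * w x) + norm (c x) powr p * w x)"
      using w_pos by eventually_elim simp
  qed (intro integrable_mult_right Bochner_Integration.integrable_add int)
  also have "\<dots> = 3 powr p * (A powr p * energy a + B powr p * energy b + energy c)"
    using int by (simp add: energy_def)
  finally show ?thesis .
qed

text \<open>Hoelder's inequality for \<open>norm (v x) powr p * w x\<close> and
  \<open>w x powr (- \<sigma>)\<close>: with the powers \<open>\<sigma> / (\<sigma> + 1)\<close> and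
  \<open>1 / (\<sigma> + 1)\<close> the weights cancel, and \<open>r\<close> is the power of
  \<open>v\<close> that remains. For \<open>\<sigma> = s\<close> it is
  \<open>p_sub p s\<close>.\<close>

lemma integral_norm_powr_le_energy:
  assumes v: "v \<in> Lpw" and \<sigma>: "\<sigma> > 0" "integrable \<mu> (\<lambda>x. w x powr (- \<sigma>))"
  defines "r \<equiv> p * \<sigma> / (\<sigma> + 1)"
  shows "integrable \<mu> (\<lambda>x. norm (v x) powr r)"
    and "(LINT x|\<mu>. norm (v x) powr r)
      \<le> energy v powr (\<sigma> / (\<sigma> + 1)) * (LINT x|\<mu>. w x powr (- \<sigma>)) powr (1 / (\<sigma> + 1))"
proof -
  note [measurable] = Lp_weightedD(1)[OF v]
  have e: "0 < \<sigma> / (\<sigma> + 1)" "0 < 1 / (\<sigma> + 1)" "\<sigma> / (\<sigma> + 1) + 1 / (\<sigma> + 1) = 1"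
    using \<sigma>(1) by (auto simp: field_simps)
  have nn: "AE x in \<mu>. 0 \<le> norm (v x) powr p * w x" "AE x in \<mu>. 0 \<le> w x powr (- \<sigma>)"
    using w_pos by (auto elim: eventually_mono)
  note H = Hoelder_powr[OF e Lp_weightedD(2)[OF v] nn(1) \<sigma>(2) nn(2)]
  have eq: "AE x in \<mu>. (norm (v x) powr p * w x) powr (\<sigma> / (\<sigma> + 1)) * (w x powr (- \<sigma>)) powr (1 / (\<sigma> + 1)) = norm (v x) powr r"
    using w_pos
  proof eventually_elim
    case (elim x)
    have "(norm (v x) powr p * w x) powr (\<sigma> / (\<sigma> + 1)) = norm (v x) powr r * w x powr (\<sigma> / (\<sigma> + 1))"
      using elim by (simp add: powr_mult powr_powr r_def)
    moreover have "(w x powr (- \<sigma>)) powr (1 / (\<sigma> + 1)) = w x powr (- (\<sigma> / (\<sigma> + 1)))"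
      by (simp add: powr_powr)
    moreover have "w x powr (\<sigma> / (\<sigma> + 1)) * w x powr (- (\<sigma> / (\<sigma> + 1))) = 1"
      using elim by (simp flip: powr_add)
    ultimately show ?case by (simp add: mult.assoc)
  qed
  show "integrable \<mu> (\<lambda>x. norm (v x) powr r)"
    by (rule integrable_cong_AE_imp[OF H(1) _ eq]) measurable
  have "(LINT x|\<mu>. norm (v x) powr r)
     = (LINT x|\<mu>. (norm (v x) powr p * w x) powr (\<sigma> / (\<sigma> + 1)) * (w x powr (- \<sigma>)) powr (1 / (\<sigma> + 1)))"
    by (rule integral_cong_AE[symmetric, OF _ _ eq]) measurable
  then show "(LINT x|\<mu>. norm (v x) powr r)
      \<le> energy v powr (\<sigma> / (\<sigma> + 1)) * (LINT x|\<mu>. w x powr (- \<sigma>)) powr (1 / (\<sigma> + 1))"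
    using H(2) by (simp add: energy_def)
qed

text \<open>The value \<open>\<sigma> = 1 / (p - 1)\<close> is the one for which
  \<open>p * \<sigma> / (\<sigma> + 1)\<close> equals 1.\<close>

lemma Lp_weighted_integrable:
  assumes v: "v \<in> Lpw"
  shows "integrable \<mu> v"
    and "(LINT x|\<mu>. norm (v x))
      \<le> energy v powr (1 / p) * (LINT x|\<mu>. w x powr (- (1 / (p - 1)))) powr (1 - 1 / p)"
proof -
  have e: "p * (1 / (p - 1)) / (1 / (p - 1) + 1) = 1" "1 / (p - 1) / (1 / (p - 1) + 1) = 1 / p"
    "1 / (1 / (p - 1) + 1) = 1 - 1 / p"
    using p by (simp_all add: field_simps)
  have \<sigma>: "1 / (p - 1) > 0" "integrable \<mu> (\<lambda>x. w x powr (- (1 / (p - 1))))"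
    using p w_dual by simp_all
  note H = integral_norm_powr_le_energy[OF v \<sigma>, unfolded e]
  show "(LINT x|\<mu>. norm (v x))
      \<le> energy v powr (1 / p) * (LINT x|\<mu>. w x powr (- (1 / (p - 1)))) powr (1 - 1 / p)"
    using H(2) by simp
  show "integrable \<mu> v"
    using H(1) Lp_weightedD(1)[OF v] by (simp add: integrable_norm_iff)
qed

lemma bounded_in_Lp_weighted:
  assumes [measurable]: "v \<in> borel_measurable \<mu>" and "AE x in \<mu>. norm (v x) \<le> K"
  shows "v \<in> Lpw"
proof -
  have "integrable \<mu> (\<lambda>x. norm (v x) powr p * w x)"
  proof (rule Bochner_Integration.integrable_bound)
    show "integrable \<mu> (\<lambda>x. K powr p * w x)" by (intro integrable_mult_right w_int)
    show "AE x in \<mu>. norm (norm (v x) powr p * w x) \<le> norm (K powr p * w x)"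
      using assms(2) w_pos
    proof eventually_elim
      case (elim x)
      then have "norm (v x) powr p * w x \<le> K powr p * w x"
        using p by (intro mult_right_mono powr_mono2) auto
      moreover have "0 \<le> norm (v x) powr p * w x" using elim by simp
      ultimately show ?case unfolding real_norm_def by linarith
    qed
  qed measurable
  then show ?thesis by (simp add: Lp_weighted_def)
qed

lemma continuous_measurable:
  fixes v :: "'a \<Rightarrow> 'b::euclidean_space"
  assumes "continuous_on UNIV v"
  shows "v \<in> borel_measurable \<mu>"
  using assms sets_dom by (intro continuous_imp_measurable_on_sets_lebesgue) (auto intro: continuous_on_subset)

lemma continuous_bounded:
  fixes v :: "'a \<Rightarrow> 'b::euclidean_space"
  assumes "continuous_on UNIV v"
  obtains K where "K \<ge> 0" "\<And>x. x \<in> \<Omega> \<Longrightarrow> norm (v x) \<le> K"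
proof -
  have "compact (closure \<Omega>)" using bounded_dom by simp
  then have "bounded (v ` closure \<Omega>)"
    using assms by (intro compact_imp_bounded compact_continuous_image) (auto intro: continuous_on_subset)
  then obtain K where "\<forall>x\<in>closure \<Omega>. norm (v x) \<le> K" unfolding bounded_iff by blast
  then have "norm (v x) \<le> max 0 K" if "x \<in> \<Omega>" for x
    using that closure_subset[of \<Omega>] by (meson max.coboundedI2 subsetD)
  then show ?thesis using that[of "max 0 K"] by simp
qed

lemma continuous_in_Lp_weighted:
  fixes v :: "'a \<Rightarrow> 'b::euclidean_space"
  assumes "continuous_on UNIV v"
  shows "v \<in> Lpw"
proof -
  obtain K where "\<And>x. x \<in> \<Omega> \<Longrightarrow> norm (v x) \<le> K" using continuous_bounded[OF assms] by metis
  then show ?thesis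
    by (intro bounded_in_Lp_weighted[where K = K] continuous_measurable assms AE_I2) simp
qed

lemma Cc_inf_Lp_weighted:
  assumes "\<phi> \<in> Cc_inf \<Omega>"
  shows "\<phi> \<in> Lpw" "grad \<phi> \<in> Lpw"
  by (intro continuous_in_Lp_weighted C1_compact_continuous[OF Cc_inf_C1[OF assms]])+

lemma integral_dom_eq_lborel:
  fixes h :: "'a \<Rightarrow> 'b::euclidean_space"
  assumes "continuous_on UNIV h" "\<And>x. x \<notin> \<Omega> \<Longrightarrow> h x = 0"
  shows "(LINT x|\<mu>. h x) = (LINT x|lborel. h x)"
proof -
  have "(LINT x|\<mu>. h x) = (LINT x|lebesgue. indicator \<Omega> x *\<^sub>R h x)"
    using sets_dom by (intro integral_restrict_space) auto
  also have "(\<lambda>x. indicator \<Omega> x *\<^sub>R h x) = h" using assms(2) by (force simp: indicator_def)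
  also have "(LINT x|lebesgue. h x) = (LINT x|lborel. h x)"
    using borel_measurable_continuous_onI[OF assms(1)] by (intro integral_completion) simp
  finally show ?thesis .
qed

lemma integrable_norm_le:
  fixes v :: "'a \<Rightarrow> 'b::euclidean_space" and F :: "'a \<Rightarrow> 'c::euclidean_space"
  assumes v: "integrable \<mu> v" and "F \<in> borel_measurable \<mu>" and le: "\<And>x. x \<in> \<Omega> \<Longrightarrow> norm (F x) \<le> K * norm (v x)"
  shows "integrable \<mu> F"
proof (rule Bochner_Integration.integrable_bound)
  show "integrable \<mu> (\<lambda>x. K * norm (v x))" using v by simp
  show "AE x in \<mu>. norm (F x) \<le> norm (K * norm (v x))"
    using order_trans[OF le abs_ge_self] by (intro AE_I2) simp
qed fact

lemma integrable_bounded_scaleR: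
  fixes v :: "'a \<Rightarrow> real" and \<theta> :: "'a \<Rightarrow> 'b::euclidean_space"
  assumes v: "integrable \<mu> v" and \<theta>: "continuous_on UNIV \<theta>"
  shows "integrable \<mu> (\<lambda>x. v x *\<^sub>R \<theta> x)"
proof -
  obtain K where K: "\<And>x. x \<in> \<Omega> \<Longrightarrow> norm (\<theta> x) \<le> K" using continuous_bounded[OF \<theta>] by metis
  note [measurable] = borel_measurable_integrable[OF v] continuous_measurable[OF \<theta>]
  show ?thesis
    by (rule integrable_norm_le[OF v, of _ K]) (measurable, use K in \<open>simp add: mult.commute[of K] mult_left_mono\<close>)
qed

lemma integrable_scaleR_bounded:
  fixes v :: "'a \<Rightarrow> 'b::euclidean_space" and \<theta> :: "'a \<Rightarrow> real"
  assumes v: "integrable \<mu> v" and \<theta>: "continuous_on UNIV \<theta>"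
  shows "integrable \<mu> (\<lambda>x. \<theta> x *\<^sub>R v x)"
proof -
  obtain K where K: "\<And>x. x \<in> \<Omega> \<Longrightarrow> norm (\<theta> x) \<le> K" using continuous_bounded[OF \<theta>] by metis
  note [measurable] = borel_measurable_integrable[OF v] continuous_measurable[OF \<theta>]
  show ?thesis
    by (rule integrable_norm_le[OF v, of _ K]) (measurable, use K in \<open>simp add: mult_right_mono\<close>)
qed

text \<open>Integration by parts: the gradient of the product of two test functions has integral
  0.\<close>

lemma Cc_inf_weak_gradient:
  assumes \<phi>: "\<phi> \<in> Cc_inf \<Omega>"
  shows "has_weak_gradient \<Omega> \<phi> (grad \<phi>)"
  unfolding has_weak_gradient_def
proof (intro conjI ballI)
  note C\<phi> = Cc_inf_C1[OF \<phi>]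
  show "locally_integrable \<Omega> \<phi>" "locally_integrable \<Omega> (grad \<phi>)"
    by (intro integrable_imp_locally_integrable sets_dom Lp_weighted_integrable Cc_inf_Lp_weighted \<phi>)+
  fix \<psi> assume \<psi>: "\<psi> \<in> Cc_inf \<Omega>"
  note C\<psi> = Cc_inf_C1[OF \<psi>]
  note cont = C1_compact_continuous[OF C\<phi>] C1_compact_continuous[OF C\<psi>]
  obtain K where K: "K \<subseteq> \<Omega>" "\<And>x. x \<notin> K \<Longrightarrow> \<psi> x = 0" "\<And>x. x \<notin> K \<Longrightarrow> grad \<psi> x = 0"
    using Cc_inf_support[OF \<psi>] by metis
  have i: "integrable \<mu> (\<lambda>x. \<phi> x *\<^sub>R grad \<psi> x)" "integrable \<mu> (\<lambda>x. \<psi> x *\<^sub>R grad \<phi> x)"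
    by (intro integrable_scaleR_bounded Lp_weighted_integrable Cc_inf_Lp_weighted \<phi> \<psi> cont)+
  have "(LINT x|\<mu>. \<phi> x *\<^sub>R grad \<psi> x + \<psi> x *\<^sub>R grad \<phi> x) = (LINT x|lborel. \<phi> x *\<^sub>R grad \<psi> x + \<psi> x *\<^sub>R grad \<phi> x)"
  proof (rule integral_dom_eq_lborel)
    show "\<phi> x *\<^sub>R grad \<psi> x + \<psi> x *\<^sub>R grad \<phi> x = 0" if "x \<notin> \<Omega>" for x
    proof -
      have "x \<notin> K" using that K(1) by blast
      then show ?thesis using K(2,3)[of x] by simp
    qed
  qed (intro continuous_intros cont)
  also have "\<dots> = 0" by (rule integral_gradient_eq_0[OF C1_compact_mult[OF C\<phi> C\<psi>]])
  finally have "(LINT x|\<mu>. \<phi> x *\<^sub>R grad \<psi> x) + (LINT x|\<mu>. \<psi> x *\<^sub>R grad \<phi> x) = 0"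
    using i by simp
  then show "(LINT x|\<mu>. \<phi> x *\<^sub>R grad \<psi> x) = - (LINT x|\<mu>. \<psi> x *\<^sub>R grad \<phi> x)"
    by (rule eq_neg_iff_add_eq_0[THEN iffD2])
qed

lemma weak_gradient_diff:
  assumes u: "has_weak_gradient \<Omega> u g" and v: "has_weak_gradient \<Omega> v h"
  shows "has_weak_gradient \<Omega> (\<lambda>x. u x - v x) (\<lambda>x. g x - h x)"
  unfolding has_weak_gradient_def
proof (intro conjI ballI)
  have loc: "locally_integrable \<Omega> u" "locally_integrable \<Omega> g" "locally_integrable \<Omega> v" "locally_integrable \<Omega> h"
    using assms by (auto simp: has_weak_gradient_def)
  show "locally_integrable \<Omega> (\<lambda>x. u x - v x)" "locally_integrable \<Omega> (\<lambda>x. g x - h x)"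
    by (intro locally_integrable_diff loc)+
  fix \<phi> assume \<phi>: "\<phi> \<in> Cc_inf \<Omega>"
  obtain K where K: "compact K" "K \<subseteq> \<Omega>" "\<And>x. x \<notin> K \<Longrightarrow> \<phi> x = 0" "\<And>x. x \<notin> K \<Longrightarrow> grad \<phi> x = 0"
    using Cc_inf_support[OF \<phi>] by metis
  note cont = C1_compact_continuous[OF Cc_inf_C1[OF \<phi>]]
  note int1 = integrable_test_mult[OF open_dom _ cont(1) K(1,2,3)]
  have int2: "integrable \<mu> (\<lambda>x. z x *\<^sub>R grad \<phi> x)" if "locally_integrable \<Omega> z" for z :: "'a \<Rightarrow> real"
  proof -
    have iK: "integrable \<mu> (\<lambda>x. indicator K x *\<^sub>R z x)"
      using that K(1,2) sets_dom
      by (subst integrable_lebesgue_on_indicator_iff) (auto simp: locally_integrable_def lmeasurable_compact fmeasurableD)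
    have "integrable \<mu> (\<lambda>x. (indicator K x *\<^sub>R z x) *\<^sub>R grad \<phi> x)"
      by (rule integrable_bounded_scaleR[OF iK cont(2)])
    moreover have "(\<lambda>x. (indicator K x *\<^sub>R z x) *\<^sub>R grad \<phi> x) = (\<lambda>x. z x *\<^sub>R grad \<phi> x)"
      using K(4) by (force simp: indicator_def)
    ultimately show ?thesis by metis
  qed
  show "(LINT x|\<mu>. (u x - v x) *\<^sub>R grad \<phi> x) = - (LINT x|\<mu>. \<phi> x *\<^sub>R (g x - h x))"
    using u v \<phi> int1[OF loc(2)] int1[OF loc(4)] int2[OF loc(1)] int2[OF loc(3)]
    by (simp add: has_weak_gradient_def scaleR_diff_left scaleR_diff_right)
qed

text \<open>By the embedding into integrable functions, convergence in energy carries over to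
  integrals against bounded factors. This passes to the limit in the identity that defines weak
  gradients.\<close>

lemma tendsto_integral_energy:
  fixes F :: "nat \<Rightarrow> 'a \<Rightarrow> 'b::euclidean_space" and G :: "'a \<Rightarrow> 'b" and f :: "nat \<Rightarrow> 'a \<Rightarrow> 'c::euclidean_space"
  assumes F: "\<And>k. integrable \<mu> (F k)" "integrable \<mu> G"
    and f: "\<And>k. f k \<in> Lpw" "(\<lambda>k. energy (f k)) \<longlonglongrightarrow> 0"
    and le: "\<And>k x. x \<in> \<Omega> \<Longrightarrow> norm (F k x - G x) \<le> K * norm (f k x)" and K: "K \<ge> 0"
  shows "(\<lambda>k. LINT x|\<mu>. F k x) \<longlonglongrightarrow> (LINT x|\<mu>. G x)"
proof (rule Lim_null[THEN iffD2], rule Lim_null_comparison)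
  define D where "D = (LINT x|\<mu>. w x powr (- (1 / (p - 1)))) powr (1 - 1 / p)"
  have "norm ((LINT x|\<mu>. F k x) - (LINT x|\<mu>. G x)) \<le> K * (energy (f k) powr (1 / p) * D)" for k
  proof -
    have "norm ((LINT x|\<mu>. F k x) - (LINT x|\<mu>. G x)) = norm (LINT x|\<mu>. F k x - G x)"
      using F by simp
    also have "\<dots> \<le> (LINT x|\<mu>. K * norm (f k x))"
      using F le integrable_norm[OF Lp_weighted_integrable(1)[OF f(1)[of k]]]
      by (intro Bochner_Integration.integral_norm_bound_integral) auto
    also have "\<dots> = K * (LINT x|\<mu>. norm (f k x))" by simp
    also have "\<dots> \<le> K * (energy (f k) powr (1 / p) * D)"
      unfolding D_def by (intro mult_left_mono Lp_weighted_integrable(2) f K)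
    finally show ?thesis .
  qed
  then show "\<forall>\<^sub>F k in sequentially. norm ((LINT x|\<mu>. F k x) - (LINT x|\<mu>. G x))
      \<le> K * (energy (f k) powr (1 / p) * D)" by simp
  have "(\<lambda>k. K * (energy (f k) powr (1 / p) * D)) \<longlonglongrightarrow> K * (0 powr (1 / p) * D)"
    using p energy_nonneg by (intro tendsto_intros tendsto_powr' f) auto
  then show "(\<lambda>k. K * (energy (f k) powr (1 / p) * D)) \<longlonglongrightarrow> 0" using p by simp
qed

section \<open>Approximation by test functions and closedness of the space\<close>

lemma energy_cong_AE:
  assumes "u \<in> borel_measurable \<mu>" "AE x in \<mu>. u x = v x"
  shows "energy u = energy v"
proof -
  note [measurable] = assms(1) borel_measurable_lebesgue_on_AE[OF sets_dom assms]
  show ?thesis unfolding energy_def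
    by (rule integral_cong_AE) (use assms(2) in \<open>measurable, auto elim: eventually_mono\<close>)
qed

lemma Lp_weighted_cong_AE:
  assumes "u \<in> Lpw" "AE x in \<mu>. u x = v x"
  shows "v \<in> Lpw"
  using assms(2) borel_measurable_lebesgue_on_AE[OF sets_dom Lp_weightedD(1)[OF assms(1)] assms(2)]
  by (intro Lp_weightedI[OF _ assms(1) assms(1), of _ 1]) (auto elim: eventually_mono)

lemma W1p_D:
  assumes "v \<in> W1p \<Omega> w p"
  shows "has_weak_gradient \<Omega> v (wgrad \<Omega> v)" "v \<in> Lpw" "wgrad \<Omega> v \<in> Lpw"
  using assms someI_ex[of "has_weak_gradient \<Omega> v"]
  by (auto simp: W1p_def weakly_differentiable_def wgrad_def)

lemma W1pI:
  assumes "has_weak_gradient \<Omega> v h" "v \<in> Lpw" "h \<in> Lpw"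
  shows "v \<in> W1p \<Omega> w p"
proof -
  have "AE x in \<mu>. h x = wgrad \<Omega> v x"
    using wgrad_AE_eq[OF open_dom assms(1)] by (auto elim: eventually_mono)
  then have "wgrad \<Omega> v \<in> Lpw" by (rule Lp_weighted_cong_AE[OF assms(3)])
  then show ?thesis using assms by (auto simp: W1p_def weakly_differentiable_def)
qed

lemma W1p_norm_eq:
  assumes v: "has_weak_gradient \<Omega> v h" "h \<in> Lpw"
  shows "W1p_norm \<Omega> w p v = energy v powr (1 / p) + energy h powr (1 / p)"
proof -
  have "AE x in \<mu>. h x = wgrad \<Omega> v x"
    using wgrad_AE_eq[OF open_dom v(1)] by (auto elim: eventually_mono)
  then have "energy h = energy (wgrad \<Omega> v)" by (rule energy_cong_AE[OF Lp_weightedD(1)[OF v(2)]])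
  then show ?thesis by (simp add: W1p_norm_def energy_def)
qed

text \<open>Convergence in energy is convergence in mean of
  \<open>norm (\<phi> k x - v x) powr p * w x\<close>, so a subsequence converges a.e., and
  positivity of \<open>w\<close> removes the weight. Pointwise convergence is what Fatou's lemma and
  dominated convergence use later.\<close>

lemma W01p_approx:
  assumes v: "v \<in> W0"
  obtains \<phi> where "\<And>k. \<phi> k \<in> Cc_inf \<Omega>" "(\<lambda>k. energy (\<lambda>x. \<phi> k x - v x)) \<longlonglongrightarrow> 0"
    "(\<lambda>k. energy (\<lambda>x. grad (\<phi> k) x - wgrad \<Omega> v x)) \<longlonglongrightarrow> 0" "AE x in \<mu>. (\<lambda>k. \<phi> k x) \<longlonglongrightarrow> v x"
proof -
  have vW: "v \<in> W1p \<Omega> w p" using v by (simp add: W01p_def)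
  note vD = W1p_D[OF vW]
  have "\<exists>\<phi>. \<phi> \<in> Cc_inf \<Omega> \<and> W1p_norm \<Omega> w p (\<lambda>x. v x - \<phi> x) < inverse (real (Suc k))" for k
  proof -
    have "inverse (real (Suc k)) > 0" by simp
    then show ?thesis using v unfolding W01p_def by blast
  qed
  then obtain \<phi> where \<phi>: "\<And>k. \<phi> k \<in> Cc_inf \<Omega>" "\<And>k. W1p_norm \<Omega> w p (\<lambda>x. v x - \<phi> k x) < inverse (real (Suc k))"
    by metis
  note LP = Cc_inf_Lp_weighted[OF \<phi>(1)]
  have sym: "energy (\<lambda>x. a x - b x) = energy (\<lambda>x. b x - a x)" for a b :: "'a \<Rightarrow> 'c::euclidean_space"
    by (simp add: energy_def norm_minus_commute)
  have W: "energy (\<lambda>x. \<phi> k x - v x) powr (1 / p) + energy (\<lambda>x. grad (\<phi> k) x - wgrad \<Omega> v x) powr (1 / p) < inverse (real (Suc k))" for k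
    using \<phi>(2)[of k] W1p_norm_eq[OF weak_gradient_diff[OF vD(1) Cc_inf_weak_gradient[OF \<phi>(1)]] Lp_weighted_diff[OF vD(3) LP(2)], of k]
    by (simp add: sym[of "\<phi> k" v] sym[of "grad (\<phi> k)"])
  have lim: "E \<longlonglongrightarrow> 0" if E: "\<And>k. E k \<ge> 0" "\<And>k. E k powr (1 / p) \<le> inverse (real (Suc k))" for E :: "nat \<Rightarrow> real"
  proof (rule Lim_null_comparison)
    have "norm (E k) \<le> inverse (real (Suc k)) powr p" for k
    proof -
      have "E k = (E k powr (1 / p)) powr p" using E(1) p by (simp add: powr_powr)
      also have "\<dots> \<le> inverse (real (Suc k)) powr p" using E(2) p by (intro powr_mono2) auto
      finally show ?thesis using E(1)[of k] by simp
    qed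
    then show "\<forall>\<^sub>F k in sequentially. norm (E k) \<le> inverse (real (Suc k)) powr p" by simp
    have "(\<lambda>k. inverse (real (Suc k)) powr p) \<longlonglongrightarrow> 0 powr p"
      using p by (intro tendsto_powr' LIMSEQ_inverse_real_of_nat tendsto_const) auto
    then show "(\<lambda>k. inverse (real (Suc k)) powr p) \<longlonglongrightarrow> 0" using p by simp
  qed
  have e1: "(\<lambda>k. energy (\<lambda>x. \<phi> k x - v x)) \<longlonglongrightarrow> 0"
  proof (rule lim[OF energy_nonneg])
    show "energy (\<lambda>x. \<phi> k x - v x) powr (1 / p) \<le> inverse (real (Suc k))" for k
      using W[of k] powr_ge_zero[of "energy (\<lambda>x. grad (\<phi> k) x - wgrad \<Omega> v x)" "1 / p"] by linarith
  qed
  have e2: "(\<lambda>k. energy (\<lambda>x. grad (\<phi> k) x - wgrad \<Omega> v x)) \<longlonglongrightarrow> 0"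
  proof (rule lim[OF energy_nonneg])
    show "energy (\<lambda>x. grad (\<phi> k) x - wgrad \<Omega> v x) powr (1 / p) \<le> inverse (real (Suc k))" for k
      using W[of k] powr_ge_zero[of "energy (\<lambda>x. \<phi> k x - v x)" "1 / p"] by linarith
  qed
  have diff: "(\<lambda>x. \<phi> k x - v x) \<in> Lpw" for k by (intro Lp_weighted_diff LP vD)
  define U where "U k x = norm (\<phi> k x - v x) powr p * w x" for k x
  have "(LINT x|\<mu>. norm (U k x)) = energy (\<lambda>x. \<phi> k x - v x)" for k
  proof -
    have "AE x in \<mu>. norm (U k x) = norm (\<phi> k x - v x) powr p * w x"
      using w_pos by eventually_elim (simp add: U_def)
    moreover have [measurable]: "U k \<in> borel_measurable \<mu>"
      unfolding U_def[abs_def] by (rule borel_measurable_integrable[OF Lp_weightedD(2)[OF diff]])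
    ultimately show ?thesis
      unfolding energy_def using borel_measurable_integrable[OF Lp_weightedD(2)[OF diff]]
      by (intro integral_cong_AE) auto
  qed
  then have "(\<lambda>k. LINT x|\<mu>. norm (U k x)) \<longlonglongrightarrow> 0" using e1 by simp
  moreover have "integrable \<mu> (U k)" for k
    unfolding U_def[abs_def] by (rule Lp_weightedD(2)[OF diff])
  ultimately obtain r :: "nat \<Rightarrow> nat" where r: "strict_mono r" "AE x in \<mu>. (\<lambda>k. U (r k) x) \<longlonglongrightarrow> 0"
    using tendsto_L1_AE_subseq[of "\<mu>" U] by blast
  have "AE x in \<mu>. (\<lambda>k. \<phi> (r k) x) \<longlonglongrightarrow> v x"
    using r(2) w_pos
  proof eventually_elim
    case (elim x)
    have "(\<lambda>k. (U (r k) x / w x) powr (1 / p)) \<longlonglongrightarrow> (0 / w x) powr (1 / p)"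
      using elim p by (intro tendsto_powr' tendsto_intros) (auto simp: U_def)
    moreover have "(U (r k) x / w x) powr (1 / p) = \<bar>\<phi> (r k) x - v x\<bar>" for k
      using elim p by (simp add: U_def powr_powr)
    ultimately have "(\<lambda>k. \<bar>\<phi> (r k) x - v x\<bar>) \<longlonglongrightarrow> 0" using p by simp
    then show ?case by (simp add: LIM_zero_iff tendsto_rabs_zero_iff)
  qed
  then show ?thesis
    using that[of "\<lambda>k. \<phi> (r k)"] \<phi>(1) LIMSEQ_subseq_LIMSEQ[OF e1 r(1)] LIMSEQ_subseq_LIMSEQ[OF e2 r(1)]
    by (simp add: o_def)
qed

text \<open>Passing to the limit in the integration by parts of the test functions makes
  \<open>h\<close> a weak gradient of \<open>v\<close>; the gradient of \<open>v\<close> is thus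
  identified together with the membership.\<close>

lemma W01p_closed:
  assumes \<phi>: "\<And>k. \<phi> k \<in> Cc_inf \<Omega>" and v: "v \<in> Lpw" and h: "h \<in> Lpw"
    and e1: "(\<lambda>k. energy (\<lambda>x. \<phi> k x - v x)) \<longlonglongrightarrow> 0" and e2: "(\<lambda>k. energy (\<lambda>x. grad (\<phi> k) x - h x)) \<longlonglongrightarrow> 0"
  shows "v \<in> W0" "AE x in \<mu>. wgrad \<Omega> v x = h x"
proof -
  note LP = Cc_inf_Lp_weighted[OF \<phi>]
  have G: "has_weak_gradient \<Omega> v h"
    unfolding has_weak_gradient_def
  proof (intro conjI ballI)
    show "locally_integrable \<Omega> v" "locally_integrable \<Omega> h"
      by (intro integrable_imp_locally_integrable sets_dom Lp_weighted_integrable v h)+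
    fix \<psi> assume \<psi>: "\<psi> \<in> Cc_inf \<Omega>"
    note cont = C1_compact_continuous[OF Cc_inf_C1[OF \<psi>]]
    obtain K where K: "K \<ge> 0" "\<And>x. x \<in> \<Omega> \<Longrightarrow> norm (grad \<psi> x) \<le> K" using continuous_bounded[OF cont(2)] by metis
    obtain L where L: "L \<ge> 0" "\<And>x. x \<in> \<Omega> \<Longrightarrow> norm (\<psi> x) \<le> L" using continuous_bounded[OF cont(1)] by metis
    have "(\<lambda>k. LINT x|\<mu>. \<phi> k x *\<^sub>R grad \<psi> x) \<longlonglongrightarrow> (LINT x|\<mu>. v x *\<^sub>R grad \<psi> x)"
    proof (rule tendsto_integral_energy[OF _ _ _ e1 _ K(1)])
      show "integrable \<mu> (\<lambda>x. \<phi> k x *\<^sub>R grad \<psi> x)" for k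
        by (intro integrable_bounded_scaleR Lp_weighted_integrable LP cont)
      show "integrable \<mu> (\<lambda>x. v x *\<^sub>R grad \<psi> x)"
        by (intro integrable_bounded_scaleR Lp_weighted_integrable v cont)
      show "(\<lambda>x. \<phi> k x - v x) \<in> Lpw" for k by (intro Lp_weighted_diff LP v)
      show "norm (\<phi> k x *\<^sub>R grad \<psi> x - v x *\<^sub>R grad \<psi> x) \<le> K * norm (\<phi> k x - v x)" if "x \<in> \<Omega>" for k x
        using K(2)[OF that] by (simp add: mult_right_mono mult.commute flip: scaleR_diff_left)
    qed
    moreover have "(\<lambda>k. LINT x|\<mu>. \<psi> x *\<^sub>R grad (\<phi> k) x) \<longlonglongrightarrow> (LINT x|\<mu>. \<psi> x *\<^sub>R h x)"
    proof (rule tendsto_integral_energy[OF _ _ _ e2 _ L(1)])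
      show "integrable \<mu> (\<lambda>x. \<psi> x *\<^sub>R grad (\<phi> k) x)" for k
        by (intro integrable_scaleR_bounded Lp_weighted_integrable LP cont)
      show "integrable \<mu> (\<lambda>x. \<psi> x *\<^sub>R h x)"
        by (intro integrable_scaleR_bounded Lp_weighted_integrable h cont)
      show "(\<lambda>x. grad (\<phi> k) x - h x) \<in> Lpw" for k by (intro Lp_weighted_diff LP h)
      show "norm (\<psi> x *\<^sub>R grad (\<phi> k) x - \<psi> x *\<^sub>R h x) \<le> L * norm (grad (\<phi> k) x - h x)" if "x \<in> \<Omega>" for k x
        using L(2)[OF that] by (simp add: mult_right_mono flip: scaleR_diff_right)
    qed
    moreover have "(LINT x|\<mu>. \<phi> k x *\<^sub>R grad \<psi> x) = - (LINT x|\<mu>. \<psi> x *\<^sub>R grad (\<phi> k) x)" for k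
      using Cc_inf_weak_gradient[OF \<phi>[of k]] \<psi> by (simp add: has_weak_gradient_def)
    ultimately have "(\<lambda>k. - (LINT x|\<mu>. \<psi> x *\<^sub>R grad (\<phi> k) x)) \<longlonglongrightarrow> (LINT x|\<mu>. v x *\<^sub>R grad \<psi> x)"
      "(\<lambda>k. - (LINT x|\<mu>. \<psi> x *\<^sub>R grad (\<phi> k) x)) \<longlonglongrightarrow> - (LINT x|\<mu>. \<psi> x *\<^sub>R h x)"
      by (auto intro: tendsto_minus)
    then show "(LINT x|\<mu>. v x *\<^sub>R grad \<psi> x) = - (LINT x|\<mu>. \<psi> x *\<^sub>R h x)"
      by (rule LIMSEQ_unique)
  qed
  show "AE x in \<mu>. wgrad \<Omega> v x = h x" by (rule wgrad_AE_eq[OF open_dom G])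
  have sym: "energy (\<lambda>x. a x - b x) = energy (\<lambda>x. b x - a x)" for a b :: "'a \<Rightarrow> 'c::euclidean_space"
    by (simp add: energy_def norm_minus_commute)
  have N: "W1p_norm \<Omega> w p (\<lambda>x. v x - \<phi> k x) = energy (\<lambda>x. \<phi> k x - v x) powr (1 / p) + energy (\<lambda>x. grad (\<phi> k) x - h x) powr (1 / p)" for k
    using W1p_norm_eq[OF weak_gradient_diff[OF G Cc_inf_weak_gradient[OF \<phi>]] Lp_weighted_diff[OF h LP(2)], of k]
    by (simp add: sym[of "\<phi> k" v] sym[of "grad (\<phi> k)"])
  have "(\<lambda>k. W1p_norm \<Omega> w p (\<lambda>x. v x - \<phi> k x)) \<longlonglongrightarrow> 0 powr (1 / p) + 0 powr (1 / p)"
    unfolding N using p energy_nonneg by (intro tendsto_add tendsto_powr' e1 e2 tendsto_const) auto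
  then have lim: "(\<lambda>k. W1p_norm \<Omega> w p (\<lambda>x. v x - \<phi> k x)) \<longlonglongrightarrow> 0" using p by simp
  have "\<exists>\<psi>\<in>Cc_inf \<Omega>. W1p_norm \<Omega> w p (\<lambda>x. v x - \<psi> x) < e" if "e > 0" for e
  proof -
    have "\<forall>\<^sub>F k in sequentially. W1p_norm \<Omega> w p (\<lambda>x. v x - \<phi> k x) < e" by (rule order_tendstoD(2)[OF lim that])
    then obtain k where "W1p_norm \<Omega> w p (\<lambda>x. v x - \<phi> k x) < e" by (auto simp: eventually_sequentially)
    then show ?thesis using \<phi> by blast
  qed
  then show "v \<in> W0" using W1pI[OF G v h] by (simp add: W01p_def)
qed

end

section \<open>The chain rule in the weighted space\<close>

context weighted_domain
begin

lemma Lp_weighted_le: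
  assumes "v \<in> borel_measurable \<mu>" "h \<in> Lpw"
    and le: "\<And>x. norm (v x) \<le> c * norm (h x)" and c: "c \<ge> 0"
  shows "v \<in> Lpw"
proof (rule Lp_weightedI[OF assms(1,2,2) _ c])
  have "norm (v x) \<le> c * (norm (h x) + norm (h x))" for x
    using le[of x] mult_nonneg_nonneg[OF c norm_ge_zero[of "h x"]] unfolding distrib_left by linarith
  then show "AE x in \<mu>. norm (v x) \<le> c * (norm (h x) + norm (h x))" by simp
qed

text \<open>The test functions approximating \<open>v\<close> are composed with polynomials whose derivatives
  approximate \<open>g\<close>; polynomials suffice because each test function is bounded.\<close>

theorem W01p_chain:
  fixes G g :: "real \<Rightarrow> real"
  assumes v: "v \<in> W0" and G: "\<And>t. (G has_real_derivative g t) (at t)" "G 0 = 0"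
    and g: "continuous_on UNIV g" "\<And>t. \<bar>g t\<bar> \<le> K"
  shows "(\<lambda>x. G (v x)) \<in> W0"
    and "AE x in \<mu>. wgrad \<Omega> (\<lambda>x. G (v x)) x = g (v x) *\<^sub>R wgrad \<Omega> v x"
proof -
  define h where "h = wgrad \<Omega> v"
  have K: "K \<ge> 0" using g(2)[of 0] by linarith
  have vW: "v \<in> W1p \<Omega> w p" using v by (simp add: W01p_def)
  note vL = W1p_D(2)[OF vW] and hL = W1p_D(3)[OF vW, folded h_def]
  have GL: "\<bar>G s - G t\<bar> \<le> K * \<bar>s - t\<bar>" for s t
    using field_differentiable_bound[of UNIV G g K s t] G(1) g(2) by simp
  obtain \<phi> where \<phi>: "\<And>k. \<phi> k \<in> Cc_inf \<Omega>" "(\<lambda>k. energy (\<lambda>x. \<phi> k x - v x)) \<longlonglongrightarrow> 0"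
    "(\<lambda>k. energy (\<lambda>x. grad (\<phi> k) x - h x)) \<longlonglongrightarrow> 0" "AE x in \<mu>. (\<lambda>k. \<phi> k x) \<longlonglongrightarrow> v x"
    by (rule W01p_approx[OF v, folded h_def]) (rule that; assumption)
  define \<epsilon> where "\<epsilon> k = inverse (real (Suc k))" for k
  have \<epsilon>: "\<epsilon> k > 0" "\<epsilon> k \<le> 1" for k by (auto simp: \<epsilon>_def inverse_le_1_iff)
  have \<epsilon>lim: "\<epsilon> \<longlonglongrightarrow> 0" unfolding \<epsilon>_def[abs_def] by (rule LIMSEQ_inverse_real_of_nat)
  \<comment> \<open>Here \<open>\<psi>\<close> stands for \<open>Q (\<phi> k x)\<close> and
    \<open>q\<close> for \<open>Q' (\<phi> k x)\<close>. The error of \<open>\<psi>\<close> is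
    relative to \<open>\<bar>\<phi> k x\<bar>\<close>, so it is controlled by the energy of
    \<open>v\<close>.\<close>
  define approx where "approx k \<psi> q \<longleftrightarrow> \<psi> \<in> Cc_inf \<Omega> \<and> grad \<psi> = (\<lambda>x. q x *\<^sub>R grad (\<phi> k) x) \<and>
      (\<forall>x. \<bar>\<psi> x - G (\<phi> k x)\<bar> \<le> \<epsilon> k * \<bar>\<phi> k x\<bar>) \<and> (\<forall>x. \<bar>q x - g (\<phi> k x)\<bar> \<le> \<epsilon> k)" for k \<psi> and q :: "'a \<Rightarrow> real"
  have "\<exists>\<psi> q. approx k \<psi> q" for k
  proof -
    note C = Cc_inf_C1[OF \<phi>(1)[of k]]
    obtain a where a: "\<And>x. norm x \<ge> a \<Longrightarrow> \<phi> k x = 0" using C1_compact_support[OF C] by metis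
    have "bounded (\<phi> k ` cball 0 a)"
      using C1_compact_continuous(1)[OF C] by (intro compact_imp_bounded compact_continuous_image) (auto intro: continuous_on_subset)
    then obtain R where "\<forall>x\<in>cball 0 a. norm (\<phi> k x) \<le> R" unfolding bounded_iff by blast
    then have R: "\<bar>\<phi> k x\<bar> \<le> max 0 R" for x
    proof (cases "norm x \<ge> a")
      case False
      then have "norm (\<phi> k x) \<le> R" using \<open>\<forall>x\<in>cball 0 a. norm (\<phi> k x) \<le> R\<close> by simp
      then show ?thesis by simp
    qed (use a[of x] in simp)
    define I where "I = {- max 0 R..max 0 R}"
    have I: "\<phi> k x \<in> I" "0 \<in> I" "convex I" for x
      using R[of x] unfolding I_def by (auto simp: abs_le_iff)
    have "compact I" "continuous_on I g" unfolding I_def using g(1) by (auto intro: continuous_on_subset)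
    then obtain f where "real_polynomial_function f" and f: "\<And>t. t \<in> I \<Longrightarrow> \<bar>g t - f t\<bar> < \<epsilon> k"
      using Stone_Weierstrass_real_polynomial_function[OF _ _ \<epsilon>(1)] by metis
    then obtain b m where fb: "f = (\<lambda>t. \<Sum>i\<le>m. b i * t ^ i)"
      using real_polynomial_function_imp_sum by blast
    \<comment> \<open>Dividing by \<open>1 + real i\<close> integrates the polynomial
      \<open>f\<close> term by term, which gives an antiderivative vanishing at 0.\<close>
    define c where "c i = b i / (1 + real i)" for i
    have cb: "c i * (1 + real i) = b i" for i by (simp add: c_def)
    define Q where "Q t = (\<Sum>i\<le>m. c i * t ^ Suc i)" for t
    have QD: "(Q has_real_derivative f t) (at t)" for t
    proof -
      have "((\<lambda>t. c i * t ^ Suc i) has_real_derivative c i * (1 + real i) * t ^ i) (at t)" for i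
        using DERIV_cmult[OF DERIV_pow[of "Suc i" t UNIV], of "c i"] by (simp add: algebra_simps)
      then have "((\<lambda>t. \<Sum>i\<le>m. c i * t ^ Suc i) has_real_derivative (\<Sum>i\<le>m. c i * (1 + real i) * t ^ i)) (at t)"
        by (intro DERIV_sum)
      then show ?thesis by (simp only: Q_def[abs_def] fb cb)
    qed
    have QG: "\<bar>Q t - G t\<bar> \<le> \<epsilon> k * \<bar>t\<bar>" if "t \<in> I" for t
    proof -
      \<comment> \<open>The mean value inequality: the derivatives differ by at most
        \<open>\<epsilon> k\<close> on \<open>I\<close>, and both functions vanish at 0, so the
        error is proportional to \<open>\<bar>t\<bar>\<close>.\<close>
      have "norm ((Q t - G t) - (Q 0 - G 0)) \<le> \<epsilon> k * norm (t - 0)"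
      proof (rule field_differentiable_bound[OF I(3)])
        show "((\<lambda>t. Q t - G t) has_real_derivative f z - g z) (at z within I)" for z
          by (intro DERIV_diff has_field_derivative_at_within[OF QD] has_field_derivative_at_within[OF G(1)])
        show "norm (f z - g z) \<le> \<epsilon> k" if "z \<in> I" for z
          using f[OF that] by (simp add: abs_minus_commute less_imp_le)
      qed (use that I in auto)
      moreover have "Q 0 = 0" by (simp add: Q_def)
      ultimately show ?thesis using G(2) by simp
    qed
    note P = Cc_inf_polynomial[OF \<phi>(1)[of k], of c m]
    have "(\<lambda>x. Q (\<phi> k x)) \<in> Cc_inf \<Omega>" using P(1) by (simp only: Q_def)
    moreover have "grad (\<lambda>x. Q (\<phi> k x)) = (\<lambda>x. f (\<phi> k x) *\<^sub>R grad (\<phi> k) x)"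
      using P(2) by (simp only: Q_def fb cb)
    moreover have "\<forall>x. \<bar>Q (\<phi> k x) - G (\<phi> k x)\<bar> \<le> \<epsilon> k * \<bar>\<phi> k x\<bar>" using QG I(1) by blast
    moreover have "\<forall>x. \<bar>f (\<phi> k x) - g (\<phi> k x)\<bar> \<le> \<epsilon> k"
      using f[OF I(1)] by (simp add: abs_minus_commute less_imp_le)
    ultimately show ?thesis
      unfolding approx_def by (intro exI[of _ "\<lambda>x. Q (\<phi> k x)"] exI[of _ "\<lambda>x. f (\<phi> k x)"] conjI)
  qed
  then obtain \<psi> q where ap: "\<And>k. approx k (\<psi> k) (q k)" by metis
  have \<psi>: "\<And>k. \<psi> k \<in> Cc_inf \<Omega>" and gr: "\<And>k. grad (\<psi> k) = (\<lambda>x. q k x *\<^sub>R grad (\<phi> k) x)"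
    and \<psi>G: "\<And>k x. \<bar>\<psi> k x - G (\<phi> k x)\<bar> \<le> \<epsilon> k * \<bar>\<phi> k x\<bar>" and qg: "\<And>k x. \<bar>q k x - g (\<phi> k x)\<bar> \<le> \<epsilon> k"
    using ap unfolding approx_def by blast+
  note L\<phi> = Cc_inf_Lp_weighted[OF \<phi>(1)] and L\<psi> = Cc_inf_Lp_weighted[OF \<psi>]
  have [measurable]: "v \<in> borel_measurable \<mu>" "h \<in> borel_measurable \<mu>"
    using Lp_weightedD(1)[OF vL] Lp_weightedD(1)[OF hL] .
  have [measurable]: "g \<in> borel_measurable borel" by (rule borel_measurable_continuous_onI[OF g(1)])
  have contG: "continuous_on UNIV G"
    by (intro continuous_at_imp_continuous_on ballI DERIV_isCont[OF G(1)])
  have [measurable]: "G \<in> borel_measurable borel" by (rule borel_measurable_continuous_onI[OF contG])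
  have [measurable]: "\<phi> k \<in> borel_measurable \<mu>" for k
    by (rule Lp_weightedD(1)[OF L\<phi>(1)])
  have GvL: "(\<lambda>x. G (v x)) \<in> Lpw"
    by (rule Lp_weighted_le[OF _ vL, of _ K]) (use GL[of _ 0] G(2) K in auto)
  have ghL: "(\<lambda>x. g (v x) *\<^sub>R h x) \<in> Lpw"
    by (rule Lp_weighted_le[OF _ hL, of _ K]) (use g(2) K in \<open>auto intro!: mult_right_mono\<close>)
  have zL: "(\<lambda>x. 0 :: 'b::euclidean_space) \<in> Lpw"
    by (rule continuous_in_Lp_weighted) simp
  have z0: "energy (\<lambda>x. 0 :: 'b::euclidean_space) = 0" using p by (simp add: energy_def)
  \<comment> \<open>\<open>K + 1\<close> collects the Lipschitz constant \<open>K\<close> of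
    \<open>G\<close> and the approximation error \<open>\<epsilon> k \<le> 1\<close>.\<close>
  let ?B = "\<lambda>k. 3 powr p * (\<epsilon> k powr p * energy v + (K + 1) powr p * energy (\<lambda>x. \<phi> k x - v x))"
  have e1: "(\<lambda>k. energy (\<lambda>x. \<psi> k x - G (v x))) \<longlonglongrightarrow> 0"
  proof (rule Lim_null_comparison)
    have "energy (\<lambda>x. \<psi> k x - G (v x)) \<le> 3 powr p * (\<epsilon> k powr p * energy v + (K + 1) powr p * energy (\<lambda>x. \<phi> k x - v x) + energy (\<lambda>x. 0 :: real))" for k
    proof (rule energy_le3[OF _ vL Lp_weighted_diff[OF L\<phi>(1) vL] zL])
      show "(\<lambda>x. \<psi> k x - G (v x)) \<in> borel_measurable \<mu>"
        using Lp_weightedD(1)[OF L\<psi>(1)[of k]] by measurable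
      have "norm (\<psi> k x - G (v x)) \<le> \<epsilon> k * norm (v x) + (K + 1) * norm (\<phi> k x - v x) + norm (0::real)" for x
      proof -
        have "\<epsilon> k * \<bar>\<phi> k x\<bar> \<le> \<epsilon> k * (\<bar>v x\<bar> + \<bar>\<phi> k x - v x\<bar>)"
          using \<epsilon>(1)[of k] by (intro mult_left_mono) auto
        moreover have "\<epsilon> k * \<bar>\<phi> k x - v x\<bar> \<le> 1 * \<bar>\<phi> k x - v x\<bar>"
          using \<epsilon>(2)[of k] by (intro mult_right_mono) auto
        ultimately show ?thesis
          using \<psi>G[of k x] GL[of "\<phi> k x" "v x"] abs_triangle_ineq4[of "\<psi> k x - G (\<phi> k x)" "G (v x) - G (\<phi> k x)"]
          unfolding real_norm_def distrib_left distrib_right by (simp add: abs_minus_commute)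
      qed
      then show "AE x in \<mu>. norm (\<psi> k x - G (v x)) \<le> \<epsilon> k * norm (v x) + (K + 1) * norm (\<phi> k x - v x) + norm (0::real)"
        by simp
    qed (use \<epsilon>(1)[of k] K in auto)
    then show "\<forall>\<^sub>F k in sequentially. norm (energy (\<lambda>x. \<psi> k x - G (v x)))
       \<le> ?B k"
      by (simp add: z0)
    have "?B \<longlonglongrightarrow>
        3 powr p * (0 powr p * energy v + (K + 1) powr p * 0)"
      using p \<epsilon>(1) by (intro tendsto_intros tendsto_powr' \<epsilon>lim \<phi>(2)) (auto simp: less_imp_le)
    then show "?B \<longlonglongrightarrow> 0"
      using p by simp
  qed
  \<comment> \<open>The error of replacing \<open>g (\<phi> k x)\<close> by \<open>g (v x)\<close>.
    Convergence in energy does not control it, since \<open>g\<close> is merely continuous; it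
    multiplies the fixed function \<open>h\<close>, so a.e. convergence and dominated convergence
    do.\<close>
  define d where "d k x = \<bar>g (\<phi> k x) - g (v x)\<bar> *\<^sub>R h x" for k x
  have dK: "\<bar>g s - g t\<bar> \<le> 2 * K" for s t using g(2)[of s] g(2)[of t] by linarith
  have dL: "d k \<in> Lpw" for k
    unfolding d_def[abs_def]
    by (rule Lp_weighted_le[OF _ hL, of _ "2 * K"]) (use dK K in \<open>auto intro!: mult_right_mono\<close>)
  have e3: "(\<lambda>k. energy (d k)) \<longlonglongrightarrow> 0"
  proof -
    have "(\<lambda>k. LINT x|\<mu>. norm (d k x) powr p * w x) \<longlonglongrightarrow> (LINT x|\<mu>. 0)"
    proof (rule integral_dominated_convergence)
      show "integrable \<mu> (\<lambda>x. (2 * K) powr p * (norm (h x) powr p * w x))"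
        by (intro integrable_mult_right Lp_weightedD(2)[OF hL])
      show "(\<lambda>x. norm (d k x) powr p * w x) \<in> borel_measurable \<mu>" for k
        by (rule borel_measurable_integrable[OF Lp_weightedD(2)[OF dL]])
      show "AE x in \<mu>. (\<lambda>k. norm (d k x) powr p * w x) \<longlonglongrightarrow> 0"
        using \<phi>(4)
      proof eventually_elim
        case (elim x)
        have "(\<lambda>k. g (\<phi> k x)) \<longlonglongrightarrow> g (v x)"
          using continuous_on_tendsto_compose[OF g(1) elim] by simp
        then have "(\<lambda>k. norm (d k x) powr p * w x) \<longlonglongrightarrow> (\<bar>\<bar>g (v x) - g (v x)\<bar>\<bar> * norm (h x)) powr p * w x"
          unfolding d_def norm_scaleR using p by (intro tendsto_intros tendsto_powr') auto
        then show ?case using p by simp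
      qed
      show "AE x in \<mu>. norm (norm (d k x) powr p * w x) \<le> (2 * K) powr p * (norm (h x) powr p * w x)" for k
        using w_pos
      proof eventually_elim
        case (elim x)
        have "norm (d k x) powr p \<le> (2 * K * norm (h x)) powr p"
          unfolding d_def norm_scaleR using p dK by (intro powr_mono2 mult_right_mono) auto
        also have "\<dots> = (2 * K) powr p * norm (h x) powr p" by (rule powr_mult)
        finally have "norm (d k x) powr p * w x \<le> ((2 * K) powr p * norm (h x) powr p) * w x"
          using elim by (intro mult_right_mono) auto
        moreover have "0 \<le> norm (d k x) powr p * w x" using elim by simp
        ultimately show ?case unfolding real_norm_def by (simp add: mult.assoc)
      qed
    qed simp
    then show ?thesis by (simp add: energy_def)
  qed
  let ?D = "\<lambda>k. 3 powr p * (\<epsilon> k powr p * energy h + (K + 1) powr p * energy (\<lambda>x. grad (\<phi> k) x - h x) + energy (d k))"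
  have e2: "(\<lambda>k. energy (\<lambda>x. grad (\<psi> k) x - g (v x) *\<^sub>R h x)) \<longlonglongrightarrow> 0"
  proof (rule Lim_null_comparison)
    have "energy (\<lambda>x. grad (\<psi> k) x - g (v x) *\<^sub>R h x)
        \<le> ?D k" for k
    proof (rule energy_le3[OF _ hL Lp_weighted_diff[OF L\<phi>(2) hL] dL])
      show "(\<lambda>x. grad (\<psi> k) x - g (v x) *\<^sub>R h x) \<in> borel_measurable \<mu>"
        using Lp_weightedD(1)[OF L\<psi>(2)[of k]] by measurable
      have "norm (grad (\<psi> k) x - g (v x) *\<^sub>R h x) \<le> \<epsilon> k * norm (h x) + (K + 1) * norm (grad (\<phi> k) x - h x) + norm (d k x)" for x
      proof -
        let ?e = "grad (\<phi> k) x - h x"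
        \<comment> \<open>Three sources of error: the polynomial, the gradient of the test function,
          and its value inside \<open>g\<close>.\<close>
        have "grad (\<psi> k) x - g (v x) *\<^sub>R h x = (q k x - g (\<phi> k x)) *\<^sub>R h x + (q k x *\<^sub>R ?e + (g (\<phi> k x) - g (v x)) *\<^sub>R h x)"
          by (simp add: gr algebra_simps)
        then have "norm (grad (\<psi> k) x - g (v x) *\<^sub>R h x)
           \<le> norm ((q k x - g (\<phi> k x)) *\<^sub>R h x) + (norm (q k x *\<^sub>R ?e) + norm ((g (\<phi> k x) - g (v x)) *\<^sub>R h x))"
          by (simp only:) (intro order_trans[OF norm_triangle_ineq] add_left_mono norm_triangle_ineq)
        moreover have "norm ((q k x - g (\<phi> k x)) *\<^sub>R h x) \<le> \<epsilon> k * norm (h x)"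
          using qg[of k x] by (simp add: mult_right_mono)
        moreover have "norm (q k x *\<^sub>R ?e) \<le> (K + 1) * norm ?e"
        proof -
          have "\<bar>q k x\<bar> \<le> K + 1" using qg[of k x] \<epsilon>(2)[of k] g(2)[of "\<phi> k x"] by linarith
          then show ?thesis by (simp add: mult_right_mono)
        qed
        moreover have "norm ((g (\<phi> k x) - g (v x)) *\<^sub>R h x) = norm (d k x)" by (simp add: d_def)
        ultimately show ?thesis by linarith
      qed
      then show "AE x in \<mu>. norm (grad (\<psi> k) x - g (v x) *\<^sub>R h x)
          \<le> \<epsilon> k * norm (h x) + (K + 1) * norm (grad (\<phi> k) x - h x) + norm (d k x)" by simp
    qed (use \<epsilon>(1)[of k] K in auto)
    then show "\<forall>\<^sub>F k in sequentially. norm (energy (\<lambda>x. grad (\<psi> k) x - g (v x) *\<^sub>R h x))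
        \<le> ?D k"
      by simp
    have "?D \<longlonglongrightarrow>
        3 powr p * (0 powr p * energy h + (K + 1) powr p * 0 + 0)"
      using p \<epsilon>(1) by (intro tendsto_intros tendsto_powr' \<epsilon>lim \<phi>(3) e3) (auto simp: less_imp_le)
    then show "?D \<longlonglongrightarrow> 0"
      using p by simp
  qed
  show "(\<lambda>x. G (v x)) \<in> W0" "AE x in \<mu>. wgrad \<Omega> (\<lambda>x. G (v x)) x = g (v x) *\<^sub>R wgrad \<Omega> v x"
    using W01p_closed[OF \<psi> GvL ghL e1 e2] by (simp_all add: h_def)
qed

section \<open>Embeddings of the weighted space\<close>

lemma energy_grad_approx_le:
  assumes v: "v \<in> W0" and \<phi>: "\<phi> \<in> Cc_inf \<Omega>"
  shows "energy (grad \<phi>) \<le> 3 powr p * (energy (wgrad \<Omega> v) + energy (\<lambda>x. grad \<phi> x - wgrad \<Omega> v x))"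
proof -
  have hL: "wgrad \<Omega> v \<in> Lpw" using v by (auto simp: W01p_def intro: W1p_D)
  note gL = Cc_inf_Lp_weighted(2)[OF \<phi>]
  have zL: "(\<lambda>x. 0 :: real) \<in> Lpw"
    by (rule continuous_in_Lp_weighted) simp
  have "norm (grad \<phi> x) \<le> 1 * norm (wgrad \<Omega> v x) + 1 * norm (grad \<phi> x - wgrad \<Omega> v x) + norm (0 :: real)" for x
    using norm_triangle_sub[of "grad \<phi> x" "wgrad \<Omega> v x"] by simp
  then have "energy (grad \<phi>) \<le> 3 powr p * (1 powr p * energy (wgrad \<Omega> v) + 1 powr p * energy (\<lambda>x. grad \<phi> x - wgrad \<Omega> v x) + energy (\<lambda>x. 0 :: real))"
    by (intro energy_le3[OF Lp_weightedD(1)[OF gL] hL Lp_weighted_diff[OF gL hL] zL]) auto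
  then show ?thesis using p by (simp add: energy_def)
qed

lemma integral_grad_powr_le:
  assumes \<phi>: "\<phi> \<in> Cc_inf \<Omega>" and \<sigma>: "\<sigma> > 0" "integrable \<mu> (\<lambda>x. w x powr (- \<sigma>))"
  defines "r \<equiv> p * \<sigma> / (\<sigma> + 1)"
  shows "(LINT x|lborel. norm (grad \<phi> x) powr r) powr (1 / r)
     \<le> energy (grad \<phi>) powr (1 / p) * (LINT x|\<mu>. w x powr (- \<sigma>)) powr (1 / (p * \<sigma>))"
proof -
  have r: "r > 0" using p \<sigma> by (simp add: r_def)
  obtain K where K: "K \<subseteq> \<Omega>" "\<And>x. x \<notin> K \<Longrightarrow> grad \<phi> x = 0" using Cc_inf_support[OF \<phi>] by metis
  define S where "S = (LINT x|\<mu>. w x powr (- \<sigma>))"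
  have "(LINT x|lborel. norm (grad \<phi> x) powr r) = (LINT x|\<mu>. norm (grad \<phi> x) powr r)"
    using K r C1_compact_continuous(2)[OF Cc_inf_C1[OF \<phi>]]
    by (intro integral_dom_eq_lborel[symmetric] continuous_on_powr' continuous_intros) auto
  also have "\<dots> \<le> energy (grad \<phi>) powr (\<sigma> / (\<sigma> + 1)) * S powr (1 / (\<sigma> + 1))"
    unfolding r_def S_def by (rule integral_norm_powr_le_energy(2)[OF Cc_inf_Lp_weighted(2)[OF \<phi>] \<sigma>])
  finally have "(LINT x|lborel. norm (grad \<phi> x) powr r) powr (1 / r)
      \<le> (energy (grad \<phi>) powr (\<sigma> / (\<sigma> + 1)) * S powr (1 / (\<sigma> + 1))) powr (1 / r)"
    using r by (intro powr_mono2) auto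
  also have "\<dots> = energy (grad \<phi>) powr (\<sigma> / (\<sigma> + 1) * (1 / r)) * S powr (1 / (\<sigma> + 1) * (1 / r))"
    by (simp only: powr_mult powr_powr)
  also have "\<sigma> / (\<sigma> + 1) * (1 / r) = 1 / p"
    using \<sigma>(1) p by (simp add: r_def)
  also have "1 / (\<sigma> + 1) * (1 / r) = 1 / (p * \<sigma>)"
    using \<sigma>(1) p by (simp add: r_def)
  finally show ?thesis by (simp only: S_def)
qed

text \<open>Isolating the embedding as a property of \<open>q\<close> lets the estimates for the
  solutions be proved once, both for the exponent \<open>ps_star\<close> and for an arbitrary
  \<open>q > p\<close> in the borderline case.\<close>

definition sobolev_bound :: "real \<Rightarrow> real \<Rightarrow> bool" where
  "sobolev_bound q C \<longleftrightarrow> C \<ge> 0 \<and> (\<forall>v\<in>W0. integrable \<mu> (\<lambda>x. \<bar>v x\<bar> powr q) \<and>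
     (LINT x|\<mu>. \<bar>v x\<bar> powr q) powr (1 / q) \<le> C * energy (wgrad \<Omega> v) powr (1 / p))"

text \<open>The inequality is proved for test functions and reaches their closure by Fatou's lemma.
  The factor 3 in the constant is the price of \<open>powr_add3_le\<close>, paid when the energies
  of the approximating gradients are compared with that of the limit.\<close>

theorem W01p_sobolev:
  assumes \<sigma>: "\<sigma> > 0" "integrable \<mu> (\<lambda>x. w x powr (- \<sigma>))" and dim: "DIM('a) \<ge> 2"
  defines "r \<equiv> p * \<sigma> / (\<sigma> + 1)" and "n \<equiv> real DIM('a)"
  assumes r: "1 \<le> r" "r < n"
  defines "q \<equiv> n * r / (n - r)"
  obtains C where "sobolev_bound q C"
proof -
  have n: "n \<ge> 2" using dim by (simp add: n_def)
  have q: "q > 0" using r n by (simp add: q_def)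
  define S where "S = (LINT x|\<mu>. w x powr (- \<sigma>)) powr (1 / (p * \<sigma>))"
  define c where "c = r * (n - 1) / (n - r)"
  have c: "c \<ge> 0" using r n by (simp add: c_def)
  have S: "S \<ge> 0" by (simp add: S_def)
  have *: "integrable \<mu> (\<lambda>x. \<bar>v x\<bar> powr q) \<and>
     (LINT x|\<mu>. \<bar>v x\<bar> powr q) powr (1 / q) \<le> (c * S * 3) * energy (wgrad \<Omega> v) powr (1 / p)"
    if v: "v \<in> W0" for v
  proof -
    define h where "h = wgrad \<Omega> v"
    obtain \<phi> where \<phi>: "\<And>k. \<phi> k \<in> Cc_inf \<Omega>"
      "(\<lambda>k. energy (\<lambda>x. grad (\<phi> k) x - h x)) \<longlonglongrightarrow> 0" "AE x in \<mu>. (\<lambda>k. \<phi> k x) \<longlonglongrightarrow> v x"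
      by (rule W01p_approx[OF v, folded h_def]) (rule that; assumption)
    define B where "B k = (c * S * (3 powr p * (energy h + energy (\<lambda>x. grad (\<phi> k) x - h x))) powr (1 / p)) powr q" for k
    have I: "integrable \<mu> (\<lambda>x. \<bar>\<phi> k x\<bar> powr q)" "(LINT x|\<mu>. \<bar>\<phi> k x\<bar> powr q) \<le> B k" for k
    proof -
      note C = Cc_inf_C1[OF \<phi>(1)[of k]]
      have cont: "continuous_on UNIV (\<lambda>x. \<bar>\<phi> k x\<bar> powr q)"
        using q C1_compact_continuous(1)[OF C] by (intro continuous_on_powr' continuous_intros) auto
      then show "integrable \<mu> (\<lambda>x. \<bar>\<phi> k x\<bar> powr q)"
        by (intro Lp_weighted_integrable continuous_in_Lp_weighted)
      obtain K where K: "K \<subseteq> \<Omega>" "\<And>x. x \<notin> K \<Longrightarrow> \<phi> k x = 0" using Cc_inf_support[OF \<phi>(1)] by metis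
      define Q where "Q = (LINT x|lborel. \<bar>\<phi> k x\<bar> powr q)"
      have "(LINT x|\<mu>. \<bar>\<phi> k x\<bar> powr q) = Q"
        unfolding Q_def using K q by (intro integral_dom_eq_lborel cont) auto
      also have "Q = (Q powr (1 / q)) powr q" using q by (simp add: powr_powr Q_def)
      also have "\<dots> \<le> (c * (LINT x|lborel. norm (grad (\<phi> k) x) powr r) powr (1 / r)) powr q"
        using gagliardo_nirenberg_sobolev[OF C dim r[unfolded n_def]] q
        by (intro powr_mono2) (simp_all add: Q_def c_def q_def n_def)
      also have "\<dots> \<le> (c * (energy (grad (\<phi> k)) powr (1 / p) * S)) powr q"
        using integral_grad_powr_le[OF \<phi>(1)[of k] \<sigma>] q c
        by (intro powr_mono2 mult_left_mono) (auto simp: r_def S_def)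
      also have "\<dots> \<le> (c * ((3 powr p * (energy h + energy (\<lambda>x. grad (\<phi> k) x - h x))) powr (1 / p) * S)) powr q"
        using energy_grad_approx_le[OF v \<phi>(1)[of k]] q c p S
        by (intro powr_mono2 mult_left_mono mult_right_mono mult_nonneg_nonneg) (auto simp: h_def)
      also have "\<dots> = B k" by (simp add: B_def mult_ac)
      finally show "(LINT x|\<mu>. \<bar>\<phi> k x\<bar> powr q) \<le> B k" .
    qed
    have Blim: "B \<longlonglongrightarrow> (c * S * (3 powr p * (energy h + 0)) powr (1 / p)) powr q"
      unfolding B_def[abs_def] using p q c S
      by (intro tendsto_powr' tendsto_intros \<phi>(2)) (auto intro!: mult_nonneg_nonneg add_nonneg_nonneg)
    have vm: "v \<in> borel_measurable \<mu>"
      using v by (auto simp: W01p_def intro: Lp_weightedD W1p_D)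
    have lim: "AE x in \<mu>. (\<lambda>k. \<bar>\<phi> k x\<bar> powr q) \<longlonglongrightarrow> \<bar>v x\<bar> powr q"
      using \<phi>(3) by eventually_elim (use q in \<open>intro tendsto_powr' tendsto_intros, auto\<close>)
    have M: "integrable \<mu> (\<lambda>x. \<bar>v x\<bar> powr q)"
      "(LINT x|\<mu>. \<bar>v x\<bar> powr q) \<le> (c * S * (3 powr p * (energy h + 0)) powr (1 / p)) powr q"
      by (rule integral_le_of_tendsto[OF I(1) _ _ lim I(2) Blim]; use vm in simp)+
    have "(LINT x|\<mu>. \<bar>v x\<bar> powr q) powr (1 / q) \<le> ((c * S * (3 powr p * (energy h + 0)) powr (1 / p)) powr q) powr (1 / q)"
      using M(2) q by (intro powr_mono2) auto
    also have "\<dots> = c * S * (3 powr p * energy h) powr (1 / p)"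
      using q c S by (simp add: powr_powr)
    also have "\<dots> = (c * S * 3) * energy h powr (1 / p)"
      using p by (simp add: powr_mult powr_powr)
    finally show ?thesis using M(1) by (simp add: h_def)
  qed
  show ?thesis by (rule that[of "c * S * 3"]) (use * c S in \<open>auto simp: sobolev_bound_def\<close>)
qed

text \<open>The bound from \<open>C1_compact_bounded\<close> depends only on the measure of
  \<open>\<Omega>\<close> and on gradient norms. Along an approximating sequence these norms stay
  bounded, so one \<open>d\<close> works for all members and survives the a.e. limit.\<close>

theorem W01p_bounded_above:
  assumes \<sigma>: "\<sigma> > 0" "integrable \<mu> (\<lambda>x. w x powr (- \<sigma>))" and dim: "DIM('a) \<ge> 2"
    and r: "p * \<sigma> / (\<sigma> + 1) > real DIM('a)" and v: "v \<in> W0"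
  obtains d where "AE x in \<mu>. v x \<le> d"
proof -
  define r where "r = p * \<sigma> / (\<sigma> + 1)"
  define h where "h = wgrad \<Omega> v"
  obtain \<phi> where \<phi>: "\<And>k. \<phi> k \<in> Cc_inf \<Omega>"
    "(\<lambda>k. energy (\<lambda>x. grad (\<phi> k) x - h x)) \<longlonglongrightarrow> 0" "AE x in \<mu>. (\<lambda>k. \<phi> k x) \<longlonglongrightarrow> v x"
    by (rule W01p_approx[OF v, folded h_def]) (rule that; assumption)
  have "Bseq (\<lambda>k. energy (\<lambda>x. grad (\<phi> k) x - h x))"
    using \<phi>(2) by (intro convergent_imp_Bseq convergentI)
  then obtain E where E: "\<And>k. norm (energy (\<lambda>x. grad (\<phi> k) x - h x)) \<le> E" by (meson BseqE)
  define S where "S = (LINT x|\<mu>. w x powr (- \<sigma>)) powr (1 / (p * \<sigma>))"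
  define B where "B = (3 powr p * (energy h + E)) powr (1 / p) * S"
  have B: "B \<ge> 0" by (simp add: B_def S_def)
  obtain d where d: "\<And>\<phi> g. C1_compact \<phi> g \<Longrightarrow> measure lborel {x :: 'a. \<phi> x \<noteq> 0} \<le> measure lborel \<Omega> \<Longrightarrow>
       (LINT x|lborel. norm (g x) powr r) powr (1 / r) \<le> B \<Longrightarrow> AE x in lborel. \<phi> x \<le> d"
    using C1_compact_bounded[OF dim r B, of "measure lborel \<Omega>"] unfolding r_def by metis
  have "AE x in \<mu>. \<phi> k x \<le> d" for k
  proof -
    obtain K where K: "K \<subseteq> \<Omega>" "\<And>x. x \<notin> K \<Longrightarrow> \<phi> k x = 0" using Cc_inf_support[OF \<phi>(1)] by metis
    have "(LINT x|lborel. norm (grad (\<phi> k) x) powr r) powr (1 / r) \<le> energy (grad (\<phi> k)) powr (1 / p) * S"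
      unfolding r_def S_def by (rule integral_grad_powr_le[OF \<phi>(1) \<sigma>])
    also have "\<dots> \<le> B"
      unfolding B_def
    proof (intro mult_right_mono powr_mono2)
      have "energy (grad (\<phi> k)) \<le> 3 powr p * (energy h + energy (\<lambda>x. grad (\<phi> k) x - h x))"
        unfolding h_def by (rule energy_grad_approx_le[OF v \<phi>(1)])
      also have "\<dots> \<le> 3 powr p * (energy h + E)"
        using E[of k] by (intro mult_left_mono add_left_mono) auto
      finally show "energy (grad (\<phi> k)) \<le> 3 powr p * (energy h + E)" .
    qed (use p in \<open>auto simp: S_def\<close>)
    finally have "(LINT x|lborel. norm (grad (\<phi> k) x) powr r) powr (1 / r) \<le> B" .
    moreover have "measure lborel {x. \<phi> k x \<noteq> 0} \<le> measure lborel \<Omega>"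
    proof (rule measure_mono_fmeasurable)
      show "{x. \<phi> k x \<noteq> 0} \<subseteq> \<Omega>" using K by blast
      show "{x. \<phi> k x \<noteq> 0} \<in> sets lborel"
        using borel_measurable_continuous_onI[OF C1_compact_continuous(1)[OF Cc_inf_C1[OF \<phi>(1)[of k]]]] by simp
      show "\<Omega> \<in> fmeasurable lborel"
        using emeasure_bounded_finite[OF bounded_dom] open_dom by (intro fmeasurableI) auto
    qed
    ultimately have "AE x in lborel. \<phi> k x \<le> d" by (intro d[OF Cc_inf_C1[OF \<phi>(1)]])
    then have "AE x in lebesgue. \<phi> k x \<le> d" by (rule AE_completion)
    then show ?thesis using sets_dom by (auto simp: AE_restrict_space_iff elim: eventually_mono)
  qed
  then have "AE x in \<mu>. \<forall>k. \<phi> k x \<le> d" by (simp add: AE_all_countable)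
  with \<phi>(3) have "AE x in \<mu>. v x \<le> d"
    by eventually_elim (auto intro: LIMSEQ_le_const2)
  then show ?thesis by (rule that)
qed

end

section \<open>Estimates for the approximating solutions\<close>

lemma continuous_antiderivative:
  fixes g :: "real \<Rightarrow> real"
  assumes "continuous_on UNIV g"
  obtains G where "\<And>t. (G has_real_derivative g t) (at t)" "G 0 = 0"
proof -
  have "\<exists>F. \<forall>x :: real. -\<infinity> < ereal x \<longrightarrow> ereal x < \<infinity> \<longrightarrow> (F has_vector_derivative g x) (at x)"
    using assms by (intro einterval_antiderivative) (auto simp: continuous_on_eq_continuous_at)
  then obtain F where F: "\<And>x. (F has_real_derivative g x) (at x)"
    by (auto simp: has_real_derivative_iff_has_vector_derivative)
  have "((\<lambda>t. F t - F 0) has_real_derivative g t) (at t)" for t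
    using DERIV_diff[OF F DERIV_const[of "F 0"]] by simp
  then show ?thesis using that[of "\<lambda>t. F t - F 0"] by simp
qed

text \<open>The chain rule asks for a bounded derivative, hence the cut at \<open>M\<close>. On
  \<open>{0..M}\<close>, where the solution takes its values a.e., nothing is changed.\<close>

lemma truncated_power:
  fixes c M :: real
  assumes "c > 1" "M > 0" and g_def: "g = (\<lambda>t. c * min (max 0 t) M powr (c - 1))"
  obtains G where "\<And>t. (G has_real_derivative g t) (at t)" "G 0 = 0" "\<And>t. 0 \<le> t \<Longrightarrow> t \<le> M \<Longrightarrow> G t = t powr c"
proof -
  have "continuous_on UNIV g"
    unfolding g_def using assms by (intro continuous_intros continuous_on_powr') auto
  then obtain G where G: "\<And>t. (G has_real_derivative g t) (at t)" "G 0 = 0"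
    by (rule continuous_antiderivative) (rule that; assumption)
  have "G t = t powr c" if "0 \<le> t" "t \<le> M" for t
  proof -
    \<comment> \<open>On \<open>{0..M}\<close> the difference has derivative 0, hence a mean value
      inequality with constant 0.\<close>
    have "norm ((G t - max 0 t powr c) - (G 0 - max 0 0 powr c)) \<le> 0 * norm (t - 0)"
    proof (rule field_differentiable_bound[of "{0..M}"])
      show "((\<lambda>t. G t - max 0 t powr c) has_real_derivative g z - c * max 0 z powr (c - 1)) (at z within {0..M})" for z
        by (rule has_field_derivative_at_within[OF DERIV_diff[OF G(1) has_real_derivative_pos_part_powr[OF assms(1)]]])
      show "norm (g z - c * max 0 z powr (c - 1)) \<le> 0" if "z \<in> {0..M}" for z
        using that by (simp add: g_def min_def)
    qed (use that assms in auto)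
    then show ?thesis using G(2) that assms(1) by simp
  qed
  then show ?thesis by (rule that[OF G])
qed

text \<open>\<open>w x powr (- \<sigma>)\<close> is at most \<open>w x powr (- s)\<close> where
  \<open>w x \<le> 1\<close> and at most 1 elsewhere. This allows \<open>s\<close> to be lowered, to
  \<open>1 / (p - 1)\<close> for the locale and further choices for a prescribed Sobolev
  exponent.\<close>

lemma integrable_negative_power:
  fixes w :: "'a \<Rightarrow> real"
  assumes fin: "finite_measure M" and [measurable]: "w \<in> borel_measurable M" and pos: "AE x in M. w x > 0"
    and int: "integrable M (\<lambda>x. w x powr (- s))" and "0 < \<sigma>" "\<sigma> \<le> s"
  shows "integrable M (\<lambda>x. w x powr (- \<sigma>))"
proof (rule Bochner_Integration.integrable_bound)
  interpret finite_measure M by (rule fin)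
  show "integrable M (\<lambda>x. 1 + w x powr (- s))" using int by simp
  show "AE x in M. norm (w x powr (- \<sigma>)) \<le> norm (1 + w x powr (- s))"
    using pos
  proof eventually_elim
    case (elim x)
    have "w x powr (- \<sigma>) \<le> 1 + w x powr (- s)"
    proof (cases "w x \<le> 1")
      case True
      then have "w x powr (- \<sigma>) \<le> w x powr (- s)" using elim assms by (intro powr_mono') auto
      then show ?thesis by simp
    next
      case False
      then have "w x powr (- \<sigma>) \<le> w x powr 0" using assms by (intro powr_mono) auto
      then show ?thesis using False by (simp add: add_increasing2)
    qed
    then show ?case by simp
  qed
qed measurable

section \<open>Testing the equation\<close>

context weighted_domain
begin

lemma finite_measure_dom: "finite_measure \<mu>"
  using bounded_dom open_dom by (intro finite_measure_lebesgue_on bounded_set_imp_lmeasurable sets_dom)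

text \<open>Growth and degeneracy force \<open>A x \<zeta> \<bullet> \<zeta> = \<bar>\<zeta>\<bar>\<^sup>p w x\<close>.\<close>

lemma test_energy_le:
  assumes growth: "AE x in \<mu>. \<forall>\<zeta>. norm (A x \<zeta>) \<le> norm \<zeta> powr (p - 1) * w x"
    and degen: "AE x in \<mu>. \<forall>\<zeta>. A x \<zeta> \<bullet> \<zeta> \<ge> norm \<zeta> powr p * w x"
    and sol: "approx_solution \<Omega> w p A f n v"
    and G: "\<And>t. (G has_real_derivative g t) (at t)" "G 0 = 0" "continuous_on UNIV g" "\<And>t. \<bar>g t\<bar> \<le> K"
    and H: "\<And>t. (H has_real_derivative h t) (at t)" "H 0 = 0" "continuous_on UNIV h" "\<And>t. \<bar>h t\<bar> \<le> L"
    and hg: "\<And>t. \<bar>h t\<bar> powr p \<le> C * g t" "C \<ge> 0"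
    and F: "integrable \<mu> F" "AE x in \<mu>. 0 \<le> F x"
      "AE x in \<mu>. min (f x) (real n) / (v x + 1 / real n) * G (v x) \<le> F x"
  shows "(\<lambda>x. H (v x)) \<in> W0"
    and "energy (wgrad \<Omega> (\<lambda>x. H (v x))) \<le> C * (LINT x|\<mu>. F x)"
proof -
  have v: "v \<in> W0" using sol by (simp add: approx_solution_def)
  define D where "D = wgrad \<Omega> v"
  have vL: "v \<in> Lpw" and DL: "D \<in> Lpw"
    using v unfolding D_def W01p_def by (auto intro: W1p_D)
  note cG = W01p_chain[OF v G, folded D_def] and cH = W01p_chain[OF v H, folded D_def]
  show "(\<lambda>x. H (v x)) \<in> W0" by (rule cH(1))
  have [measurable]: "v \<in> borel_measurable \<mu>" "D \<in> borel_measurable \<mu>"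
    using Lp_weightedD(1)[OF vL] Lp_weightedD(1)[OF DL] .
  have [measurable]: "g \<in> borel_measurable borel" "h \<in> borel_measurable borel"
    using borel_measurable_continuous_onI[OF G(3)] borel_measurable_continuous_onI[OF H(3)] .
  have gm: "(\<lambda>x. g (v x) *\<^sub>R D x) \<in> borel_measurable \<mu>" by measurable
  have hm: "(\<lambda>x. h (v x) *\<^sub>R D x) \<in> borel_measurable \<mu>" by measurable
  have int: "integrable \<mu> (\<lambda>x. g (v x) * (norm (D x) powr p * w x))"
  proof (rule Bochner_Integration.integrable_bound)
    show "integrable \<mu> (\<lambda>x. K * (norm (D x) powr p * w x))"
      by (intro integrable_mult_right Lp_weightedD(2)[OF DL])
    show "AE x in \<mu>. norm (g (v x) * (norm (D x) powr p * w x)) \<le> norm (K * (norm (D x) powr p * w x))"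
    proof (intro AE_I2)
      fix x
      have "\<bar>g (v x)\<bar> \<le> \<bar>K\<bar>" using G(4)[of "v x"] by simp
      then show "norm (g (v x) * (norm (D x) powr p * w x)) \<le> norm (K * (norm (D x) powr p * w x))"
        unfolding real_norm_def abs_mult[of _ "norm (D x) powr p * w x"] by (rule mult_right_mono) simp
    qed
  qed measurable
  have "energy (wgrad \<Omega> (\<lambda>x. H (v x))) = energy (\<lambda>x. h (v x) *\<^sub>R D x)"
    by (rule energy_cong_AE[symmetric, OF hm]) (use cH(2) in \<open>auto elim: eventually_mono\<close>)
  also have "\<dots> \<le> (LINT x|\<mu>. C * (g (v x) * (norm (D x) powr p * w x)))"
    unfolding energy_def
  proof (rule integral_mono_AE')
    \<comment> \<open>By \<open>hg\<close>, the energy density of \<open>H (v x)\<close> is at most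
      \<open>C\<close> times the density that testing with \<open>G (v x)\<close> produces.\<close>
    show "AE x in \<mu>. norm (h (v x) *\<^sub>R D x) powr p * w x \<le> C * (g (v x) * (norm (D x) powr p * w x))"
      using w_pos
    proof eventually_elim
      case (elim x)
      have "\<bar>h (v x)\<bar> powr p * (norm (D x) powr p * w x) \<le> (C * g (v x)) * (norm (D x) powr p * w x)"
        using hg(1)[of "v x"] elim by (intro mult_right_mono) auto
      then show ?case by (simp add: powr_mult mult.assoc)
    qed
    show "AE x in \<mu>. 0 \<le> C * (g (v x) * (norm (D x) powr p * w x))"
      using w_pos
    proof eventually_elim
      case (elim x)
      have "0 \<le> C * g (v x)" using hg(1)[of "v x"] order_trans[OF powr_ge_zero] by blast
      moreover have "0 \<le> norm (D x) powr p * w x" using elim by simp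
      ultimately have "0 \<le> (C * g (v x)) * (norm (D x) powr p * w x)" by (rule mult_nonneg_nonneg)
      then show ?case by (simp add: mult.assoc)
    qed
  qed (intro integrable_mult_right int)
  also have "\<dots> = C * (LINT x|\<mu>. g (v x) * (norm (D x) powr p * w x))" by simp
  also have "(LINT x|\<mu>. g (v x) * (norm (D x) powr p * w x))
      = (LINT x|\<mu>. A x (D x) \<bullet> wgrad \<Omega> (\<lambda>x. G (v x)) x)"
  proof -
    have ae: "AE x in \<mu>. g (v x) * (norm (D x) powr p * w x) = A x (D x) \<bullet> wgrad \<Omega> (\<lambda>x. G (v x)) x"
      using growth degen cG(2)
    proof eventually_elim
      case (elim x)
      have "A x (D x) \<bullet> D x \<le> norm (A x (D x)) * norm (D x)" by (rule norm_cauchy_schwarz)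
      also have "\<dots> \<le> (norm (D x) powr (p - 1) * w x) * norm (D x)"
        using elim(1) by (intro mult_right_mono) auto
      also have "\<dots> = norm (D x) powr p * w x"
        using powr_mult_base[of "norm (D x)" "p - 1"] by (simp add: mult_ac)
      finally have "A x (D x) \<bullet> D x = norm (D x) powr p * w x" using elim(2) by (simp add: antisym)
      then show ?case using elim(3) by simp
    qed
    \<comment> \<open>Measurability of the integrand with \<open>A\<close> is inherited from the
      left side through a.e. equality.\<close>
    show ?thesis
      by (rule integral_cong_AE[OF borel_measurable_integrable[OF int]
            borel_measurable_lebesgue_on_AE[OF sets_dom borel_measurable_integrable[OF int] ae] ae])
  qed
  also have "\<dots> = (LINT x|\<mu>. min (f x) (real n) / (v x + 1 / real n) * G (v x))"
    using sol cG(1) by (simp add: approx_solution_def D_def)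
  also have "C * \<dots> \<le> C * (LINT x|\<mu>. F x)"
    by (intro mult_left_mono integral_mono_AE' F hg)
  finally show "energy (wgrad \<Omega> (\<lambda>x. H (v x))) \<le> C * (LINT x|\<mu>. F x)" .
qed

text \<open>The test function is \<open>v powr (p * (\<gamma> - 1) + 1)\<close>, truncated at an a.e. bound of \<open>v\<close>.\<close>

lemma approx_power_bound:
  assumes growth: "AE x in \<mu>. \<forall>\<zeta>. norm (A x \<zeta>) \<le> norm \<zeta> powr (p - 1) * w x"
    and degen: "AE x in \<mu>. \<forall>\<zeta>. A x \<zeta> \<bullet> \<zeta> \<ge> norm \<zeta> powr p * w x"
    and f: "f \<in> Lp \<Omega> m" "AE x in \<mu>. f x \<ge> 0"
    and q: "q > p" and m: "1 < m" "m < q / (q - p)"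
    and sob: "sobolev_bound q S"
  defines "m' \<equiv> hoelder_conj m"
  defines "\<gamma> \<equiv> p * m' / (p * m' - q)"
  obtains B where "\<And>n v. n \<ge> 1 \<Longrightarrow> approx_solution \<Omega> w p A f n v \<Longrightarrow>
    integrable \<mu> (\<lambda>x. \<bar>v x\<bar> powr (q * \<gamma>)) \<and> (LINT x|\<mu>. \<bar>v x\<bar> powr (q * \<gamma>)) \<le> B"
proof -
  have S: "S \<ge> 0" "\<And>v. v \<in> W0 \<Longrightarrow> integrable \<mu> (\<lambda>x. \<bar>v x\<bar> powr q)"
    "\<And>v. v \<in> W0 \<Longrightarrow> (LINT x|\<mu>. \<bar>v x\<bar> powr q) powr (1 / q) \<le> S * energy (wgrad \<Omega> v) powr (1 / p)"
    using sob by (auto simp: sobolev_bound_def)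
  have m': "m' > 1" "1 / m' = 1 - 1 / m" using m by (auto simp: m'_def hoelder_conj_def field_simps)
  have pq: "p > 0" "q > 0" using p q by auto
  have pm: "p * m' - q > 0"
  proof -
    have "m * (q - p) < q" using m q by (simp add: field_simps)
    then have "q * (m - 1) < p * m" by (simp add: algebra_simps)
    then show ?thesis using m by (simp add: m'_def hoelder_conj_def field_simps)
  qed
  have \<gamma>: "\<gamma> > 1" using pm pq by (simp add: \<gamma>_def field_simps)
  \<comment> \<open>With \<open>\<beta> - 1 = p * (\<gamma> - 1)\<close>, the \<open>p\<close>-th
    power of the derivative of \<open>s powr \<gamma>\<close> is a multiple of the derivative of
    \<open>s powr \<beta>\<close>.\<close>
  define \<beta> where "\<beta> = p * (\<gamma> - 1) + 1"
  have \<beta>: "\<beta> > 1" using \<gamma> pq by (simp add: \<beta>_def)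
  define t where "t = q * \<gamma>"
  have t: "t > 0" using pq \<gamma> by (simp add: t_def)
  \<comment> \<open>The equation that determines \<open>\<gamma>\<close>: the power
    \<open>\<beta> - 1\<close> left after dividing by \<open>v\<close> is what Hoelder's inequality
    with \<open>f\<close> turns into the integral of \<open>\<bar>v x\<bar> powr t\<close>, the one
    that the Sobolev inequality bounds.\<close>
  have tm: "t * (1 - 1 / m) = \<beta> - 1"
  proof -
    have "\<gamma> - 1 = q / (p * m' - q)" using pm by (simp add: \<gamma>_def field_simps)
    then have "\<beta> - 1 = p * q / (p * m' - q)" by (simp add: \<beta>_def)
    also have "\<dots> = t * (1 / m')" using m'(1) by (simp add: t_def \<gamma>_def)
    finally show ?thesis using m' by simp
  qed
  \<comment> \<open>The difference of the two powers of that integral; it is positive exactly when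
    \<open>m < q / (q - p)\<close>.\<close>
  define \<delta> where "\<delta> = p / q - (1 - 1 / m)"
  have \<delta>: "\<delta> > 0"
  proof -
    have "1 / m' < p / q" using pm pq m' by (simp add: field_simps)
    then show ?thesis using m' by (simp add: \<delta>_def)
  qed
  define Nf where "Nf = (LINT x|\<mu>. \<bar>f x\<bar> powr m) powr (1 / m)"
  have intf: "integrable \<mu> (\<lambda>x. \<bar>f x\<bar> powr m)"
    using f(1) by (simp add: Lp_def Lp_weighted_def)
  define Z where "Z = S powr p * (\<gamma> powr p / \<beta> * Nf)"
  have Z: "Z \<ge> 0" using \<beta> by (simp add: Z_def Nf_def)
  show ?thesis
  proof (rule that[of "Z powr (1 / \<delta>)"], fold t_def)
    fix n v assume n: "n \<ge> (1 :: nat)" and sol: "approx_solution \<Omega> w p A f n v"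
    have v0: "AE x in \<mu>. v x > 0" using sol by (simp add: approx_solution_def)
    obtain M0 where "AE x in \<mu>. \<bar>v x\<bar> \<le> M0" using sol by (auto simp: approx_solution_def Linf_def)
    \<comment> \<open>\<open>M\<close> depends on the solution. It enters only the truncations and
      the bounds on their derivatives, not the final bound.\<close>
    define M where "M = max 1 M0"
    have M: "M > 0" "AE x in \<mu>. v x \<le> M"
      using \<open>AE x in \<mu>. \<bar>v x\<bar> \<le> M0\<close> by (auto simp: M_def elim!: eventually_mono)
    define g where "g = (\<lambda>s. \<beta> * min (max 0 s) M powr (\<beta> - 1))"
    define h where "h = (\<lambda>s. \<gamma> * min (max 0 s) M powr (\<gamma> - 1))"
    obtain G where G: "\<And>s. (G has_real_derivative g s) (at s)" "G 0 = 0" "\<And>s. 0 \<le> s \<Longrightarrow> s \<le> M \<Longrightarrow> G s = s powr \<beta>"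
      by (rule truncated_power[OF \<beta> M(1) g_def]) (rule that; assumption)
    obtain H where H: "\<And>s. (H has_real_derivative h s) (at s)" "H 0 = 0" "\<And>s. 0 \<le> s \<Longrightarrow> s \<le> M \<Longrightarrow> H s = s powr \<gamma>"
      by (rule truncated_power[OF \<gamma> M(1) h_def]) (rule that; assumption)
    have cg: "continuous_on UNIV g" "continuous_on UNIV h"
      unfolding g_def h_def using \<beta> \<gamma> M
      by (intro continuous_intros continuous_on_powr'; simp)+
    have gK: "\<bar>g s\<bar> \<le> \<beta> * M powr (\<beta> - 1)" for s
      using \<beta> M by (auto simp: g_def abs_mult intro!: mult_left_mono powr_mono2)
    have hK: "\<bar>h s\<bar> \<le> \<gamma> * M powr (\<gamma> - 1)" for s
      using \<gamma> M by (auto simp: h_def abs_mult intro!: mult_left_mono powr_mono2)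
    have hg: "\<bar>h s\<bar> powr p \<le> \<gamma> powr p / \<beta> * g s" for s
      using \<beta> \<gamma> by (simp add: h_def g_def abs_mult powr_mult powr_powr \<beta>_def mult.commute)
    have Cn: "\<gamma> powr p / \<beta> \<ge> 0" using \<beta> by simp
    have vt: "AE x in \<mu>. \<bar>H (v x)\<bar> powr q = \<bar>v x\<bar> powr t"
      using v0 M(2) by eventually_elim (simp add: H(3) powr_powr t_def mult.commute)
    have vm: "v \<in> borel_measurable \<mu>"
      using sol by (auto simp: approx_solution_def Linf_def)
    have vW: "v \<in> W0" using sol by (simp add: approx_solution_def)
    note HW = W01p_chain(1)[OF vW H(1,2) cg(2) hK]
    have vtm: "(\<lambda>x. \<bar>v x\<bar> powr t) \<in> borel_measurable \<mu>" using vm by measurable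
    \<comment> \<open>\<open>H (v x)\<close> lies in the space, so the embedding yields a finite
      integral; the division by a power of \<open>I\<close> at the end relies on this.\<close>
    have intv: "integrable \<mu> (\<lambda>x. \<bar>v x\<bar> powr t)"
      by (rule integrable_cong_AE_imp[OF S(2)[OF HW] vtm vt])
    define I where "I = (LINT x|\<mu>. \<bar>v x\<bar> powr t)"
    have I0: "I \<ge> 0" by (simp add: I_def)
    define F where "F x = (\<bar>f x\<bar> powr m) powr (1 / m) * (\<bar>v x\<bar> powr t) powr (1 - 1 / m)" for x
    have F: "integrable \<mu> F" "(LINT x|\<mu>. F x) \<le> Nf * I powr (1 - 1 / m)"
      unfolding F_def[abs_def] Nf_def I_def using m by (intro Hoelder_powr intf intv; simp)+
    have Fle: "AE x in \<mu>. min (f x) (real n) / (v x + 1 / real n) * G (v x) \<le> F x"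
      using f(2) v0 M(2)
    proof eventually_elim
      case (elim x)
      \<comment> \<open>Dropping the minimum and the shift \<open>1 / real n\<close> removes the
        dependence on \<open>n\<close>; the division by \<open>v x\<close> lowers the power from
        \<open>\<beta>\<close> to \<open>\<beta> - 1\<close>.\<close>
      have "min (f x) (real n) / (v x + 1 / real n) * G (v x) \<le> f x / v x * G (v x)"
        using elim n by (intro mult_right_mono frac_le) (auto simp: G(3))
      also have "\<dots> = f x * v x powr (\<beta> - 1)"
        using elim by (simp add: G(3) powr_diff)
      also have "\<dots> = F x"
        using elim m by (simp add: F_def powr_powr tm[unfolded mult.commute[of t]] tm)
      finally show ?case .
    qed
    have F0: "AE x in \<mu>. 0 \<le> F x" by (simp add: F_def)
    have E: "energy (wgrad \<Omega> (\<lambda>x. H (v x))) \<le> \<gamma> powr p / \<beta> * (LINT x|\<mu>. F x)"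
      by (rule test_energy_le(2)[OF growth degen sol G(1,2) cg(1) gK H(1,2) cg(2) hK hg Cn F(1) F0 Fle])
    have "I = (LINT x|\<mu>. \<bar>H (v x)\<bar> powr q)"
      unfolding I_def
      by (rule integral_cong_AE[symmetric, OF borel_measurable_integrable[OF S(2)[OF HW]] vtm vt])
    then have "I powr (1 / q) \<le> S * energy (wgrad \<Omega> (\<lambda>x. H (v x))) powr (1 / p)" using S(3)[OF HW] by simp
    also have "\<dots> \<le> S * (\<gamma> powr p / \<beta> * (Nf * I powr (1 - 1 / m))) powr (1 / p)"
    proof (intro mult_left_mono powr_mono2 S(1))
      show "energy (wgrad \<Omega> (\<lambda>x. H (v x))) \<le> \<gamma> powr p / \<beta> * (Nf * I powr (1 - 1 / m))"
        using E mult_left_mono[OF F(2) Cn] by linarith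
    qed (use pq in auto)
    finally have "(I powr (1 / q)) powr p \<le> (S * (\<gamma> powr p / \<beta> * (Nf * I powr (1 - 1 / m))) powr (1 / p)) powr p"
      using pq by (intro powr_mono2) auto
    also have "\<dots> = Z * I powr (1 - 1 / m)"
      using pq S(1) Cn \<beta> by (simp add: powr_mult powr_powr Z_def Nf_def mult.assoc)
    finally have le: "I powr (p / q) \<le> Z * I powr (1 - 1 / m)" by (simp add: powr_powr)
    have "I \<le> Z powr (1 / \<delta>)"
    proof (cases "I = 0")
      case False
      have "I powr (p / q) = I powr \<delta> * I powr (1 - 1 / m)" by (simp add: \<delta>_def flip: powr_add)
      then have "I powr \<delta> \<le> Z" using le False I0 by simp
      then have "(I powr \<delta>) powr (1 / \<delta>) \<le> Z powr (1 / \<delta>)" using \<delta> by (intro powr_mono2) auto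
      then show ?thesis using \<delta> I0 by (simp add: powr_powr)
    qed simp
    then show "integrable \<mu> (\<lambda>x. \<bar>v x\<bar> powr t) \<and> (LINT x|\<mu>. \<bar>v x\<bar> powr t) \<le> Z powr (1 / \<delta>)"
      using intv by (simp add: I_def)
  qed
qed

text \<open>The soft truncation satisfies \<open>0 \<le> G' \<le> 1\<close>, hence \<open>\<bar>G'\<bar>\<^sup>p \<le> G'\<close>, so it can serve both as
  test function and in the Sobolev inequality.\<close>

lemma approx_bounded:
  assumes growth: "AE x in \<mu>. \<forall>\<zeta>. norm (A x \<zeta>) \<le> norm \<zeta> powr (p - 1) * w x"
    and degen: "AE x in \<mu>. \<forall>\<zeta>. A x \<zeta> \<bullet> \<zeta> \<ge> norm \<zeta> powr p * w x"
    and f: "f \<in> Lp \<Omega> m" "AE x in \<mu>. f x \<ge> 0"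
    and q: "q > p" and m: "m > q / (q - p)"
    and sob: "sobolev_bound q S"
  obtains d where "\<And>n v. n \<ge> 1 \<Longrightarrow> approx_solution \<Omega> w p A f n v \<Longrightarrow> AE x in \<mu>. v x \<le> d"
proof -
  interpret finite_measure "\<mu>" by (rule finite_measure_dom)
  have S: "S \<ge> 0" "\<And>v. v \<in> W0 \<Longrightarrow> integrable \<mu> (\<lambda>x. \<bar>v x\<bar> powr q)"
    "\<And>v. v \<in> W0 \<Longrightarrow> (LINT x|\<mu>. \<bar>v x\<bar> powr q) powr (1 / q) \<le> S * energy (wgrad \<Omega> v) powr (1 / p)"
    using sob by (auto simp: sobolev_bound_def)
  have pq: "p > 0" "q > 0" using p q by auto
  have "q / (q - p) > 1" using p q by (simp add: field_simps)
  then have m1: "m > 1" using m by linarith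
  \<comment> \<open>Equivalent to \<open>m > q / (q - p)\<close>. The factor
    \<open>1 - 1 / m\<close> will come from Hoelder's inequality on the superlevel set, the factor
    \<open>q / p\<close> from the embedding.\<close>
  have mq: "(1 - 1 / m) * (q / p) > 1"
  proof -
    have "q < m * (q - p)" using m q by (simp add: field_simps)
    then have "p * m < q * (m - 1)" by (simp add: algebra_simps)
    then show ?thesis using m1 pq by (simp add: field_simps)
  qed
  define Nf where "Nf = (LINT x|\<mu>. \<bar>f x\<bar> powr m) powr (1 / m)"
  have intf: "integrable \<mu> (\<lambda>x. \<bar>f x\<bar> powr m)"
    using f(1) by (simp add: Lp_def Lp_weighted_def)
  show ?thesis
  proof (rule that)
    fix n v assume n: "n \<ge> (1 :: nat)" and sol: "approx_solution \<Omega> w p A f n v"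
    have v0: "AE x in \<mu>. v x > 0" using sol by (simp add: approx_solution_def)
    have vm [measurable]: "v \<in> borel_measurable \<mu>"
      using sol by (auto simp: approx_solution_def Linf_def)
    show "AE x in \<mu>. v x \<le> stampacchia_level q ((1 - 1 / m) * (q / p)) (2 powr q * (S powr q * Nf powr (q / p))) (measure \<mu> (space \<mu>))"
    proof (rule AE_le_stampacchia_level[OF vm _ bounded_measure pq(2) mq])
      show "emeasure \<mu> {x \<in> space \<mu>. v x > 0} < \<infinity>" by (simp add: emeasure_eq_measure)
      fix k e :: real assume k: "0 \<le> k" and e: "0 < e"
      define A where "A = {x \<in> space \<mu>. v x > k}"
      have As: "A \<in> sets \<mu>" "emeasure \<mu> A < \<infinity>" unfolding A_def by (measurable, simp add: emeasure_eq_measure)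
      have G: "\<And>t. (soft_excess k e has_real_derivative soft_excess' k e t) (at t)" "soft_excess k e 0 = 0"
        "continuous_on UNIV (soft_excess' k e)" "\<And>t. \<bar>soft_excess' k e t\<bar> \<le> 1"
        using soft_excess_derivative[OF e] soft_excess_bounds(2)[OF e k] soft_excess'_continuous[OF e]
          soft_excess'_bounds(1,2)[OF e, of k] by auto
      have hg: "\<bar>soft_excess' k e t\<bar> powr p \<le> 1 * soft_excess' k e t" for t
        using powr_mono'[of 1 p "soft_excess' k e t"] soft_excess'_bounds(1,2)[OF e, of k t] p by simp
      note F = Hoelder_indicator[OF m1 intf As, folded Nf_def]
      have F0: "AE x in \<mu>. 0 \<le> \<bar>f x\<bar> * indicator A x" by simp
      have Fle: "AE x in \<mu>. min (f x) (real n) / (v x + 1 / real n) * soft_excess k e (v x) \<le> \<bar>f x\<bar> * indicator A x"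
        using f(2) v0 AE_space
      proof eventually_elim
        case (elim x)
        show ?case
        proof (cases "x \<in> A")
          case True
          \<comment> \<open>The truncation, being at most \<open>v x\<close>, cancels the singular
            factor \<open>1 / v x\<close> and leaves \<open>f\<close> on the superlevel set.\<close>
          have "soft_excess k e (v x) \<le> v x"
            using soft_excess_bounds(4)[OF e, of k "v x"] k elim by simp
          then have "min (f x) (real n) / (v x + 1 / real n) * soft_excess k e (v x) \<le> f x / v x * v x"
            using elim n soft_excess_bounds(1)[OF e] by (intro mult_mono frac_le) auto
          then show ?thesis using elim True by simp
        next
          case False
          then have "soft_excess k e (v x) = 0" using elim by (intro soft_excess_bounds(2)[OF e]) (auto simp: A_def)
          then show ?thesis by simp
        qed
      qed
      note T = test_energy_le[OF growth degen sol G G hg _ F(1) F0 Fle]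
      have W: "(\<lambda>x. soft_excess k e (v x)) \<in> W0" by (rule T(1)) simp
      have "energy (wgrad \<Omega> (\<lambda>x. soft_excess k e (v x))) \<le> 1 * (LINT x|\<mu>. \<bar>f x\<bar> * indicator A x)" by (rule T(2)) simp
      then have E: "energy (wgrad \<Omega> (\<lambda>x. soft_excess k e (v x))) \<le> Nf * measure \<mu> A powr (1 - 1 / m)"
        using F(2) by linarith
      show "integrable \<mu> (\<lambda>x. \<bar>soft_excess k e (v x)\<bar> powr q)" by (rule S(2)[OF W])
      define Q where "Q = (LINT x|\<mu>. \<bar>soft_excess k e (v x)\<bar> powr q)"
      have "Q powr (1 / q) \<le> S * energy (wgrad \<Omega> (\<lambda>x. soft_excess k e (v x))) powr (1 / p)"
        unfolding Q_def by (rule S(3)[OF W])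
      also have "\<dots> \<le> S * (Nf * measure \<mu> A powr (1 - 1 / m)) powr (1 / p)"
        using pq by (intro mult_left_mono powr_mono2 E S(1)) auto
      finally have "(Q powr (1 / q)) powr q \<le> (S * (Nf * measure \<mu> A powr (1 - 1 / m)) powr (1 / p)) powr q"
        using pq by (intro powr_mono2) auto
      also have "\<dots> = S powr q * Nf powr (q / p) * measure \<mu> A powr ((1 - 1 / m) * (q / p))"
        by (simp add: powr_mult powr_powr)
      finally show "(LINT x|\<mu>. \<bar>soft_excess k e (v x)\<bar> powr q)
          \<le> S powr q * Nf powr (q / p) * measure \<mu> {x \<in> space \<mu>. v x > k} powr ((1 - 1 / m) * (q / p))"
        using pq by (simp add: powr_powr Q_def A_def)
    qed
  qed
qed

end

section \<open>Choice of exponents and passage to the limit\<close>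

lemma weighted_domain_weight_class:
  assumes \<Omega>: "open \<Omega>" "bounded \<Omega>" and p: "1 < p" and s: "1 / (p - 1) \<le> s" and w: "weight_class \<Omega> p s w"
  shows "weighted_domain \<Omega> w p"
proof -
  have s\<Omega>: "\<Omega> \<in> sets lebesgue" using \<Omega> by auto
  have M: "muckenhoupt p w" and ws: "integrable (lebesgue_on \<Omega>) (\<lambda>x. w x powr (- s))"
    using w by (auto simp: weight_class_def)
  \<comment> \<open>The closure of \<open>\<Omega>\<close> is compact, so local integrability of the
    weight on the whole space suffices.\<close>
  have "w absolutely_integrable_on closure \<Omega>"
    using M \<Omega>(2) by (simp add: muckenhoupt_def locally_integrable_def)
  then have "w absolutely_integrable_on \<Omega>"
    by (rule set_integrable_subset) (use s\<Omega> closure_subset in auto)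
  then have wi: "integrable (lebesgue_on \<Omega>) w"
    using s\<Omega> by (simp add: integrable_restrict_space set_integrable_def)
  have wp: "AE x in lebesgue_on \<Omega>. w x > 0"
    using M s\<Omega> by (auto simp: muckenhoupt_def AE_restrict_space_iff elim: eventually_mono)
  have "finite_measure (lebesgue_on \<Omega>)"
    using \<Omega> by (intro finite_measure_lebesgue_on bounded_set_imp_lmeasurable s\<Omega>)
  then have "integrable (lebesgue_on \<Omega>) (\<lambda>x. w x powr (- (1 / (p - 1))))"
    by (rule integrable_negative_power[OF _ borel_measurable_integrable[OF wi] wp ws]) (use p s in auto)
  then have "integrable (lebesgue_on \<Omega>) (\<lambda>x. w x powr (- 1 / (p - 1)))" by simp
  then show ?thesis using \<Omega> p wi wp by unfold_locales
qed

theorem theorem3p5: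
  fixes \<Omega> :: "(real ^ 'n) set"
    and p s :: real
    and w f u :: "real ^ 'n \<Rightarrow> real"
    and A :: "real ^ 'n \<Rightarrow> real ^ 'n \<Rightarrow> real ^ 'n"
    and un :: "nat \<Rightarrow> real ^ 'n \<Rightarrow> real"
  defines "N \<equiv> real CARD('n)"
  defines "ps \<equiv> p_sub p s"
  defines "ps_star \<equiv> sobolev_conj N ps"
  assumes "CARD('n) \<ge> 2"
    and "bounded_smooth_domain \<Omega>"
    and "1 < p"
    and "1 / (p - 1) \<le> s" and "N / p < s"
    and "weight_class \<Omega> p s w"
    and "structural_conditions \<Omega> w p A"
    and "f \<in> Lp \<Omega> 1"
    and "AE x in lebesgue_on \<Omega>. f x \<ge> 0"
    and "\<not> (AE x in lebesgue_on \<Omega>. f x = 0)"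
    and "\<And>n. n \<ge> 1 \<Longrightarrow> approx_solution \<Omega> w p A f n (un n)"
    and "AE x in lebesgue_on \<Omega>. (\<lambda>n. un n x) \<longlonglongrightarrow> u x"
    and "u \<in> W01p \<Omega> w p"
    and "weak_solution \<Omega> w p A f u"
  shows
    "(1 \<le> ps \<and> ps < N \<longrightarrow>
        (\<forall>m. 1 < m \<and> m < ps_star / (ps_star - p) \<and> f \<in> Lp \<Omega> m \<longrightarrow>
           (let \<gamma> = p * hoelder_conj m / (p * hoelder_conj m - ps_star)
            in u \<in> Lp \<Omega> (ps_star * \<gamma>))) \<and>
        (\<forall>m. m > ps_star / (ps_star - p) \<and> f \<in> Lp \<Omega> m \<longrightarrow> u \<in> Linf \<Omega>)) \<and>
     (ps = N \<longrightarrow>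
        (\<forall>q>p. \<forall>m. 1 < m \<and> m < q / (q - p) \<and> f \<in> Lp \<Omega> m \<longrightarrow>
           (let \<gamma> = p * hoelder_conj m / (p * hoelder_conj m - q)
            in u \<in> Lp \<Omega> (q * \<gamma>)))) \<and>
     (ps > N \<longrightarrow> u \<in> Linf \<Omega>)"
proof -
  have \<Omega>: "open \<Omega>" "bounded \<Omega>" using assms(5) by (auto simp: bounded_smooth_domain_def)
  interpret weighted_domain \<Omega> w p
    by (rule weighted_domain_weight_class[OF \<Omega> assms(6,7,9)])
  have dim: "DIM(real ^ 'n) \<ge> 2" and N: "N = real DIM(real ^ 'n)" "N \<ge> 2"
    using assms(4) by (simp_all add: N_def)
  have s: "s > 0" using assms(7) p by (smt (verit) divide_pos_pos)
  have ws: "integrable (lebesgue_on \<Omega>) (\<lambda>x. w x powr (- s))" using assms(9) by (simp add: weight_class_def)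
  have growth: "AE x in lebesgue_on \<Omega>. \<forall>\<zeta>. norm (A x \<zeta>) \<le> norm \<zeta> powr (p - 1) * w x"
    and degen: "AE x in lebesgue_on \<Omega>. \<forall>\<zeta>. A x \<zeta> \<bullet> \<zeta> \<ge> norm \<zeta> powr p * w x"
    using assms(10) by (auto simp: structural_conditions_def)
  note f0 = assms(12)
  \<comment> \<open>The index is shifted because the approximating solutions are given for
    \<open>n \<ge> 1\<close> only.\<close>
  have sol: "approx_solution \<Omega> w p A f (Suc k) (un (Suc k))" for k using assms(14) by simp
  have lim: "AE x in lebesgue_on \<Omega>. (\<lambda>k. un (Suc k) x) \<longlonglongrightarrow> u x"
    using assms(15) by eventually_elim (rule LIMSEQ_Suc)
  have um: "u \<in> borel_measurable (lebesgue_on \<Omega>)"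
    using assms(16) by (auto simp: W01p_def intro: Lp_weightedD W1p_D)
  have u0: "AE x in lebesgue_on \<Omega>. u x > 0" using assms(17) by (simp add: weak_solution_def)
  have ps: "ps = p * s / (s + 1)" by (simp add: ps_def p_sub_def)
  have psp: "ps < p" using s p by (simp add: ps field_simps)
  have Linf: "u \<in> Linf \<Omega>" if "AE x in lebesgue_on \<Omega>. u x \<le> d" for d
  proof -
    have "AE x in lebesgue_on \<Omega>. \<bar>u x\<bar> \<le> d" using that u0 by eventually_elim simp
    then show ?thesis using um by (auto simp: Linf_def)
  qed
  have power: "u \<in> Lp \<Omega> (q * (p * hoelder_conj m / (p * hoelder_conj m - q)))"
    if q: "q > p" and m: "1 < m" "m < q / (q - p)" and f: "f \<in> Lp \<Omega> m"
      and S: "sobolev_bound q S"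
    for q m S
  proof -
    define t where "t = q * (p * hoelder_conj m / (p * hoelder_conj m - q))"
    have "\<exists>B. \<forall>n v. n \<ge> 1 \<longrightarrow> approx_solution \<Omega> w p A f n v \<longrightarrow>
        integrable (lebesgue_on \<Omega>) (\<lambda>x. \<bar>v x\<bar> powr t) \<and> (LINT x|lebesgue_on \<Omega>. \<bar>v x\<bar> powr t) \<le> B"
      unfolding t_def by (rule approx_power_bound[OF growth degen f f0 q m S]) blast
    then obtain B where B: "\<And>n v. n \<ge> 1 \<Longrightarrow> approx_solution \<Omega> w p A f n v \<Longrightarrow>
        integrable (lebesgue_on \<Omega>) (\<lambda>x. \<bar>v x\<bar> powr t) \<and> (LINT x|lebesgue_on \<Omega>. \<bar>v x\<bar> powr t) \<le> B"
      by blast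
    \<comment> \<open>Positivity of \<open>u\<close> gives a nonzero limit, at which
      \<open>powr\<close> is continuous in its base whatever the sign of \<open>t\<close>.\<close>
    have lim': "AE x in lebesgue_on \<Omega>. (\<lambda>k. \<bar>un (Suc k) x\<bar> powr t) \<longlonglongrightarrow> \<bar>u x\<bar> powr t"
      using lim u0
    proof eventually_elim
      case (elim x)
      then show ?case by (intro tendsto_powr tendsto_intros) auto
    qed
    have utm: "(\<lambda>x. \<bar>u x\<bar> powr t) \<in> borel_measurable (lebesgue_on \<Omega>)" using um by measurable
    have "integrable (lebesgue_on \<Omega>) (\<lambda>x. \<bar>u x\<bar> powr t)"
      by (rule integral_le_of_tendsto(1)[OF _ _ utm lim' _ tendsto_const[of B]]) (use B sol in auto)
    then show ?thesis using um by (simp add: Lp_def Lp_weighted_def t_def)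
  qed
  have a: "(1 < m \<and> m < ps_star / (ps_star - p) \<longrightarrow> u \<in> Lp \<Omega> (ps_star * (p * hoelder_conj m / (p * hoelder_conj m - ps_star))))
      \<and> (m > ps_star / (ps_star - p) \<longrightarrow> u \<in> Linf \<Omega>)"
    if r: "1 \<le> ps" "ps < N" and f: "f \<in> Lp \<Omega> m" for m
  proof -
    have st: "ps_star = N * ps / (N - ps)" by (simp add: ps_star_def sobolev_conj_def)
    \<comment> \<open>Given \<open>ps < N\<close>, this is the condition \<open>N / p < s\<close> in
      another form.\<close>
    have gt: "ps_star > p"
    proof -
      have "N < s * p" using assms(8) p by (simp add: field_simps)
      then have "N * (s + 1) < s * (N + p)" by (simp add: algebra_simps)
      then have "p * (N * (s + 1)) < p * (s * (N + p))" using p by simp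
      then have "p * N < ps * (N + p)" using s by (simp add: ps field_simps)
      then show ?thesis using r by (simp add: st field_simps)
    qed
    obtain S where S: "sobolev_bound ps_star S"
      by (rule W01p_sobolev[OF s ws dim r[unfolded ps N(1)], folded ps N(1), folded st])
    have "u \<in> Linf \<Omega>" if m: "m > ps_star / (ps_star - p)"
    proof -
      have "\<exists>d. \<forall>n v. n \<ge> 1 \<longrightarrow> approx_solution \<Omega> w p A f n v \<longrightarrow> (AE x in lebesgue_on \<Omega>. v x \<le> d)"
        by (rule approx_bounded[OF growth degen f f0 gt m S]) blast
      then obtain d where d: "\<And>n v. n \<ge> 1 \<Longrightarrow> approx_solution \<Omega> w p A f n v \<Longrightarrow> AE x in lebesgue_on \<Omega>. v x \<le> d"
        by blast
      have "AE x in lebesgue_on \<Omega>. \<forall>k. un (Suc k) x \<le> d"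
        using d[OF _ sol] by (simp add: AE_all_countable)
      with lim have "AE x in lebesgue_on \<Omega>. u x \<le> d"
        by eventually_elim (auto intro: LIMSEQ_le_const2)
      then show ?thesis by (rule Linf)
    qed
    then show ?thesis using power[OF gt _ _ f S] by blast
  qed
  have b: "u \<in> Lp \<Omega> (q * (p * hoelder_conj m / (p * hoelder_conj m - q)))"
    if psN: "ps = N" and q: "q > p" and m: "1 < m" "m < q / (q - p)" and f: "f \<in> Lp \<Omega> m" for q m
  proof -
    \<comment> \<open>\<open>r\<close> is the exponent whose Sobolev conjugate is \<open>q\<close>,
      and \<open>\<sigma>\<close> solves \<open>p * \<sigma> / (\<sigma> + 1) = r\<close>. Since
      \<open>r < N = ps\<close>, it follows that \<open>\<sigma> \<le> s\<close>, so the lowered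
      power of the weight is still integrable.\<close>
    define r where "r = N * q / (N + q)"
    define \<sigma> where "\<sigma> = r / (p - r)"
    have q2: "q > 2" using q psp psN N by simp
    have rN: "r < N" using N q2 by (simp add: r_def field_simps)
    have r0: "r > 0" using N q2 by (simp add: r_def)
    \<comment> \<open>This amounts to \<open>r \<ge> 1\<close>, the range of the Sobolev inequality.
      It can be read as \<open>(N - 1) * (q - 1) \<ge> 1\<close>, and
      \<open>q > p > ps = N \<ge> 2\<close>.\<close>
    have "N + q \<le> N * q"
    proof -
      have "1 * 1 \<le> (N - 1) * (q - 1)" using N q2 by (intro mult_mono) auto
      then show ?thesis by (simp add: algebra_simps)
    qed
    then have r1: "1 \<le> r" using N q2 by (simp add: r_def)
    have \<sigma>: "\<sigma> > 0" using r0 rN psN psp by (simp add: \<sigma>_def)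
    have r\<sigma>: "p * \<sigma> / (\<sigma> + 1) = r" using rN psN psp p by (simp add: \<sigma>_def field_simps)
    have "\<sigma> \<le> s"
    proof -
      have "p * \<sigma> / (\<sigma> + 1) \<le> p * s / (s + 1)" using rN psN by (simp add: r\<sigma> flip: ps)
      then have "p * (\<sigma> * (s + 1)) \<le> p * (s * (\<sigma> + 1))" using \<sigma> s by (simp add: field_simps)
      then have "\<sigma> * (s + 1) \<le> s * (\<sigma> + 1)" using p by simp
      then show ?thesis by (simp add: algebra_simps)
    qed
    then have w\<sigma>: "integrable (lebesgue_on \<Omega>) (\<lambda>x. w x powr (- \<sigma>))"
      by (rule integrable_negative_power[OF finite_measure_dom w_measurable w_pos ws \<sigma>])
    have rq: "N * r / (N - r) = q"
    proof -
      have "N - r = N * N / (N + q)" using N q2 by (simp add: r_def field_simps)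
      then show ?thesis using N q2 by (simp add: r_def)
    qed
    obtain S where S: "sobolev_bound q S"
      by (rule W01p_sobolev[OF \<sigma> w\<sigma> dim, unfolded r\<sigma>, folded N(1), OF r1 rN, unfolded rq])
    show ?thesis by (rule power[OF q m f S])
  qed
  have c: "u \<in> Linf \<Omega>" if gt: "ps > N"
  proof -
    \<comment> \<open>The bound is applied to \<open>u\<close> itself as an element of the space,
      instead of being carried over from the \<open>un\<close>.\<close>
    obtain d where "AE x in lebesgue_on \<Omega>. u x \<le> d"
      by (rule W01p_bounded_above[OF s ws dim gt[unfolded ps N(1)] assms(16)])
    then show ?thesis by (rule Linf)
  qed
  show ?thesis
    unfolding Let_def using a b c by blast
qed

end
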